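(* Let $N\geq 10$, let $B_1$ be the open unit ball of $\mathbb{R}^N$, and let $\varphi:(0,1)\to\mathbb{R}^+$ satisfy $\lim_{r\to 0}\varphi(r)=+\infty$. Then there exists $f\in C^\infty([0,+\infty))$ which is nondecreasing and convex with $f(0)>0$ and $\lim_{t\to+\infty} f(t)/t=+\infty$, such that the extremal solution $u^\ast$ of the problem $-\Delta u=\lambda f(u)$ in $B_1$, $u>0$ in $B_1$, $u=0$ on $\partial B_1$, is unbounded and $$\liminf_{r\to 0}\frac{f'(u^\ast(r))}{\varphi(r)}=0.$$
   Context: $\mathbb{R}^+$ denotes the positive reals. For $f:[0,\infty)\to\mathbb{R}$ which is $C^1$, nondecreasing and convex with $f(0)>0$ and $\lim_{t\to+\infty}f(t)/t=+\infty$, consider for $\lambda\ge 0$ the problem $(P_\lambda)$: $-\Delta u=\lambda f(u)$ in $B_1$, $u>0$ in $B_1$, $u=0$ on $\partial B_1$. It is well known that there is a finite number $\lambda^\ast>0$ (the extremal parameter) such that for $0<\lambda<\lambda^\ast$ the problem $(P_\lambda)$ has a minimal (i.e. pointwise smallest) classical solution $u_\lambda\in C^0(\overline{B_1})\cap C^2(B_1)$, while for $\lambda>\lambda^\ast$ there is no solution, even in the weak sense. The functions $u_\lambda$ are increasing in $\lambda$, and the extremal solution is the pointwise limit $u^\ast(x):=\lim_{\lambda\uparrow\lambda^\ast}u_\lambda(x)$, a weak solution of $(P_{\lambda^\ast})$. On the ball, $u^\ast$ is radially symmetric and radially decreasing; $u^\ast(r)$ denotes its value at points with $|x|=r$. 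*)

theory Defs
  imports "HOL-Analysis.Analysis"
begin

(* C^infinity on the closed half-line: D k is the k-th derivative, one-sided at 0.
   Values of f on the negative reals are irrelevant. *)
definition smooth_on_halfline :: "(real \<Rightarrow> real) \<Rightarrow> bool" where
  "smooth_on_halfline f \<longleftrightarrow>
     (\<exists>D :: nat \<Rightarrow> real \<Rightarrow> real.
        (\<forall>t\<ge>0. D 0 t = f t) \<and>
        (\<forall>k. \<forall>t\<ge>0. (D k has_real_derivative D (Suc k) t) (at t within {0..})))"

definition partial_deriv :: "'a::euclidean_space \<Rightarrow> ('a \<Rightarrow> real) \<Rightarrow> 'a \<Rightarrow> real" where
  "partial_deriv b u x = deriv (\<lambda>t. u (x + t *\<^sub>R b)) 0"

definition C1_on :: "'a::euclidean_space set \<Rightarrow> ('a \<Rightarrow> real) \<Rightarrow> bool" where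
  "C1_on S u \<longleftrightarrow> continuous_on S u \<and>
     (\<forall>b\<in>Basis. (\<forall>x\<in>S. (\<lambda>t. u (x + t *\<^sub>R b)) field_differentiable at 0) \<and>
                continuous_on S (partial_deriv b u))"

definition C2_on :: "'a::euclidean_space set \<Rightarrow> ('a \<Rightarrow> real) \<Rightarrow> bool" where
  "C2_on S u \<longleftrightarrow> C1_on S u \<and> (\<forall>b\<in>Basis. C1_on S (partial_deriv b u))"

definition laplacian :: "('a::euclidean_space \<Rightarrow> real) \<Rightarrow> 'a \<Rightarrow> real" where
  "laplacian u x = (\<Sum>b\<in>Basis. partial_deriv b (partial_deriv b u) x)"

definition extends_continuously :: "'a::euclidean_space set \<Rightarrow> ('a \<Rightarrow> real) \<Rightarrow> bool" where
  "extends_continuously S g \<longleftrightarrow>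
     (\<exists>h. continuous_on (closure S) h \<and> (\<forall>x\<in>S. h x = g x))"

(* The space C^2 of the closure of S: all derivatives of order at most two extend
   continuously up to the boundary. *)
definition C2_upto_boundary :: "'a::euclidean_space set \<Rightarrow> ('a \<Rightarrow> real) \<Rightarrow> bool" where
  "C2_upto_boundary S u \<longleftrightarrow> C2_on S u \<and> continuous_on (closure S) u \<and>
     (\<forall>b\<in>Basis. extends_continuously S (partial_deriv b u)) \<and>
     (\<forall>b\<in>Basis. \<forall>c\<in>Basis. extends_continuously S (partial_deriv c (partial_deriv b u)))"

(* Below, S is the domain and the problem is
   -Laplacian u = lam f(u) in S, u > 0 in S, u = 0 on the boundary of S. *)
definition classical_solution ::
  "'a::euclidean_space set \<Rightarrow> (real \<Rightarrow> real) \<Rightarrow> real \<Rightarrow> ('a \<Rightarrow> real) \<Rightarrow> bool" where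
  "classical_solution S f lam u \<longleftrightarrow>
     continuous_on (closure S) u \<and> C2_on S u \<and>
     (\<forall>x\<in>S. - laplacian u x = lam * f (u x)) \<and>
     (\<forall>x\<in>S. u x > 0) \<and>
     (\<forall>x\<in>frontier S. u x = 0)"

definition minimal_solution ::
  "'a::euclidean_space set \<Rightarrow> (real \<Rightarrow> real) \<Rightarrow> real \<Rightarrow> ('a \<Rightarrow> real) \<Rightarrow> bool" where
  "minimal_solution S f lam u \<longleftrightarrow> classical_solution S f lam u \<and>
     (\<forall>v. classical_solution S f lam v \<longrightarrow> (\<forall>x\<in>closure S. u x \<le> v x))"

(* Weak solutions in the usual L^1 sense (Brezis, Cazenave, Martel, Ramiandrisoa):
   u and f(u) * dist(., boundary) are integrable, and the equation is tested against
   C^2 functions up to the boundary that vanish on the boundary. *)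
definition weak_solution ::
  "'a::euclidean_space set \<Rightarrow> (real \<Rightarrow> real) \<Rightarrow> real \<Rightarrow> ('a \<Rightarrow> real) \<Rightarrow> bool" where
  "weak_solution S f lam u \<longleftrightarrow>
     set_integrable lebesgue S u \<and>
     (AE x in lebesgue. x \<in> S \<longrightarrow> u x \<ge> 0) \<and>
     set_integrable lebesgue S (\<lambda>x. f (u x) * infdist x (frontier S)) \<and>
     (\<forall>z. C2_upto_boundary S z \<and> (\<forall>x\<in>frontier S. z x = 0) \<longrightarrow>
        - (LINT x:S|lebesgue. u x * laplacian z x) =
        lam * (LINT x:S|lebesgue. f (u x) * z x))"

definition extremal_parameter ::
  "'a::euclidean_space set \<Rightarrow> (real \<Rightarrow> real) \<Rightarrow> real \<Rightarrow> bool" where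
  "extremal_parameter S f lamstar \<longleftrightarrow> lamstar > 0 \<and>
     (\<forall>lam. 0 < lam \<and> lam < lamstar \<longrightarrow> (\<exists>u. minimal_solution S f lam u)) \<and>
     (\<forall>lam. lam > lamstar \<longrightarrow>
        \<not> (\<exists>u. classical_solution S f lam u) \<and> \<not> (\<exists>u. weak_solution S f lam u))"

(* The pointwise limit is taken in the extended reals: an unbounded radially decreasing
   extremal solution has the value infinity at the origin. *)
definition extremal_solution ::
  "'a::euclidean_space set \<Rightarrow> (real \<Rightarrow> real) \<Rightarrow> ('a \<Rightarrow> ereal) \<Rightarrow> bool" where
  "extremal_solution S f ustar \<longleftrightarrow>
     (\<exists>lamstar ul. extremal_parameter S f lamstar \<and>
        (\<forall>lam. 0 < lam \<and> lam < lamstar \<longrightarrow> minimal_solution S f lam (ul lam)) \<and>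
        (\<forall>x\<in>closure S. ((\<lambda>lam. ereal (ul lam x)) \<longlongrightarrow> ustar x) (at_left lamstar)))"

end

theory Submission
  imports Defs
begin

text \<open>
  Write radial functions as functions of \<open>t = |x|\<^sup>2\<close>, so that the Laplacian becomes
  \<open>4 t Y'' + 2 N Y'\<close>. The singular solution \<open>W\<close> (with \<open>\<lambda>\<^sup>* = 1\<close>) is prescribed first and \<open>f\<close> is
  defined by \<open>f(W) = - \<Delta> W\<close>. We take \<open>W' = - P\<close> with \<open>P' / P = - q\<close> and
  \<open>q(t) = \<Sum>\<^sub>n (1 / (t + A\<^sub>n) - 1 / (t + B\<^sub>n))\<close> for very sparse scales \<open>B\<^sub>0 > A\<^sub>0 \<ge> B\<^sub>1 > A\<^sub>1 \<ge> \<dots>\<close>.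
  Between \<open>B\<^sub>n\<close> and \<open>A\<^sub>n\<close> the profile \<open>W\<close> grows like \<open>log (1 / t)\<close>, while between \<open>A\<^sub>n\<close> and
  \<open>B\<^sub>n\<^sub>+\<^sub>1\<close> the function \<open>q\<close>, and with it \<open>f'(W) \<le> (2 N + 4) q\<close>, is nearly constant; taking \<open>B\<^sub>n\<^sub>+\<^sub>1\<close> tiny
  keeps \<open>f'(W)\<close> below \<open>\<phi>\<close> somewhere. Since \<open>t q < 1\<close> and \<open>N \<ge> 10\<close>, the function \<open>f\<close> is convex and
  \<open>\<psi> = P / t\<close> is a strict positive supersolution of the linearised operator \<open>- \<Delta> - f'(W)\<close>.

  For \<open>\<lambda> < 1\<close> the bounded function \<open>W (\<lambda> t + 1 - \<lambda>)\<close> is a supersolution because \<open>W\<close> is convex in \<open>t\<close>,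
  so the Picard iterates converge to the minimal solution \<open>u\<^sub>\<lambda>\<close>; comparison with \<open>\<psi>\<close> gives
  \<open>0 \<le> W - u\<^sub>\<lambda> \<le> C (1 - \<lambda>) \<psi>\<close>. A classical or weak solution for some \<open>\<lambda> > 1\<close> dominates the iterates for
  that \<open>\<lambda>\<close> (weak solutions need not be radial: the comparison is made against radial test functions,
  using tangent lines of \<open>f\<close>). The same affine change of \<open>t\<close> then bounds the iterates for \<open>\<lambda> = 1\<close>
  uniformly, hence all \<open>u\<^sub>\<lambda>\<close> with \<open>\<lambda> < 1\<close>, contradicting \<open>u\<^sub>\<lambda> \<rightarrow> W\<close>.
\<close>

subsection \<open>Radial functions as functions of the squared norm\<close>

lemma DERIV_chain_within:
  fixes f g :: "real \<Rightarrow> real"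
  assumes "(f has_real_derivative E) (at (g x) within T)" "(g has_real_derivative D) (at x within S)"
    "g ` S \<subseteq> T"
  shows "((\<lambda>x. f (g x)) has_real_derivative E * D) (at x within S)"
  using DERIV_image_chain[OF has_field_derivative_subset[OF assms(1,3)] assms(2)]
  by (simp add: o_def)

text \<open>The derivative is an argument, so that second derivatives are expressed by chaining
  \<open>C1_unit Y Y1\<close> and \<open>C1_unit Y1 Y2\<close>. It is one-sided at \<open>0\<close>
  and \<open>1\<close>, which stand for the centre and the boundary of the ball.\<close>

definition C1_unit :: "(real \<Rightarrow> real) \<Rightarrow> (real \<Rightarrow> real) \<Rightarrow> bool" where
  "C1_unit v v' \<longleftrightarrow>
     (\<forall>t\<in>{0..1}. (v has_real_derivative v' t) (at t within {0..1})) \<and> continuous_on {0..1} v'"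

lemma C1_unitD: "C1_unit v v' \<Longrightarrow> t \<in> {0..1} \<Longrightarrow> (v has_real_derivative v' t) (at t within {0..1})"
  by (simp add: C1_unit_def)

lemma C1_unit_cont': "C1_unit v v' \<Longrightarrow> continuous_on {0..1} v'"
  by (simp add: C1_unit_def)

lemma C1_unit_cont: "C1_unit v v' \<Longrightarrow> continuous_on {0..1} v"
  by (meson C1_unitD DERIV_continuous continuous_on_eq_continuous_within)

lemma C1_unit_const: "C1_unit (\<lambda>_. c) (\<lambda>_. 0)"
  by (simp add: C1_unit_def)

lemma C1_unit_cmult:
  assumes "C1_unit v v'"
  shows "C1_unit (\<lambda>t. c * v t) (\<lambda>t. c * v' t)"
  unfolding C1_unit_def
  by (intro conjI ballI DERIV_cmult C1_unitD[OF assms] continuous_on_mult_left C1_unit_cont'[OF assms])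

lemma C1_unit_affine_comp:
  assumes "C1_unit v v'" "0 \<le> k" "k \<le> 1"
  shows "C1_unit (\<lambda>t. v (k * t + (1 - k))) (\<lambda>t. k * v' (k * t + (1 - k)))"
proof -
  have im: "k * t + (1 - k) \<in> {0..1}" if "t \<in> {0..1}" for t
  proof -
    have "k * t \<ge> 0" "k * t \<le> k" using assms that by (auto simp: mult_left_le)
    then show ?thesis using assms by auto
  qed
  have "((\<lambda>t. v (k * t + (1 - k))) has_real_derivative v' (k * t + (1 - k)) * k) (at t within {0..1})"
    if "t \<in> {0..1}" for t
    by (rule DERIV_chain_within[where f = v and T = "{0..1}" and g = "\<lambda>t. k * t + (1 - k)", OF C1_unitD[OF assms(1) im[OF that]]])
       (use im in \<open>auto intro!: derivative_eq_intros\<close>)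
  moreover have "continuous_on {0..1} (\<lambda>t. v' (k * t + (1 - k)))"
    by (rule continuous_on_compose2[OF C1_unit_cont'[OF assms(1)]]) (use im in \<open>auto intro!: continuous_intros\<close>)
  ultimately show ?thesis
    unfolding C1_unit_def by (auto intro!: continuous_intros simp: mult.commute)
qed

lemma inner_self_less_1: "norm x < 1 \<Longrightarrow> (x::'a::real_inner) \<bullet> x < 1"
  by (simp add: dot_square_norm abs_square_less_1)

lemma inner_self_le_1: "norm x \<le> 1 \<Longrightarrow> (x::'a::real_inner) \<bullet> x \<le> 1"
  by (simp add: dot_square_norm abs_square_le_1)

lemma has_derivative_radial_along:
  fixes x b :: "'a::euclidean_space"
  assumes "C1_unit Y Y1" "norm x < 1" 
  shows "((\<lambda>t. Y ((x + t *\<^sub>R b) \<bullet> (x + t *\<^sub>R b))) has_real_derivative 2 * (x \<bullet> b) * Y1 (x \<bullet> x)) (at 0)"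
proof -
  let ?g = "\<lambda>t. (x + t *\<^sub>R b) \<bullet> (x + t *\<^sub>R b)"
  \<comment> \<open>For these parameters the point stays in the ball, so the squared norm stays in
    the unit interval, where \<open>Y\<close> is differentiable.\<close>
  let ?S = "{t. norm (x + t *\<^sub>R b) < 1}"
  have op: "open ?S" by (intro open_Collect_less continuous_intros)
  have 0: "0 \<in> ?S" using assms by simp
  have "((\<lambda>t. Y (?g t)) has_real_derivative Y1 (?g 0) * (2 * (x \<bullet> b))) (at 0 within ?S)"
  proof (rule DERIV_chain_within[where f = Y and g = ?g and T = "{0..1}"])
    show "(Y has_real_derivative Y1 (?g 0)) (at (?g 0) within {0..1})"
      using assms inner_self_le_1[of x] by (intro C1_unitD) auto
    have "?g = (\<lambda>t. x \<bullet> x + 2 * t * (x \<bullet> b) + t^2 * (b \<bullet> b))"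
      by (auto simp: algebra_simps inner_commute power2_eq_square)
    then show "(?g has_real_derivative 2 * (x \<bullet> b)) (at 0 within ?S)"
      by (auto intro!: derivative_eq_intros)
    show "?g ` ?S \<subseteq> {0..1}" using inner_self_le_1[of "x + _ *\<^sub>R b"] by (auto simp del: inner_simps)
  qed
  then show ?thesis using at_within_open[OF 0 op] by (simp add: mult.commute)
qed

lemma continuous_on_radial:
  fixes S :: "'a::euclidean_space set"
  assumes "continuous_on {0..1} v" "S \<subseteq> cball 0 1"
  shows "continuous_on S (\<lambda>x. v (x \<bullet> x))"
  by (rule continuous_on_compose2[OF assms(1)])
     (use assms(2) in \<open>auto intro!: continuous_intros inner_self_le_1 simp: subset_iff\<close>)

context
  fixes Y Y1 Y2 :: "real \<Rightarrow> real"
  assumes Y: "C1_unit Y Y1" and Y1: "C1_unit Y1 Y2"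
begin

lemma partial_deriv_radial:
  fixes x b :: "'a::euclidean_space"
  assumes "norm x < 1"
  shows "partial_deriv b (\<lambda>x. Y (x \<bullet> x)) x = 2 * (x \<bullet> b) * Y1 (x \<bullet> x)"
  unfolding partial_deriv_def by (intro DERIV_imp_deriv has_derivative_radial_along Y assms)

lemma has_derivative_partial_deriv_radial:
  fixes x b c :: "'a::euclidean_space"
  assumes "norm x < 1"
  shows "((\<lambda>t. partial_deriv b (\<lambda>x. Y (x \<bullet> x)) (x + t *\<^sub>R c)) has_real_derivative
     2 * (c \<bullet> b) * Y1 (x \<bullet> x) + 4 * (x \<bullet> b) * (x \<bullet> c) * Y2 (x \<bullet> x)) (at 0)"
proof -
  let ?S = "{t. norm (x + t *\<^sub>R c) < 1}"
  have op: "open ?S" by (intro open_Collect_less continuous_intros)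
  have 0: "0 \<in> ?S" using assms by simp
  have "((\<lambda>t. 2 * ((x + t *\<^sub>R c) \<bullet> b) * Y1 ((x + t *\<^sub>R c) \<bullet> (x + t *\<^sub>R c))) has_real_derivative
     2 * (c \<bullet> b) * Y1 (x \<bullet> x) + 4 * (x \<bullet> b) * (x \<bullet> c) * Y2 (x \<bullet> x)) (at 0)"
    unfolding inner_add_left inner_scaleR_left
    by (rule derivative_eq_intros has_derivative_radial_along[OF Y1 assms, unfolded inner_add_left inner_scaleR_left] refl)+
       (simp add: algebra_simps)
  then show ?thesis
    by (rule has_field_derivative_transform_within_open[OF _ op 0]) (auto simp: partial_deriv_radial)
qed

lemma partial_deriv2_radial:
  fixes x b c :: "'a::euclidean_space"
  assumes "norm x < 1"
  shows "partial_deriv c (partial_deriv b (\<lambda>x. Y (x \<bullet> x))) x =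
     2 * (c \<bullet> b) * Y1 (x \<bullet> x) + 4 * (x \<bullet> b) * (x \<bullet> c) * Y2 (x \<bullet> x)"
  unfolding partial_deriv_def[of c] by (intro DERIV_imp_deriv has_derivative_partial_deriv_radial assms)

text \<open>The explicit formulas for the derivatives are continuous on the closed ball. This is the
  regularity required both of classical solutions and of test functions for weak solutions.\<close>

lemma C2_upto_boundary_radial:
  "C2_upto_boundary (ball 0 1) (\<lambda>x::'a::euclidean_space. Y (x \<bullet> x))"
proof -
  note cY = continuous_on_radial[OF C1_unit_cont[OF Y]]
   and cY1 = continuous_on_radial[OF C1_unit_cont[OF Y1]]
   and cY2 = continuous_on_radial[OF C1_unit_cont'[OF Y1]]
  let ?u = "\<lambda>x::'a. Y (x \<bullet> x)"
  have c1: "continuous_on S (\<lambda>x. 2 * (x \<bullet> b) * Y1 (x \<bullet> x))" if "S \<subseteq> cball 0 1" for S and b :: 'a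
    by (intro continuous_intros cY1 that)
  have c2: "continuous_on S (\<lambda>x. 2 * (c \<bullet> b) * Y1 (x \<bullet> x) + 4 * (x \<bullet> b) * (x \<bullet> c) * Y2 (x \<bullet> x))"
    if "S \<subseteq> cball 0 1" for S and b c :: 'a
    by (intro continuous_intros cY1 cY2 that)
  have p1: "continuous_on (ball 0 1) (partial_deriv b ?u)" for b
    using c1[of "ball 0 1" b] by (rule continuous_on_eq) (auto simp: partial_deriv_radial)
  have p2: "continuous_on (ball 0 1) (partial_deriv c (partial_deriv b ?u))" for b c
    using c2[of "ball 0 1" c b] by (rule continuous_on_eq) (auto simp: partial_deriv2_radial)
  have "C1_on (ball 0 1) ?u"
    unfolding C1_on_def using p1 cY[of "ball 0 1"] has_derivative_radial_along[OF Y]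
    by (auto simp: field_differentiable_def intro!: exI)
  moreover have "C1_on (ball 0 1) (partial_deriv b ?u)" for b
    unfolding C1_on_def using p1 p2 has_derivative_partial_deriv_radial
    by (auto simp: field_differentiable_def intro!: exI)
  ultimately have "C2_on (ball 0 1) ?u" by (simp add: C2_on_def)
  moreover have "extends_continuously (ball 0 1) (partial_deriv b ?u)" for b
    unfolding extends_continuously_def
    using c1[of "cball 0 1" b] by (intro exI[of _ "\<lambda>x. 2 * (x \<bullet> b) * Y1 (x \<bullet> x)"]) (auto simp: partial_deriv_radial)
  moreover have "extends_continuously (ball 0 1) (partial_deriv c (partial_deriv b ?u))" for b c
    unfolding extends_continuously_def
    using c2[of "cball 0 1" c b]
    by (intro exI[of _ "\<lambda>x. 2 * (c \<bullet> b) * Y1 (x \<bullet> x) + 4 * (x \<bullet> b) * (x \<bullet> c) * Y2 (x \<bullet> x)"])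
       (auto simp: partial_deriv2_radial)
  ultimately show ?thesis
    unfolding C2_upto_boundary_def using cY[of "cball 0 1"] by simp
qed

text \<open>Each basis vector contributes \<open>2 * Y1\<close> and
  \<open>4 * (x \<bullet> b)^2 * Y2\<close>; the squares sum to
  \<open>x \<bullet> x\<close>.\<close>

lemma laplacian_radial:
  fixes x :: "'a::euclidean_space"
  assumes "norm x < 1"
  shows "laplacian (\<lambda>x. Y (x \<bullet> x)) x = 4 * (x \<bullet> x) * Y2 (x \<bullet> x) + 2 * DIM('a) * Y1 (x \<bullet> x)"
proof -
  have "laplacian (\<lambda>x. Y (x \<bullet> x)) x
      = (\<Sum>b\<in>Basis. 2 * Y1 (x \<bullet> x) + 4 * Y2 (x \<bullet> x) * ((x \<bullet> b) * (x \<bullet> b)))"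
    unfolding laplacian_def by (intro sum.cong refl) (simp add: partial_deriv2_radial assms inner_same_Basis)
  also have "\<dots> = 2 * DIM('a) * Y1 (x \<bullet> x) + 4 * Y2 (x \<bullet> x) * (x \<bullet> x)"
    by (simp add: sum.distrib sum_distrib_left[symmetric] euclidean_inner[of x x])
  finally show ?thesis by (simp add: algebra_simps)
qed

end

section \<open>Comparison of Laplacians at an interior minimum\<close>

text \<open>Since \<open>g' 0 = 0\<close>, a negative \<open>c\<close> makes \<open>g'\<close>
  negative just to the right of \<open>0\<close>, and the mean value theorem yields a value of
  \<open>g\<close> below \<open>g 0\<close>.\<close>

lemma second_deriv_local_min:
  fixes g :: "real \<Rightarrow> real"
  assumes "e > 0" and g: "\<And>t. \<bar>t\<bar> < e \<Longrightarrow> (g has_real_derivative g' t) (at t)"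
    and g': "(g' has_real_derivative c) (at 0)" and min: "\<And>t. \<bar>t\<bar> < e \<Longrightarrow> g 0 \<le> g t"
  shows "c \<ge> 0"
proof (rule ccontr)
  assume "\<not> c \<ge> 0"
  have "g' 0 = 0" by (rule DERIV_local_min[OF g]) (use assms in auto)
  obtain d where d: "d > 0" "\<And>h. h > 0 \<Longrightarrow> h < d \<Longrightarrow> g' h < g' 0"
    using DERIV_neg_dec_right[OF g'] \<open>\<not> c \<ge> 0\<close> by auto
  let ?h = "min d e / 2"
  have h: "0 < ?h" "?h < d" "?h < e" using d \<open>e > 0\<close> by auto
  obtain z where z: "0 < z" "z < ?h" "g ?h - g 0 = (?h - 0) * g' z"
    using MVT2[of 0 ?h g g'] h g by fastforce
  have "g' z < 0" using d(2)[of z] z h \<open>g' 0 = 0\<close> by auto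
  then have "g ?h < g 0" using z h by (smt (verit) mult_pos_neg)
  then show False using min[of ?h] h by auto
qed

lemma C1_on_deriv_along:
  assumes "C1_on S u" "b \<in> Basis" "x + t *\<^sub>R b \<in> S"
  shows "((\<lambda>s. u (x + s *\<^sub>R b)) has_real_derivative partial_deriv b u (x + t *\<^sub>R b)) (at t)"
proof -
  have "((\<lambda>s. u ((x + t *\<^sub>R b) + s *\<^sub>R b)) has_real_derivative partial_deriv b u (x + t *\<^sub>R b)) (at 0)"
    using assms unfolding C1_on_def partial_deriv_def by (metis DERIV_deriv_iff_field_differentiable)
  then have "((\<lambda>s. u (x + (s + t) *\<^sub>R b)) has_real_derivative partial_deriv b u (x + t *\<^sub>R b)) (at 0)"
    by (simp add: algebra_simps)
  then show ?thesis using DERIV_shift[of "\<lambda>s. u (x + s *\<^sub>R b)" _ 0 t] by simp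
qed

text \<open>The second derivative test, applied to \<open>u - w\<close> along each coordinate line
  through \<open>x\<close>, compares the two sums term by term.\<close>

lemma laplacian_le_at_min:
  fixes u w :: "'a::euclidean_space \<Rightarrow> real"
  assumes "open S" "C2_on S u" "C2_on S w" "x \<in> S"
    and min: "\<And>y. y \<in> S \<Longrightarrow> u x - w x \<le> u y - w y"
  shows "laplacian w x \<le> laplacian u x"
  unfolding laplacian_def
proof (rule sum_mono)
  fix b :: 'a assume b: "b \<in> Basis"
  obtain e where e: "e > 0" "ball x e \<subseteq> S" using assms openE by blast
  have in_S: "x + t *\<^sub>R b \<in> S" if "\<bar>t\<bar> < e" for t
    using that e b by (intro subsetD[OF e(2)]) (auto simp: dist_norm)
  have "partial_deriv b (partial_deriv b u) x - partial_deriv b (partial_deriv b w) x \<ge> 0"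
  proof (rule second_deriv_local_min[OF \<open>e > 0\<close>])
    fix t :: real assume t: "\<bar>t\<bar> < e"
    show "((\<lambda>t. u (x + t *\<^sub>R b) - w (x + t *\<^sub>R b)) has_real_derivative
        partial_deriv b u (x + t *\<^sub>R b) - partial_deriv b w (x + t *\<^sub>R b)) (at t)"
      using assms b in_S[OF t] by (intro DERIV_diff C1_on_deriv_along) (auto simp: C2_on_def)
    show "u (x + 0 *\<^sub>R b) - w (x + 0 *\<^sub>R b) \<le> u (x + t *\<^sub>R b) - w (x + t *\<^sub>R b)"
      using min[OF in_S[OF t]] by simp
  next
    have "((\<lambda>t. partial_deriv b u (x + t *\<^sub>R b) - partial_deriv b w (x + t *\<^sub>R b)) has_real_derivative
        partial_deriv b (partial_deriv b u) (x + 0 *\<^sub>R b) - partial_deriv b (partial_deriv b w) (x + 0 *\<^sub>R b)) (at 0)"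
      using assms b by (intro DERIV_diff C1_on_deriv_along[where S=S]) (auto simp: C2_on_def)
    then show "((\<lambda>t. partial_deriv b u (x + t *\<^sub>R b) - partial_deriv b w (x + t *\<^sub>R b)) has_real_derivative
        partial_deriv b (partial_deriv b u) x - partial_deriv b (partial_deriv b w) x) (at 0)" by simp
  qed
  then show "partial_deriv b (partial_deriv b w) x \<le> partial_deriv b (partial_deriv b u) x" by simp
qed

section \<open>Monotonicity and comparison of radial functions\<close>

lemma C1_unit_at:
  assumes "C1_unit v v'" "0 < t" "t < 1"
  shows "(v has_real_derivative v' t) (at t)"
  using C1_unitD[OF assms(1), of t] assms at_within_Icc_at[of 0 t 1] by auto

lemma C1_unit_mono:
  assumes "C1_unit v v'" "\<And>t. t \<in> {0..1} \<Longrightarrow> v' t \<ge> 0" "0 \<le> s" "s \<le> t" "t \<le> 1"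
  shows "v s \<le> v t"
proof (rule DERIV_nonneg_imp_increasing_open[OF \<open>s \<le> t\<close>])
  show "\<exists>y. DERIV v x :> y \<and> 0 \<le> y" if "s < x" "x < t" for x
    using C1_unit_at[OF assms(1), of x] assms that by (intro exI[of _ "v' x"]) auto
  show "continuous_on {s..t} v"
    by (rule continuous_on_subset[OF C1_unit_cont[OF assms(1)]]) (use assms in auto)
qed

lemma C1_unit_antimono:
  assumes "C1_unit v v'" "\<And>t. t \<in> {0..1} \<Longrightarrow> v' t \<le> 0" "0 \<le> s" "s \<le> t" "t \<le> 1"
  shows "v t \<le> v s"
proof -
  have "C1_unit (\<lambda>t. - v t) (\<lambda>t. - v' t)"
    using assms(1) by (auto simp: C1_unit_def intro!: derivative_eq_intros continuous_intros)
  from C1_unit_mono[OF this _ assms(3-5)] assms(2) show ?thesis by simp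
qed

text \<open>With \<open>t = r^2\<close> the hypothesis says that \<open>r ^ N * D (r^2)\<close> is
  nondecreasing in \<open>r\<close>, and this function vanishes at \<open>r = 0\<close>. The
  expression \<open>N * D + 2 * t * D1\<close> is the divergence of the vector field
  \<open>x * D (|x|^2)\<close>.\<close>

lemma radial_divergence_nonneg:
  assumes D: "C1_unit D D1" and "N \<ge> 1"
    and le: "\<And>t. t \<in> {0..1} \<Longrightarrow> real N * D t + 2 * t * D1 t \<ge> 0" and t: "t \<in> {0..1}"
  shows "D t \<ge> 0"
proof (cases "t = 0")
  case True
  then show ?thesis using le[of 0] \<open>N \<ge> 1\<close> by (simp add: zero_le_mult_iff)
next
  case False
  have "0 ^ N * D (0^2) \<le> sqrt t ^ N * D ((sqrt t)^2)"
  proof (rule DERIV_nonneg_imp_increasing_open[where f = "\<lambda>r. r ^ N * D (r^2)"])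
    show "\<exists>y. ((\<lambda>r. r ^ N * D (r^2)) has_real_derivative y) (at r) \<and> 0 \<le> y" if r: "0 < r" "r < sqrt t" for r
    proof (intro exI conjI)
      have "r < 1" using r t by (smt (verit) atLeastAtMost_iff real_sqrt_le_1_iff)
      then have r2: "0 < r^2" "r^2 < 1" using r by (auto simp: power_less_one_iff)
      have N: "r ^ N = r * r ^ (N - 1)" using \<open>N \<ge> 1\<close> by (simp add: power_eq_if)
      show "((\<lambda>r. r ^ N * D (r^2)) has_real_derivative r ^ (N - 1) * (N * D (r^2) + 2 * r^2 * D1 (r^2))) (at r)"
        by (rule derivative_eq_intros DERIV_chain2[where f = D and g = "\<lambda>r. r^2", OF C1_unit_at[OF D r2]] refl)+
           (simp add: N algebra_simps power2_eq_square)
      show "0 \<le> r ^ (N - 1) * (N * D (r^2) + 2 * r^2 * D1 (r^2))"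
        using r r2 by (intro mult_nonneg_nonneg le) auto
    qed
    have "(\<lambda>x. x\<^sup>2) ` {0..sqrt t} \<subseteq> {0..1}"
      using t by (auto simp: abs_square_le_1) (smt (verit) real_sqrt_le_1_iff)
    then have "continuous_on {0..sqrt t} (\<lambda>r. D (r^2))"
      by (intro continuous_on_compose2[OF C1_unit_cont[OF D]] continuous_intros)
    then show "continuous_on {0..sqrt t} (\<lambda>r. r ^ N * D (r^2))"
      by (intro continuous_intros)
  qed (use t in auto)
  moreover have "sqrt t ^ N > 0" using t False by simp
  ultimately show ?thesis using t False \<open>N \<ge> 1\<close> by (simp add: zero_le_mult_iff power_0_left)
qed

text \<open>The right-hand side minus the left-hand side of the hypothesis is twice the divergence
  expression for \<open>Z1 - Y1\<close>. Hence \<open>Z1 - Y1 \<ge> 0\<close>, and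
  \<open>Z - Y\<close> increases to a nonpositive value at \<open>1\<close>.\<close>

lemma radial_comparison:
  assumes Y: "C1_unit Y Y1" "C1_unit Y1 Y2" and Z: "C1_unit Z Z1" "C1_unit Z1 Z2" and "N \<ge> 1"
    and le: "\<And>t. t \<in> {0..1} \<Longrightarrow> 4 * t * Y2 t + 2 * real N * Y1 t \<le> 4 * t * Z2 t + 2 * real N * Z1 t"
    and "Z 1 \<le> Y 1" and t: "t \<in> {0..1}"
  shows "Z t \<le> Y t"
proof -
  have D: "C1_unit (\<lambda>t. Z1 t - Y1 t) (\<lambda>t. Z2 t - Y2 t)" and E: "C1_unit (\<lambda>t. Z t - Y t) (\<lambda>t. Z1 t - Y1 t)"
    using assms C1_unit_cont by (auto simp: C1_unit_def intro!: derivative_eq_intros continuous_intros)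
  have "Z1 s - Y1 s \<ge> 0" if "s \<in> {0..1}" for s
    by (rule radial_divergence_nonneg[OF D \<open>N \<ge> 1\<close> _ that]) (use le in \<open>force simp: algebra_simps\<close>)
  from C1_unit_mono[OF E this, of t 1] t \<open>Z 1 \<le> Y 1\<close> show ?thesis by auto
qed

section \<open>The radial solution operator of the Dirichlet problem\<close>

text \<open>With \<open>s = r\<^sup>2\<close>, the value \<open>moment (N - 1) v s\<close> is \<open>r\<close> to the power \<open>- N\<close> times the integral of
  \<open>\<rho> ^ (N - 1) * v (\<rho>\<^sup>2)\<close> over \<open>[0, r]\<close>; the substitution \<open>\<rho> = r e\<close> removes the singularity at \<open>r = 0\<close>.
  Thus \<open>dirichlet\<close> below is the radial solution operator for \<open>- \<Delta> Y = v\<close>, \<open>Y(1) = 0\<close>.\<close>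

definition moment :: "nat \<Rightarrow> (real \<Rightarrow> real) \<Rightarrow> real \<Rightarrow> real" where
  "moment k v s = integral {0..1} (\<lambda>e. e ^ k * v (s * e^2))"

lemma sq_scale_unit: "s \<in> {0..1} \<Longrightarrow> e \<in> {0..1} \<Longrightarrow> s * e^2 \<in> {0..(1::real)}"
  by (auto simp: mult_le_one power_le_one)

lemma moment_integrand_cont:
  fixes v :: "real \<Rightarrow> real"
  assumes "continuous_on {0..1} v"
  shows "continuous_on ({0..1} \<times> {0..1}) (\<lambda>(s, e). e ^ k * v (s * e^2))"
proof -
  have "continuous_on ({0..1} \<times> {0..1}) (\<lambda>p. v (fst p * (snd p)^2))"
    by (rule continuous_on_compose2[OF assms], intro continuous_intros, clarify, rule sq_scale_unit) auto
  then show ?thesis unfolding case_prod_beta by (intro continuous_intros)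
qed

lemma moment_integrand_integrable:
  fixes v :: "real \<Rightarrow> real"
  assumes "continuous_on {0..1} v" "s \<in> {0..1}"
  shows "(\<lambda>e. e ^ k * v (s * e^2)) integrable_on {0..1}"
proof -
  have "continuous_on {0..1} (\<lambda>e. v (s * e^2))"
    by (rule continuous_on_compose2[OF assms(1)], intro continuous_intros, clarify, rule sq_scale_unit[OF assms(2)])
  then show ?thesis by (intro integrable_continuous_interval continuous_intros)
qed

lemma moment_cont:
  assumes "continuous_on {0..1} v"
  shows "continuous_on {0..1} (moment k v)"
  using integral_continuous_on_param[of "{0..1}" 0 1 "\<lambda>s e. e ^ k * v (s * e^2)"] moment_integrand_cont[OF assms]
  unfolding moment_def by simp

lemma moment_mono:
  assumes "continuous_on {0..1} v" "continuous_on {0..1} w" "\<And>t. t \<in> {0..1} \<Longrightarrow> v t \<le> w t" "s \<in> {0..1}"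
  shows "moment k v s \<le> moment k w s"
  unfolding moment_def
  by (intro integral_le moment_integrand_integrable mult_left_mono assms sq_scale_unit) auto

lemma moment_const: "moment k (\<lambda>_. c) s = c / (k + 1)"
proof -
  have "((\<lambda>e. e ^ k * c) has_integral (1 ^ (k+1) * (c / (k+1)) - 0 ^ (k+1) * (c / (k+1)))) {0..1}"
  proof (rule fundamental_theorem_of_calculus)
    fix e :: real
    have "((\<lambda>e. e ^ (k+1) * (c / (k+1))) has_real_derivative (k+1) * e ^ k * (c / (k+1))) (at e within {0..1})"
      by (auto intro!: derivative_eq_intros simp del: power_Suc)
    then show "((\<lambda>e. e ^ (k+1) * (c / (k+1))) has_vector_derivative e ^ k * c) (at e within {0..1})"
      by (simp add: has_real_derivative_iff_has_vector_derivative[symmetric] del: power_Suc)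
  qed simp
  then show ?thesis unfolding moment_def by (simp add: integral_unique del: integral_mult_left)
qed

lemma moment_pos:
  assumes "continuous_on {0..1} v" "\<And>t. t \<in> {0..1} \<Longrightarrow> v t > 0" "s \<in> {0..1}"
  shows "moment k v s > 0"
proof -
  obtain m where "m \<in> {0..1}" "\<And>t. t \<in> {0..1} \<Longrightarrow> v m \<le> v t"
    using continuous_attains_inf[OF _ _ assms(1)] by auto
  then have "moment k (\<lambda>_. v m) s \<le> moment k v s" by (intro moment_mono assms) auto
  moreover have "v m > 0" using \<open>m \<in> _\<close> assms by auto
  ultimately show ?thesis by (simp add: moment_const) (smt (verit) divide_pos_pos of_nat_0_le_iff)
qed

text \<open>Differentiation under the integral brings down a factor \<open>e^2\<close>, hence the
  shift of the exponent by two.\<close>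

lemma moment_C1_unit:
  assumes v: "C1_unit v v'"
  shows "C1_unit (moment k v) (moment (k + 2) v')"
proof -
  have "(moment k v has_real_derivative moment (k + 2) v' s) (at s within {0..1})" if s: "s \<in> {0..1}" for s
  proof -
    have "((\<lambda>s. integral (cbox 0 1) (\<lambda>e. e ^ k * v (s * e^2))) has_real_derivative
        integral (cbox 0 1) (\<lambda>e. e ^ (k + 2) * v' (s * e^2))) (at s within {0..1})"
    proof (rule leibniz_rule_field_derivative[where U = "{0..1}" and fx = "\<lambda>s e. e ^ (k + 2) * v' (s * e^2)"])
      fix s e :: real assume se: "s \<in> {0..1}" "e \<in> cbox 0 1"
      then have "((\<lambda>s. v (s * e^2)) has_real_derivative v' (s * e^2) * e^2) (at s within {0..1})"
        by (intro DERIV_chain_within[where f = v and T = "{0..1}" and g = "\<lambda>s. s * e^2"] C1_unitD[OF v] sq_scale_unit)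
           (use sq_scale_unit in \<open>auto intro!: derivative_eq_intros\<close>)
      then show "((\<lambda>s. e ^ k * v (s * e^2)) has_real_derivative e ^ (k + 2) * v' (s * e^2)) (at s within {0..1})"
        by (auto intro!: derivative_eq_intros simp: power_add power2_eq_square)
    qed (use moment_integrand_integrable[OF C1_unit_cont[OF v], where k = k]
           moment_integrand_cont[OF C1_unit_cont'[OF v], where k = "k + 2"] s in \<open>simp_all del: power_Suc add_2_eq_Suc'\<close>)
    then show ?thesis by (simp add: moment_def[abs_def])
  qed
  then show ?thesis using moment_cont[OF C1_unit_cont'[OF v]] by (auto simp: C1_unit_def)
qed

text \<open>Integrating the derivative of \<open>e ^ (k + 1) * v (s * e^2)\<close> over the unit
  interval leaves only the boundary value at \<open>e = 1\<close>.\<close>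

lemma moment_euler:
  assumes v: "C1_unit v v'" and s: "s \<in> {0..1}"
  shows "2 * s * moment (k + 2) v' s + (k + 1) * moment k v s = v s"
proof -
  have "((\<lambda>e. (k + 1) * (e ^ k * v (s * e^2)) + 2 * s * (e ^ (k + 2) * v' (s * e^2))) has_integral
      1 ^ (k + 1) * v (s * 1^2) - 0 ^ (k + 1) * v (s * 0^2)) {0..1}"
  proof (rule fundamental_theorem_of_calculus)
    fix e :: real assume e: "e \<in> {0..1}"
    have "((\<lambda>e. v (s * e^2)) has_real_derivative v' (s * e^2) * (2 * s * e)) (at e within {0..1})"
      by (intro DERIV_chain_within[where f = v and T = "{0..1}" and g = "\<lambda>e. s * e^2"] C1_unitD[OF v] sq_scale_unit s e)
         (use sq_scale_unit[OF s] in \<open>auto intro!: derivative_eq_intros\<close>)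
    from DERIV_mult[OF DERIV_power[OF DERIV_ident, of "k + 1"] this]
    show "((\<lambda>e. e ^ (k + 1) * v (s * e^2)) has_vector_derivative
       (k + 1) * (e ^ k * v (s * e^2)) + 2 * s * (e ^ (k + 2) * v' (s * e^2))) (at e within {0..1})"
      unfolding has_real_derivative_iff_has_vector_derivative[symmetric]
      by (simp add: algebra_simps)
  qed auto
  moreover have "((\<lambda>e. (k + 1) * (e ^ k * v (s * e^2)) + 2 * s * (e ^ (k + 2) * v' (s * e^2))) has_integral
      (k + 1) * moment k v s + 2 * s * moment (k + 2) v' s) {0..1}"
    unfolding moment_def
    by (intro has_integral_add has_integral_mult_right integrable_integral moment_integrand_integrable
         C1_unit_cont[OF v] C1_unit_cont'[OF v] s)
  ultimately have "1 ^ (k + 1) * v (s * 1^2) - 0 ^ (k + 1) * v (s * 0^2)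
      = (k + 1) * moment k v s + 2 * s * moment (k + 2) v' s"
    by (rule has_integral_unique)
  then show ?thesis by simp
qed

definition dirichlet :: "nat \<Rightarrow> (real \<Rightarrow> real) \<Rightarrow> real \<Rightarrow> real" where
  "dirichlet N v t = integral {t..1} (moment (N - 1) v) / 2"

lemma dirichlet_1 [simp]: "dirichlet N v 1 = 0"
  by (simp add: dirichlet_def)

lemma dirichlet_C1_unit:
  assumes "continuous_on {0..1} v"
  shows "C1_unit (dirichlet N v) (\<lambda>t. - moment (N - 1) v t / 2)"
proof -
  let ?m = "moment (N - 1) v"
  note c = moment_cont[OF assms, of "N - 1"]
  \<comment> \<open>A variable upper limit puts the integral into the form of the fundamental
    theorem of calculus.\<close>
  have eq: "dirichlet N v t = (integral {0..1} ?m - integral {0..t} ?m) / 2" if "t \<in> {0..1}" for t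
  proof -
    have "integral {0..t} ?m + integral {t..1} ?m = integral {0..1} ?m"
      using that by (intro Henstock_Kurzweil_Integration.integral_combine integrable_continuous_interval[OF c]) auto
    then show ?thesis by (simp add: dirichlet_def)
  qed
  have "((\<lambda>t. (integral {0..1} ?m - integral {0..t} ?m) / 2) has_real_derivative - ?m t / 2) (at t within {0..1})"
    if "t \<in> {0..1}" for t
  proof -
    have "((\<lambda>t. integral {0..1} ?m - integral {0..t} ?m) has_real_derivative 0 - ?m t) (at t within {0..1})"
      by (intro DERIV_diff DERIV_const integral_has_real_derivative[OF c that])
    from DERIV_cdivide[OF this, of 2] show ?thesis by simp
  qed
  note deriv = this
  have "(dirichlet N v has_real_derivative - ?m t / 2) (at t within {0..1})" if "t \<in> {0..1}" for t
    using deriv[OF that] by (rule has_field_derivative_transform_within[where d = 1]) (simp_all only: that eq zero_less_one)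
  moreover have "continuous_on {0..1} (\<lambda>t. - ?m t / 2)" by (intro continuous_intros c) simp
  ultimately show ?thesis unfolding C1_unit_def by blast
qed

lemma dirichlet_C2_unit:
  assumes "C1_unit v v'" "N \<ge> 1"
  shows "C1_unit (\<lambda>t. - moment (N - 1) v t / 2) (\<lambda>t. - moment (N + 1) v' t / 2)"
proof -
  have N: "N - 1 + 2 = N + 1" using assms(2) by simp
  have m: "C1_unit (moment (N - 1) v) (moment (N + 1) v')" by (rule moment_C1_unit[OF assms(1), of "N - 1", unfolded N])
  have "((\<lambda>t. - moment (N - 1) v t / 2) has_real_derivative - moment (N + 1) v' t / 2) (at t within {0..1})"
    if "t \<in> {0..1}" for t
    by (intro DERIV_cdivide DERIV_minus C1_unitD[OF m that])
  moreover have "continuous_on {0..1} (\<lambda>t. - moment (N + 1) v' t / 2)"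
    by (intro continuous_intros C1_unit_cont'[OF m]) simp
  ultimately show ?thesis unfolding C1_unit_def by blast
qed

text \<open>The identity \<open>moment_euler\<close> with \<open>k = N - 1\<close>; it says that
  \<open>dirichlet N v\<close> solves the Poisson equation with right-hand side
  \<open>v\<close>.\<close>

lemma dirichlet_eq:
  assumes "C1_unit v v'" "N \<ge> 1" "t \<in> {0..1}"
  shows "4 * t * (- moment (N + 1) v' t / 2) + 2 * real N * (- moment (N - 1) v t / 2) = - v t"
proof -
  have N: "N - 1 + 2 = N + 1" "real (N - 1) + 1 = real N" using assms(2) by auto
  have "2 * t * moment (N + 1) v' t + real N * moment (N - 1) v t = v t"
    by (rule moment_euler[OF assms(1,3), of "N - 1", unfolded N])
  then show ?thesis by simp
qed

subsection \<open>Radial integrals and Green's identity\<close>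

text \<open>Polar coordinates in measure form. It suffices to compare both measures on half-lines,
  where the left one is a difference of ball volumes and the right one follows from the fundamental
  theorem of calculus.\<close>

lemma distr_norm_ball:
  "distr (restrict_space lborel (ball (0::'a::euclidean_space) 1)) borel norm =
   density lborel (\<lambda>r. ennreal (unit_ball_vol DIM('a) * DIM('a) * r ^ (DIM('a) - 1) * indicator {0..1} r))"
  (is "?M = ?D")
proof (rule measure_eqI_lessThan)
  let ?B = "ball (0::'a) 1" and ?N = "DIM('a)" and ?w = "unit_ball_vol DIM('a)"
  have M: "emeasure ?M {x<..} = ennreal (?w * (1 - (max 0 (min x 1)) ^ ?N))" for x
  proof -
    have "emeasure ?M {x<..} = emeasure (restrict_space lborel ?B) (norm -` {x<..} \<inter> ?B)"
      by (subst emeasure_distr) (auto simp: space_restrict_space intro!: measurable_restrict_space1)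
    also have "\<dots> = emeasure lborel (norm -` {x<..} \<inter> ?B)"
      by (subst emeasure_restrict_space) auto
    also have "\<dots> = ennreal (?w * (1 - (max 0 (min x 1)) ^ ?N))"
    proof -
      consider "x < 0" | "0 \<le> x" "x < 1" | "1 \<le> x" by linarith
      then show ?thesis
      proof cases
        case 1
        then have "norm -` {x<..} \<inter> ?B = ?B" by (auto intro: less_le_trans[OF _ norm_ge_zero])
        then show ?thesis using 1 by (simp add: emeasure_ball power_0_left)
      next
        case 2
        then have "norm -` {x<..} \<inter> ?B = ?B - cball 0 x" by auto
        moreover have "emeasure lborel (?B - cball 0 x) = emeasure lborel ?B - emeasure lborel (cball (0::'a) x)"
          using 2 by (intro emeasure_Diff) (auto simp: emeasure_cball)
        ultimately show ?thesis using 2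
          by (simp add: emeasure_ball emeasure_cball ennreal_minus algebra_simps)
      next
        case 3
        then have "norm -` {x<..} \<inter> ?B = {}" by auto
        then show ?thesis using 3 by simp
      qed
    qed
    finally show ?thesis .
  qed
  show "emeasure ?M {x<..} < \<infinity>" for x by (simp add: M)
  show "emeasure ?M {x<..} = emeasure ?D {x<..}" for x
  proof -
    let ?y = "max 0 (min x 1)"
    have "emeasure ?D {x<..} =
      (\<integral>\<^sup>+r. ennreal (?w * ?N * r ^ (?N - 1) * indicator {0..1} r) * indicator {x<..} r \<partial>lborel)"
      by (subst emeasure_density) auto
    also have "\<dots> = (\<integral>\<^sup>+r. ennreal (?w * ?N * r ^ (?N - 1)) * indicator {?y..1} r \<partial>lborel)"
    proof (rule nn_integral_cong_AE)
      \<comment> \<open>The two intervals of integration differ at most in the points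
        \<open>x\<close> and \<open>1\<close>, which form a null set.\<close>
      have "AE r in lborel. r \<noteq> x \<and> r \<noteq> 1" by (intro AE_conjI AE_lborel_singleton)
      then show "AE r in lborel. ennreal (?w * ?N * r ^ (?N - 1) * indicator {0..1} r) * indicator {x<..} r =
          ennreal (?w * ?N * r ^ (?N - 1)) * indicator {?y..1} r"
        by eventually_elim (auto simp: indicator_def)
    qed
    also have "\<dots> = ennreal (?w * 1 ^ ?N - ?w * ?y ^ ?N)"
    proof (rule nn_integral_FTC_Icc[where F = "\<lambda>r. ?w * r ^ ?N"])
      fix r assume r: "r \<in> {?y..1}"
      have "((\<lambda>r. ?w * r ^ ?N) has_real_derivative ?w * (?N * r ^ (?N - 1))) (at r)"
        by (auto intro!: derivative_eq_intros)
      then show "((\<lambda>r. ?w * r ^ ?N) has_real_derivative ?w * ?N * r ^ (?N - 1)) (at r)"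
        by (simp add: mult_ac)
      show "0 \<le> ?w * ?N * r ^ (?N - 1)" using r by auto
    next
      show "(\<lambda>r. ?w * ?N * r ^ (?N - 1)) \<in> borel_measurable borel" by measurable
      show "?y \<le> 1" by simp
    qed
    finally show ?thesis by (simp add: M algebra_simps)
  qed
qed auto

text \<open>The integral is pushed forward under the norm. Extending \<open>h\<close> by zero keeps
  the integrand Borel, and passing to the completed measure changes neither integrability nor the
  value.\<close>

lemma radial_integral:
  assumes h: "continuous_on {0..1} h"
  shows "set_integrable lebesgue (ball (0::'a::euclidean_space) 1) (\<lambda>x. h (x \<bullet> x))"
    and "(LINT x:ball (0::'a) 1|lebesgue. h (x \<bullet> x)) =
       unit_ball_vol DIM('a) * DIM('a) * integral {0..1} (\<lambda>r. r ^ (DIM('a) - 1) * h (r^2))"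
proof -
  let ?B = "ball (0::'a) 1" and ?N = "DIM('a)" and ?w = "unit_ball_vol DIM('a)"
  let ?M = "distr (restrict_space lborel ?B) borel norm"
  define g where "g r = indicator {0..1} r *\<^sub>R h (r^2)" for r :: real
  define d where "d r = ?w * ?N * r ^ (?N - 1) * indicator {0..1} r" for r :: real
  have hr: "continuous_on {0..1} (\<lambda>r. h (r^2))"
    by (rule continuous_on_compose2[OF h]) (auto intro!: continuous_intros simp: abs_square_le_1)
  have g [measurable]: "g \<in> borel_measurable borel"
    unfolding g_def[abs_def] by (rule borel_measurable_continuous_on_indicator[OF _ hr]) simp
  have d [measurable]: "d \<in> borel_measurable borel" unfolding d_def[abs_def] by measurable
  have d0: "d r \<ge> 0" for r by (auto simp: d_def indicator_def)
  have norm_meas: "norm \<in> measurable (restrict_space lborel ?B) borel"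
    by (intro measurable_restrict_space1) auto
  have M: "?M = density lborel (\<lambda>r. ennreal (d r))"
    unfolding d_def by (rule distr_norm_ball)
  have dg: "(\<lambda>r. d r *\<^sub>R g r) = (\<lambda>r. indicator {0..1} r *\<^sub>R (?w * ?N * (r ^ (?N - 1) * h (r^2))))"
    by (auto simp: d_def g_def indicator_def)
  have I: "set_integrable lborel {0..1} (\<lambda>r. ?w * ?N * (r ^ (?N - 1) * h (r^2)))"
    by (intro borel_integrable_atLeastAtMost' continuous_intros hr)
  then have "integrable lborel (\<lambda>r. d r *\<^sub>R g r)" unfolding dg set_integrable_def .
  then have "integrable ?M g" unfolding M using d0 by (subst integrable_density) auto
  then have "integrable (restrict_space lborel ?B) (\<lambda>x. g (norm x))"
    by (subst (asm) integrable_distr_eq[OF norm_meas g])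
  moreover have gn: "indicator ?B x *\<^sub>R g (norm x) = indicator ?B x *\<^sub>R h (x \<bullet> x)" for x :: 'a
    by (auto simp: g_def indicator_def dot_square_norm)
  ultimately have i: "integrable lborel (\<lambda>x. indicator ?B x *\<^sub>R h (x \<bullet> x))"
    by (subst (asm) integrable_restrict_space) (auto simp del: real_scaleR_def)
  then show "set_integrable lebesgue ?B (\<lambda>x. h (x \<bullet> x))"
    unfolding set_integrable_def by (subst integrable_completion) auto
  have "(LINT x:?B|lebesgue. h (x \<bullet> x)) = integral\<^sup>L lborel (\<lambda>x. indicator ?B x *\<^sub>R g (norm x))"
    unfolding set_lebesgue_integral_def gn using i by (intro integral_completion) auto
  also have "\<dots> = integral\<^sup>L ?M g"
    by (subst integral_distr[OF norm_meas g], subst integral_restrict_space) auto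
  also have "\<dots> = integral\<^sup>L lborel (\<lambda>r. d r *\<^sub>R g r)"
    unfolding M using d0 by (subst integral_density) auto
  also have "\<dots> = integral {0..1} (\<lambda>r. ?w * ?N * (r ^ (?N - 1) * h (r^2)))"
    unfolding dg using set_borel_integral_eq_integral(2)[OF I] unfolding set_lebesgue_integral_def .
  also have "\<dots> = ?w * ?N * integral {0..1} (\<lambda>r. r ^ (?N - 1) * h (r^2))"
    by (rule integral_mult_right)
  finally show "(LINT x:?B|lebesgue. h (x \<bullet> x)) =
       ?w * ?N * integral {0..1} (\<lambda>r. r ^ (?N - 1) * h (r^2))" .
qed

text \<open>In polar coordinates the difference of the integrands is the derivative of
  \<open>2 * r ^ N * (Y * Z1 - Z * Y1)\<close>, taken at \<open>r^2\<close>. This function vanishes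
  at \<open>r = 1\<close> by the boundary conditions and at \<open>r = 0\<close> because of the
  factor \<open>r ^ N\<close>.\<close>

lemma green_radial:
  assumes Y: "C1_unit Y Y1" "C1_unit Y1 Y2" and Z: "C1_unit Z Z1" "C1_unit Z1 Z2"
    and bc: "Y 1 = 0" "Z 1 = 0"
  defines "N \<equiv> real DIM('a::euclidean_space)"
  shows "(LINT x:ball (0::'a) 1|lebesgue. Y (x \<bullet> x) * (4 * (x \<bullet> x) * Z2 (x \<bullet> x) + 2 * N * Z1 (x \<bullet> x))) =
         (LINT x:ball (0::'a) 1|lebesgue. (4 * (x \<bullet> x) * Y2 (x \<bullet> x) + 2 * N * Y1 (x \<bullet> x)) * Z (x \<bullet> x))"
proof -
  let ?D = "DIM('a)"
  let ?K = "\<lambda>t. Y t * Z1 t - Z t * Y1 t" and ?K1 = "\<lambda>t. Y t * Z2 t - Z t * Y2 t"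
  let ?l = "\<lambda>t. Y t * (4 * t * Z2 t + 2 * N * Z1 t)" and ?r = "\<lambda>t. (4 * t * Y2 t + 2 * N * Y1 t) * Z t"
  note c = Y[THEN C1_unit_cont] Z[THEN C1_unit_cont] Y[THEN C1_unit_cont'] Z[THEN C1_unit_cont']
  have cl: "continuous_on {0..1} ?l" and cr: "continuous_on {0..1} ?r"
    by (intro continuous_intros c)+
  have K: "C1_unit ?K ?K1"
    unfolding C1_unit_def
  proof (intro conjI ballI)
    show "(?K has_real_derivative ?K1 t) (at t within {0..1})" if "t \<in> {0..1}" for t
      by (rule derivative_eq_intros Y[THEN C1_unitD, OF that] Z[THEN C1_unitD, OF that] refl)+ (simp add: algebra_simps)
    show "continuous_on {0..1} ?K1" by (intro continuous_intros c)
  qed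
  have "((\<lambda>r. r ^ (?D - 1) * (?l (r^2) - ?r (r^2))) has_integral 2 * 1 ^ ?D * ?K (1^2) - 2 * 0 ^ ?D * ?K (0^2)) {0..1}"
  proof (rule fundamental_theorem_of_calculus)
    fix r :: real assume r: "r \<in> {0..1}"
    then have r2: "r^2 \<in> {0..1}" by (auto simp: abs_square_le_1)
    have k: "((\<lambda>r. ?K (r^2)) has_real_derivative ?K1 (r^2) * (2 * r)) (at r within {0..1})"
      by (rule DERIV_chain_within[where f = ?K and g = "\<lambda>r. r^2" and T = "{0..1}", OF C1_unitD[OF K r2]])
         (auto intro!: derivative_eq_intros simp: abs_square_le_1)
    have D: "r ^ ?D = r * r ^ (?D - 1)" by (simp add: power_eq_if)
    have "((\<lambda>r. 2 * r ^ ?D * ?K (r^2)) has_real_derivative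
      2 * (?D * r ^ (?D - 1)) * ?K (r^2) + ?K1 (r^2) * (2 * r) * (2 * r ^ ?D)) (at r within {0..1})"
      by (rule derivative_eq_intros k refl)+ simp
    moreover have "2 * (?D * r ^ (?D - 1)) * ?K (r^2) + ?K1 (r^2) * (2 * r) * (2 * r ^ ?D) =
      r ^ (?D - 1) * (?l (r^2) - ?r (r^2))"
      unfolding D N_def by (simp add: algebra_simps power2_eq_square)
    ultimately show "((\<lambda>r. 2 * r ^ ?D * ?K (r^2)) has_vector_derivative r ^ (?D - 1) * (?l (r^2) - ?r (r^2)))
        (at r within {0..1})"
      unfolding has_real_derivative_iff_has_vector_derivative[symmetric] by simp
  qed auto
  then have "integral {0..1} (\<lambda>r. r ^ (?D - 1) * (?l (r^2) - ?r (r^2))) = 0"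
    using bc by (simp add: integral_unique)
  then have "(LINT x:ball (0::'a) 1|lebesgue. ?l (x \<bullet> x) - ?r (x \<bullet> x)) = 0"
    using radial_integral(2)[of "\<lambda>t. ?l t - ?r t", where 'a='a] cl cr by (simp add: continuous_on_diff)
  then show ?thesis
    using set_integral_diff(2)[OF radial_integral(1)[OF cl] radial_integral(1)[OF cr, where 'a='a]] by simp
qed

subsection \<open>Picard iterates\<close>

text \<open>Convexity enters as a tangent line inequality: the comparison with weak solutions and
  the gap estimate both linearise \<open>f\<close> at a known value.\<close>

locale nonlinearity =
  fixes f f1 f2 :: "real \<Rightarrow> real" and N :: nat
  assumes N: "N \<ge> 1"
    and f: "\<And>t. (f has_real_derivative f1 t) (at t)"
    and f1: "\<And>t. (f1 has_real_derivative f2 t) (at t)"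
    and f2: "continuous_on UNIV f2"
    and f_pos: "\<And>t. f t > 0"
    and f1_nonneg: "\<And>t. f1 t \<ge> 0"
    and f_tangent: "\<And>s t. f s + f1 s * (t - s) \<le> f t"
begin

lemma f_mono: "s \<le> t \<Longrightarrow> f s \<le> f t"
  using f_tangent[of s t] f1_nonneg[of s] by (smt (verit) mult_nonneg_nonneg)

lemma f_cont: "continuous_on S f"
  by (meson DERIV_continuous continuous_at_imp_continuous_on f)

lemma f1_cont: "continuous_on S f1"
  by (meson DERIV_continuous continuous_at_imp_continuous_on f1)

lemma C1_unit_f:
  assumes "C1_unit Y Y1"
  shows "C1_unit (\<lambda>t. f (Y t)) (\<lambda>t. f1 (Y t) * Y1 t)"
  unfolding C1_unit_def
  by (auto intro!: DERIV_chain2[OF f] C1_unitD[OF assms] continuous_on_mult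
        continuous_on_compose2[OF f1_cont C1_unit_cont[OF assms]] C1_unit_cont'[OF assms])

lemma C1_unit_f1:
  assumes "C1_unit Y Y1"
  shows "C1_unit (\<lambda>t. f1 (Y t)) (\<lambda>t. f2 (Y t) * Y1 t)"
  unfolding C1_unit_def
  by (auto intro!: DERIV_chain2[OF f1] C1_unitD[OF assms] continuous_on_mult
        continuous_on_compose2[OF f2 C1_unit_cont[OF assms]] C1_unit_cont'[OF assms])

text \<open>Monotone iteration from zero, written in the squared norm. The functions
  \<open>picard1\<close> and \<open>picard2\<close> are the first two derivatives in closed form, so
  that the equation can be stated pointwise.\<close>

primrec picard :: "real \<Rightarrow> nat \<Rightarrow> real \<Rightarrow> real" where
  "picard l 0 = (\<lambda>_. 0)"
| "picard l (Suc k) = (\<lambda>t. l * dirichlet N (\<lambda>s. f (picard l k s)) t)"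

primrec picard1 :: "real \<Rightarrow> nat \<Rightarrow> real \<Rightarrow> real" where
  "picard1 l 0 = (\<lambda>_. 0)"
| "picard1 l (Suc k) = (\<lambda>t. l * (- moment (N - 1) (\<lambda>s. f (picard l k s)) t / 2))"

primrec picard2 :: "real \<Rightarrow> nat \<Rightarrow> real \<Rightarrow> real" where
  "picard2 l 0 = (\<lambda>_. 0)"
| "picard2 l (Suc k) = (\<lambda>t. l * (- moment (N + 1) (\<lambda>s. f1 (picard l k s) * picard1 l k s) t / 2))"

lemma picard_C1: "C1_unit (picard l k) (picard1 l k)"
proof (induction k)
  case (Suc k)
  then show ?case
    unfolding picard.simps picard1.simps by (intro C1_unit_cmult dirichlet_C1_unit C1_unit_cont[OF C1_unit_f])
qed (simp add: C1_unit_const)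

lemma picard1_C1: "C1_unit (picard1 l k) (picard2 l k)"
proof (cases k)
  case (Suc j)
  then show ?thesis
    using C1_unit_cmult[OF dirichlet_C2_unit[OF C1_unit_f[OF picard_C1[of l j]] N], of l] by simp
qed (simp add: C1_unit_const)

lemma picard_1: "picard l k 1 = 0"
  by (cases k) auto

lemma picard_eq:
  assumes "t \<in> {0..1}"
  shows "4 * t * picard2 l (Suc k) t + 2 * real N * picard1 l (Suc k) t = - (l * f (picard l k t))"
proof -
  have "4 * t * picard2 l (Suc k) t + 2 * real N * picard1 l (Suc k) t =
     l * (4 * t * (- moment (N + 1) (\<lambda>s. f1 (picard l k s) * picard1 l k s) t / 2)
        + 2 * real N * (- moment (N - 1) (\<lambda>s. f (picard l k s)) t / 2))"
    by (simp only: picard1.simps picard2.simps) (simp only: ring_distribs mult_ac)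
  also have "\<dots> = - (l * f (picard l k t))"
    by (subst dirichlet_eq[OF C1_unit_f[OF picard_C1] N assms]) simp
  finally show ?thesis .
qed

lemma picard1_nonpos:
  assumes "l \<ge> 0" "t \<in> {0..1}"
  shows "picard1 l k t \<le> 0"
proof (cases k)
  case (Suc j)
  have "moment (N - 1) (\<lambda>s. f (picard l j s)) t > 0"
    by (intro moment_pos f_pos C1_unit_cont[OF C1_unit_f[OF picard_C1]] assms)
  then show ?thesis using assms Suc by simp
qed simp

lemma picard_antimono: "l \<ge> 0 \<Longrightarrow> 0 \<le> s \<Longrightarrow> s \<le> t \<Longrightarrow> t \<le> 1 \<Longrightarrow> picard l k t \<le> picard l k s"
  by (rule C1_unit_antimono[OF picard_C1 picard1_nonpos])

lemma picard_nonneg: "l \<ge> 0 \<Longrightarrow> t \<in> {0..1} \<Longrightarrow> picard l k t \<ge> 0"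
  using picard_antimono[of l t 1 k] by (simp add: picard_1)

text \<open>Along an iterate the values of \<open>f\<close> decrease in \<open>t\<close>, so the
  moment of their derivative is nonpositive. This convexity is what \<open>picard_shift\<close>
  relies on.\<close>

lemma picard2_nonneg:
  assumes "l \<ge> 0" "t \<in> {0..1}"
  shows "picard2 l k t \<ge> 0"
proof (cases k)
  case (Suc j)
  have "moment (N + 1) (\<lambda>s. f1 (picard l j s) * picard1 l j s) t \<le> moment (N + 1) (\<lambda>s. 0) t"
    using f1_nonneg picard1_nonpos[OF assms(1)] assms(2)
    by (intro moment_mono C1_unit_cont'[OF C1_unit_f[OF picard_C1]] mult_nonneg_nonpos) auto
  then show ?thesis using assms Suc by (simp add: moment_const mult_nonneg_nonpos)
qed simp

section \<open>Comparison of the iterates with supersolutions and classical solutions\<close>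

text \<open>The comparison functions may vary with \<open>k\<close>, which covers a fixed
  supersolution as well as other Picard sequences. Each induction step combines the monotonicity of
  \<open>f\<close> with \<open>radial_comparison\<close>.\<close>

lemma picard_le_super:
  assumes l: "l \<ge> 0"
    and v: "\<And>k. C1_unit (v k) (v1 k)" "\<And>k. C1_unit (v1 k) (v2 k)"
    and le: "\<And>k t. t \<in> {0..1} \<Longrightarrow> 4 * t * v2 (Suc k) t + 2 * real N * v1 (Suc k) t \<le> - (l * f (v k t))"
    and v_1: "\<And>k. v k 1 \<ge> 0" and v_0: "\<And>t. t \<in> {0..1} \<Longrightarrow> v 0 t \<ge> 0"
  shows "t \<in> {0..1} \<Longrightarrow> picard l k t \<le> v k t"
proof (induction k arbitrary: t)
  case 0
  then show ?case using v_0 by simp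
next
  case (Suc k)
  show ?case
  proof (rule radial_comparison[OF v picard_C1 picard1_C1 N _ _ Suc.prems])
    fix s :: real assume s: "s \<in> {0..1}"
    have "l * f (picard l k s) \<le> l * f (v k s)"
      by (intro mult_left_mono f_mono Suc.IH s l)
    then show "4 * s * v2 (Suc k) s + 2 * real N * v1 (Suc k) s
        \<le> 4 * s * picard2 l (Suc k) s + 2 * real N * picard1 l (Suc k) s"
      using le[OF s, of k] unfolding picard_eq[OF s] by linarith
  qed (simp add: picard_1 v_1 del: picard.simps)
qed

lemma picard_mono_param:
  assumes "0 \<le> l" "l \<le> m" "t \<in> {0..1}"
  shows "picard l k t \<le> picard m k t"
proof (rule picard_le_super[OF assms(1) picard_C1 picard1_C1 _ _ _ assms(3)])
  fix s :: real and k assume s: "s \<in> {0..1}"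
  have "l * f (picard m k s) \<le> m * f (picard m k s)"
    by (intro mult_right_mono assms less_imp_le[OF f_pos])
  then show "4 * s * picard2 m (Suc k) s + 2 * real N * picard1 m (Suc k) s \<le> - (l * f (picard m k s))"
    unfolding picard_eq[OF s] by linarith
qed (simp_all add: picard_1)

text \<open>The sequence shifted by one index satisfies the iteration with equality and starts above
  zero, so it serves as comparison sequence.\<close>

lemma picard_mono_Suc:
  assumes "0 \<le> l" "t \<in> {0..1}"
  shows "picard l k t \<le> picard l (Suc k) t"
proof (rule picard_le_super[OF assms(1), where v = "\<lambda>k. picard l (Suc k)"])
  show "4 * s * picard2 l (Suc (Suc k)) s + 2 * real N * picard1 l (Suc (Suc k)) s \<le> - (l * f (picard l (Suc k) s))"
    if "s \<in> {0..1}" for s k unfolding picard_eq[OF that] by simp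
qed (use assms in \<open>simp_all only: picard_C1 picard1_C1 picard_1 picard_nonneg order_refl\<close>)

lemma picard_incseq: "0 \<le> l \<Longrightarrow> t \<in> {0..1} \<Longrightarrow> incseq (\<lambda>k. picard l k t)"
  by (intro incseq_SucI picard_mono_Suc)

text \<open>Since the iterates are convex as functions of \<open>|x|\<^sup>2\<close>, composing with an affine map that
  fixes \<open>1\<close> yields a supersolution.\<close>

lemma picard_shift:
  assumes "0 \<le> l" "0 \<le> \<kappa>" "\<kappa> \<le> 1" "t \<in> {0..1}"
  shows "picard (\<kappa> * l) k t \<le> picard l k (\<kappa> * t + (1 - \<kappa>))"
proof (rule picard_le_super[where v = "\<lambda>k t. picard l k (\<kappa> * t + (1 - \<kappa>))"
      and ?v1.0 = "\<lambda>k t. \<kappa> * picard1 l k (\<kappa> * t + (1 - \<kappa>))"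
      and ?v2.0 = "\<lambda>k t. \<kappa> * (\<kappa> * picard2 l k (\<kappa> * t + (1 - \<kappa>)))"])
  fix s :: real and k assume s: "s \<in> {0..1}"
  let ?s = "\<kappa> * s + (1 - \<kappa>)"
  have "\<kappa> * s \<ge> 0" "\<kappa> * s \<le> \<kappa>" using s assms by (auto simp: mult_left_le)
  then have s': "?s \<in> {0..1}" using assms by auto
  \<comment> \<open>The factor of \<open>picard2\<close> falls short by
    \<open>4 * \<kappa> * (1 - \<kappa>)\<close>, and convexity of the iterate gives this defect the
    favourable sign.\<close>
  have "4 * s * (\<kappa> * (\<kappa> * picard2 l (Suc k) ?s)) + 2 * real N * (\<kappa> * picard1 l (Suc k) ?s) =
    \<kappa> * (4 * ?s * picard2 l (Suc k) ?s + 2 * real N * picard1 l (Suc k) ?s)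
      - 4 * \<kappa> * (1 - \<kappa>) * picard2 l (Suc k) ?s"
    by (simp only: ring_distribs) (simp only: algebra_simps)
  also have "\<dots> \<le> \<kappa> * (4 * ?s * picard2 l (Suc k) ?s + 2 * real N * picard1 l (Suc k) ?s)"
    using picard2_nonneg[OF assms(1) s', of "Suc k"] assms by (simp del: picard2.simps)
  finally show "4 * s * (\<kappa> * (\<kappa> * picard2 l (Suc k) ?s)) + 2 * real N * (\<kappa> * picard1 l (Suc k) ?s)
     \<le> - (\<kappa> * l * f (picard l k ?s))"
    unfolding picard_eq[OF s'] by (simp add: mult.assoc)
next
  show "C1_unit (\<lambda>t. picard l k (\<kappa> * t + (1 - \<kappa>))) (\<lambda>t. \<kappa> * picard1 l k (\<kappa> * t + (1 - \<kappa>)))"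
    and "C1_unit (\<lambda>t. \<kappa> * picard1 l k (\<kappa> * t + (1 - \<kappa>))) (\<lambda>t. \<kappa> * (\<kappa> * picard2 l k (\<kappa> * t + (1 - \<kappa>))))" for k
    using assms by (auto intro!: C1_unit_cmult C1_unit_affine_comp picard_C1 picard1_C1)
qed (use assms in \<open>simp_all add: picard_1\<close>)

text \<open>As \<open>v\<close> may be nonradial, the comparison takes place at a minimum point of
  the difference in the closed ball, coordinate by coordinate through
  \<open>laplacian_le_at_min\<close>.\<close>

lemma picard_le_classical:
  fixes v :: "'a::euclidean_space \<Rightarrow> real"
  assumes l: "l \<ge> 0" and DIM: "N = DIM('a)" and v: "classical_solution (ball 0 1) f l v" and "norm x \<le> 1"
  shows "picard l k (x \<bullet> x) \<le> v x"
  using \<open>norm x \<le> 1\<close>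
proof (induction k arbitrary: x)
  case 0
  show ?case
  proof (cases "norm x = 1")
    case True
    then show ?thesis using v by (auto simp: classical_solution_def)
  next
    case False
    then show ?thesis using v 0 by (auto simp: classical_solution_def less_imp_le)
  qed
next
  case (Suc k)
  let ?Y = "picard l (Suc k)" and ?Y1 = "picard1 l (Suc k)" and ?Y2 = "picard2 l (Suc k)"
  have cont_v: "continuous_on (cball 0 1) v" and C2_v: "C2_on (ball 0 1) v"
    and eq: "\<And>x. norm x < 1 \<Longrightarrow> - laplacian v x = l * f (v x)" and bd: "\<And>x. norm x = 1 \<Longrightarrow> v x = 0"
    using v by (auto simp: classical_solution_def)
  have key: "?Y (x \<bullet> x) - e \<le> v x" if "e > 0" for e
  proof -
    \<comment> \<open>Adding \<open>e * (t - 1)\<close> keeps the boundary value and raises the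
      Laplacian by \<open>2 * N * e\<close>, which makes the inequality at an interior minimum
      strict.\<close>
    let ?W = "\<lambda>t. ?Y t + e * (t - 1)" and ?W1 = "\<lambda>t. ?Y1 t + e"
    have W: "C1_unit ?W ?W1" and W1: "C1_unit ?W1 ?Y2"
      using picard_C1[of l "Suc k"] picard1_C1[of l "Suc k"]
      by (auto simp: C1_unit_def simp del: picard.simps picard1.simps picard2.simps
          intro!: derivative_eq_intros continuous_intros)
    let ?w = "\<lambda>x::'a. ?W (x \<bullet> x)"
    have "continuous_on (cball 0 1) (\<lambda>x. v x - ?w x)"
      by (intro continuous_on_diff cont_v continuous_on_radial[OF C1_unit_cont[OF W]]) auto
    then obtain m where m: "norm m \<le> 1" "\<And>y. norm y \<le> 1 \<Longrightarrow> v m - ?w m \<le> v y - ?w y"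
      using continuous_attains_inf[of "cball (0::'a) 1"] by fastforce
    have "v m - ?w m \<ge> 0"
    proof (rule ccontr)
      assume neg: "\<not> v m - ?w m \<ge> 0"
      have "norm m < 1"
      proof (rule ccontr)
        assume "\<not> norm m < 1"
        then have "norm m = 1" using m by simp
        then show False using neg bd[of m] by (simp add: picard_1 dot_square_norm del: picard.simps)
      qed
      have mm: "m \<bullet> m \<in> {0..1}" using inner_self_le_1[OF m(1)] by simp
      have "laplacian ?w m \<le> laplacian v m"
        using C2_upto_boundary_radial[OF W W1, where 'a='a] \<open>norm m < 1\<close> m(2)
        by (intro laplacian_le_at_min[OF open_ball C2_v]) (auto simp: C2_upto_boundary_def)
      also have "laplacian v m = - (l * f (v m))" using eq[OF \<open>norm m < 1\<close>] by simp
      also have "laplacian ?w m = (4 * (m \<bullet> m) * ?Y2 (m \<bullet> m) + 2 * real N * ?Y1 (m \<bullet> m)) + 2 * N * e"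
        by (subst laplacian_radial[OF W W1 \<open>norm m < 1\<close>], unfold DIM[symmetric])
           (simp add: algebra_simps del: picard1.simps picard2.simps)
      also have "\<dots> = - (l * f (picard l k (m \<bullet> m))) + 2 * N * e" by (simp only: picard_eq[OF mm])
      finally have "l * f (v m) + 2 * N * e \<le> l * f (picard l k (m \<bullet> m))" by simp
      moreover have "l * f (picard l k (m \<bullet> m)) \<le> l * f (v m)"
        by (intro mult_left_mono f_mono Suc.IH m l)
      moreover have "2 * N * e > 0" using N \<open>e > 0\<close> by simp
      ultimately show False by linarith
    qed
    then have "?w x \<le> v x" using m(2)[OF Suc.prems] by linarith
    moreover have "e * (x \<bullet> x) \<ge> 0" using \<open>e > 0\<close> by simp
    ultimately show ?thesis by (simp add: algebra_simps del: picard.simps)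
  qed
  show ?case
  proof (rule field_le_epsilon)
    show "?Y (x \<bullet> x) \<le> v x + e" if "e > 0" for e using key[OF that] by linarith
  qed
qed

end

section \<open>Comparison of the iterates with weak solutions\<close>

lemma set_integrable_mult_bounded:
  fixes g u :: "'a \<Rightarrow> real"
  assumes g: "set_integrable M S g" and u: "(\<lambda>x. indicator S x *\<^sub>R u x) \<in> borel_measurable M"
    and le: "\<And>x. x \<in> S \<Longrightarrow> \<bar>u x\<bar> \<le> C"
  shows "set_integrable M S (\<lambda>x. g x * u x)"
proof -
  have eq: "indicator S x *\<^sub>R (g x * u x) = (indicator S x *\<^sub>R g x) * (indicator S x *\<^sub>R u x)" for x
    by (simp add: indicator_def)
  have "integrable M (\<lambda>x. (indicator S x *\<^sub>R g x) * (indicator S x *\<^sub>R u x))"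
  proof (rule Bochner_Integration.integrable_bound)
    show "integrable M (\<lambda>x. C * (indicator S x *\<^sub>R g x))"
      using g unfolding set_integrable_def by (rule integrable_mult_right)
    show "(\<lambda>x. (indicator S x *\<^sub>R g x) * (indicator S x *\<^sub>R u x)) \<in> borel_measurable M"
      using g unfolding set_integrable_def by (intro borel_measurable_times u) auto
    show "AE x in M. norm ((indicator S x *\<^sub>R g x) * (indicator S x *\<^sub>R u x)) \<le> norm (C * (indicator S x *\<^sub>R g x))"
    proof (intro AE_I2)
      fix x
      show "norm ((indicator S x *\<^sub>R g x) * (indicator S x *\<^sub>R u x)) \<le> norm (C * (indicator S x *\<^sub>R g x))"
        using mult_mono[of "\<bar>u x\<bar>" "\<bar>C\<bar>" "\<bar>g x\<bar>" "\<bar>g x\<bar>"] le[of x]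
        by (cases "x \<in> S") (auto simp: abs_mult mult.commute)
    qed
  qed
  then show ?thesis unfolding set_integrable_def eq .
qed

lemma radial_measurable:
  assumes "continuous_on {0..1} (h :: real \<Rightarrow> real)"
  shows "(\<lambda>x. indicator (ball (0::'a::euclidean_space) 1) x *\<^sub>R h (x \<bullet> x)) \<in> borel_measurable lebesgue"
  using radial_integral(1)[OF assms, where 'a='a] unfolding set_integrable_def by auto

lemma continuous_on_unit_bounded:
  assumes "continuous_on {0..1} (h :: real \<Rightarrow> real)"
  obtains C where "C > 0" "\<And>t. t \<in> {0..1} \<Longrightarrow> \<bar>h t\<bar> \<le> C"
proof -
  have "bounded (h ` {0..1})"
    by (intro compact_imp_bounded compact_continuous_image assms) auto
  then show ?thesis using that unfolding bounded_pos by auto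
qed

text \<open>Through this bound the distance weight in the definition of weak solutions controls test
  functions that decay linearly at the boundary.\<close>

lemma one_minus_norm_le_infdist:
  fixes x :: "'a::euclidean_space"
  shows "1 - norm x \<le> infdist x (frontier (ball 0 1))"
proof -
  have "frontier (ball (0::'a) 1) \<noteq> {}" by simp
  moreover have "1 - norm x \<le> dist x y" if "y \<in> frontier (ball 0 1)" for y
    using that norm_triangle_ineq2[of y x] by (simp add: dist_norm norm_minus_commute)
  ultimately show ?thesis by (simp add: infdist_def cINF_greatest del: frontier_ball)
qed

context nonlinearity
begin

text \<open>The comparison is made after integration, simultaneously for all nonnegative radial
  weights. In the induction step \<open>Z\<close> solves the dual problem with right-hand side
  \<open>\<xi>\<close>; Green's identity, the tangent inequality at the iterate and the weak
  formulation tested with \<open>Z\<close> reduce the claim to the weight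
  \<open>f1 (picard l k t) * Z t\<close>.\<close>

lemma picard_le_weak_tested:
  fixes w :: "'a::euclidean_space \<Rightarrow> real"
  assumes l: "l \<ge> 0" and DIM: "N = DIM('a)" and w: "weak_solution (ball 0 1) f l w"
  shows "C1_unit \<xi> \<xi>1 \<Longrightarrow> (\<And>t. t \<in> {0..1} \<Longrightarrow> \<xi> t \<ge> 0) \<Longrightarrow>
    (LINT x:ball (0::'a) 1|lebesgue. picard l k (x \<bullet> x) * \<xi> (x \<bullet> x)) \<le>
    (LINT x:ball 0 1|lebesgue. w x * \<xi> (x \<bullet> x))"
proof (induction k arbitrary: \<xi> \<xi>1)
  case 0
  have "AE x in lebesgue. 0 \<le> indicator (ball 0 1) x *\<^sub>R (w x * \<xi> (x \<bullet> x))"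
  proof -
    have "AE x in lebesgue. x \<in> ball 0 1 \<longrightarrow> w x \<ge> 0" using w unfolding weak_solution_def by blast
    then show ?thesis
    proof eventually_elim
      case (elim x)
      then show ?case using 0(2)[of "x \<bullet> x"] inner_self_le_1[of x] by (auto simp: indicator_def)
    qed
  qed
  then show ?case unfolding set_lebesgue_integral_def by (simp add: integral_nonneg_AE)
next
  case (Suc k)
  let ?B = "ball (0::'a) 1"
  note \<xi> = Suc.prems
  define Z Z1 Z2 where "Z = dirichlet N \<xi>" and "Z1 t = - moment (N - 1) \<xi> t / 2"
    and "Z2 t = - moment (N + 1) \<xi>1 t / 2" for t
  have Z: "C1_unit Z Z1" and Z1: "C1_unit Z1 Z2"
    using dirichlet_C1_unit[OF C1_unit_cont[OF \<xi>(1)], of N] dirichlet_C2_unit[OF \<xi>(1) N]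
    unfolding Z_def Z1_def[abs_def] Z2_def[abs_def] .
  have Z_eq: "4 * t * Z2 t + 2 * real N * Z1 t = - \<xi> t" if "t \<in> {0..1}" for t
    unfolding Z1_def Z2_def by (rule dirichlet_eq[OF \<xi>(1) N that])
  have Z_1: "Z 1 = 0" by (simp add: Z_def)
  have Z1_nonpos: "Z1 t \<le> 0" if "t \<in> {0..1}" for t
    using moment_mono[OF continuous_on_const[of _ 0] C1_unit_cont[OF \<xi>(1)] \<xi>(2) that, of "N - 1"]
    by (simp add: Z1_def moment_const)
  have Z_nonneg: "Z t \<ge> 0" if "t \<in> {0..1}" for t
    using C1_unit_antimono[OF Z Z1_nonpos, of t 1] that Z_1 by simp
  obtain C where C: "C > 0" "\<And>t. t \<in> {0..1} \<Longrightarrow> \<bar>Z1 t\<bar> \<le> C"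
    using continuous_on_unit_bounded[OF C1_unit_cont'[OF Z]] by metis
  \<comment> \<open>Linear decay at the boundary bounds \<open>Z\<close> by a multiple of the
    distance function, so that \<open>f (w x) * ?z x\<close> is integrable.\<close>
  have Z_le: "Z t \<le> C * (1 - t)" if t: "t \<in> {0..1}" for t
  proof -
    have "C1_unit (\<lambda>t. C * (1 - t) - Z t) (\<lambda>t. - C - Z1 t)"
      using Z by (auto simp: C1_unit_def intro!: derivative_eq_intros continuous_intros)
    moreover have "- C - Z1 t \<le> 0" if "t \<in> {0..1}" for t using C(2)[OF that] by linarith
    ultimately have "C * (1 - 1) - Z 1 \<le> C * (1 - t) - Z t"
      using t by (intro C1_unit_antimono[of "\<lambda>t. C * (1 - t) - Z t"]) auto
    then show ?thesis using Z_1 by simp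
  qed
  let ?Y = "picard l k" and ?X = "picard l (Suc k)"
  let ?z = "\<lambda>x::'a. Z (x \<bullet> x)" and ?d = "\<lambda>x::'a. infdist x (frontier ?B)"
  have unit: "x \<bullet> x \<in> {0..1}" if "x \<in> ?B" for x :: 'a
    using that inner_self_le_1[of x] by simp
  have z_d: "?z x \<le> 2 * C * ?d x" if "x \<in> ?B" for x
  proof -
    have "?z x \<le> C * (1 - x \<bullet> x)" using Z_le[OF unit[OF that]] .
    also have "1 - x \<bullet> x = (1 - norm x) * (1 + norm x)"
      by (simp add: dot_square_norm power2_eq_square algebra_simps)
    also have "\<dots> \<le> (1 - norm x) * 2" using that by (intro mult_left_mono) auto
    finally have "?z x \<le> 2 * C * (1 - norm x)" using C(1) by (simp add: algebra_simps mult_left_mono)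
    also have "\<dots> \<le> 2 * C * ?d x" using C(1) by (intro mult_left_mono one_minus_norm_le_infdist) auto
    finally show ?thesis .
  qed
  have d_pos: "?d x > 0" if "x \<in> ?B" for x
    using one_minus_norm_le_infdist[of x] that by simp
  have w_int: "set_integrable lebesgue ?B w"
    and fw_int: "set_integrable lebesgue ?B (\<lambda>x. f (w x) * ?d x)"
    and test: "\<And>z. C2_upto_boundary ?B z \<Longrightarrow> (\<forall>x\<in>frontier ?B. z x = 0) \<Longrightarrow>
       - (LINT x:?B|lebesgue. w x * laplacian z x) = l * (LINT x:?B|lebesgue. f (w x) * z x)"
    using w unfolding weak_solution_def by blast+
  have w_mult: "set_integrable lebesgue ?B (\<lambda>x. w x * h (x \<bullet> x))" if h: "continuous_on {0..1} h" for h
  proof -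
    obtain c where "\<And>t. t \<in> {0..1} \<Longrightarrow> \<bar>h t\<bar> \<le> c" using continuous_on_unit_bounded[OF h] by metis
    then show ?thesis
      by (intro set_integrable_mult_bounded[OF w_int radial_measurable[OF h], of c]) (use unit in auto)
  qed
  have fwz_int: "set_integrable lebesgue ?B (\<lambda>x. f (w x) * ?z x)"
  proof -
    have "set_integrable lebesgue ?B (\<lambda>x. (f (w x) * ?d x) * (?z x / ?d x))"
    proof (rule set_integrable_mult_bounded[OF fw_int])
      have "continuous_on UNIV ?d" by (intro continuous_intros)
      then have "?d \<in> borel_measurable borel" by (rule borel_measurable_continuous_onI)
      then have "(\<lambda>x. (indicator ?B x *\<^sub>R ?z x) / ?d x) \<in> borel_measurable lebesgue"
        by (intro borel_measurable_divide radial_measurable[OF C1_unit_cont[OF Z]] measurable_completion)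
           simp
      then show "(\<lambda>x. indicator ?B x *\<^sub>R (?z x / ?d x)) \<in> borel_measurable lebesgue" by simp
      show "\<bar>?z x / ?d x\<bar> \<le> 2 * C" if "x \<in> ?B" for x
        using z_d[OF that] d_pos[OF that] Z_nonneg[OF unit[OF that]] by (simp add: divide_simps)
    qed
    then show ?thesis
      by (rule set_integrable_cong[THEN iffD1, rotated -1]) (use d_pos in force)+
  qed
  have uminus: "(LINT x:?B|lebesgue. - g x) = - (LINT x:?B|lebesgue. g x)" for g :: "'a \<Rightarrow> real"
    by (simp add: set_lebesgue_integral_def)
  have cong: "(LINT x:?B|lebesgue. g x) = (LINT x:?B|lebesgue. h x)"
    if "\<And>x. x \<in> ?B \<Longrightarrow> g x = h x" for g h :: "'a \<Rightarrow> real"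
    by (rule set_lebesgue_integral_cong) (use that in auto)
  have X_eq: "4 * t * picard2 l (Suc k) t + 2 * real N * picard1 l (Suc k) t = - (l * f (?Y t))"
    if "t \<in> {0..1}" for t by (rule picard_eq[OF that])
  have "(LINT x:?B|lebesgue. ?X (x \<bullet> x) * \<xi> (x \<bullet> x)) =
      - (LINT x:?B|lebesgue. ?X (x \<bullet> x) * (4 * (x \<bullet> x) * Z2 (x \<bullet> x) + 2 * real DIM('a) * Z1 (x \<bullet> x)))"
    unfolding uminus[symmetric] DIM[symmetric]
    by (rule cong) (simp only: Z_eq[OF unit] mult_minus_right minus_minus)
  also have "(LINT x:?B|lebesgue. ?X (x \<bullet> x) * (4 * (x \<bullet> x) * Z2 (x \<bullet> x) + 2 * real DIM('a) * Z1 (x \<bullet> x))) =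
     (LINT x:?B|lebesgue. (4 * (x \<bullet> x) * picard2 l (Suc k) (x \<bullet> x) + 2 * real DIM('a) * picard1 l (Suc k) (x \<bullet> x)) * ?z x)"
    by (rule green_radial[OF picard_C1 picard1_C1 Z Z1 picard_1 Z_1])
  also have "- \<dots> = (LINT x:?B|lebesgue. l * f (?Y (x \<bullet> x)) * ?z x)"
    unfolding uminus[symmetric] DIM[symmetric]
    by (rule cong) (simp only: X_eq[OF unit] mult_minus_left minus_minus)
  also have "\<dots> \<le> (LINT x:?B|lebesgue. l * f (w x) * ?z x)"
  proof -
    \<comment> \<open>The weight produced by the slope of the tangent. It is again nonnegative and
      continuously differentiable, so the induction hypothesis applies to it.\<close>
    define \<xi>' where "\<xi>' t = f1 (?Y t) * Z t" for t
    have \<xi>'_C1: "C1_unit \<xi>' (\<lambda>t. f1 (?Y t) * Z1 t + f2 (?Y t) * picard1 l k t * Z t)"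
      unfolding C1_unit_def \<xi>'_def[abs_def]
      by (intro conjI ballI DERIV_mult' C1_unitD[OF C1_unit_f1[OF picard_C1]] C1_unitD[OF Z]
          continuous_intros C1_unit_cont'[OF C1_unit_f1[OF picard_C1]] C1_unit_cont[OF C1_unit_f1[OF picard_C1]]
          C1_unit_cont[OF Z] C1_unit_cont'[OF Z])
    have \<xi>'_nonneg: "\<xi>' t \<ge> 0" if "t \<in> {0..1}" for t
      using f1_nonneg Z_nonneg[OF that] by (simp add: \<xi>'_def)
    have IH: "(LINT x:?B|lebesgue. ?Y (x \<bullet> x) * \<xi>' (x \<bullet> x)) \<le> (LINT x:?B|lebesgue. w x * \<xi>' (x \<bullet> x))"
      using Suc.IH[of \<xi>'] \<xi>'_C1 \<xi>'_nonneg by blast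
    have c1: "continuous_on {0..1} (\<lambda>t. l * f (?Y t) * Z t)" and c2: "continuous_on {0..1} (\<lambda>t. ?Y t * \<xi>' t)"
      by (intro continuous_intros C1_unit_cont[OF Z] C1_unit_cont[OF C1_unit_f[OF picard_C1]]
          C1_unit_cont[OF picard_C1] C1_unit_cont[OF \<xi>'_C1])+
    note i1 = radial_integral(1)[OF c1, where 'a='a] and i2 = radial_integral(1)[OF c2, where 'a='a]
      and i3 = w_mult[OF C1_unit_cont[OF \<xi>'_C1]]
    note i32 = set_integral_diff[OF i3 i2]
    have i4: "set_integrable lebesgue ?B (\<lambda>x. l * (w x * \<xi>' (x \<bullet> x) - ?Y (x \<bullet> x) * \<xi>' (x \<bullet> x)))"
      using i32(1) by (intro set_integrable_mult_right) auto
    have "(LINT x:?B|lebesgue. l * f (?Y (x \<bullet> x)) * ?z x) \<le> (LINT x:?B|lebesgue. l * f (?Y (x \<bullet> x)) * ?z x) +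
       l * ((LINT x:?B|lebesgue. w x * \<xi>' (x \<bullet> x)) - (LINT x:?B|lebesgue. ?Y (x \<bullet> x) * \<xi>' (x \<bullet> x)))"
      using IH l by simp
    also have "\<dots> = (LINT x:?B|lebesgue. l * f (?Y (x \<bullet> x)) * ?z x +
        l * (w x * \<xi>' (x \<bullet> x) - ?Y (x \<bullet> x) * \<xi>' (x \<bullet> x)))"
      unfolding set_integral_add(2)[OF i1 i4] set_integral_mult_right i32(2) ..
    also have "\<dots> \<le> (LINT x:?B|lebesgue. l * f (w x) * ?z x)"
    proof (rule set_integral_mono)
      show "set_integrable lebesgue ?B (\<lambda>x. l * f (?Y (x \<bullet> x)) * ?z x +
        l * (w x * \<xi>' (x \<bullet> x) - ?Y (x \<bullet> x) * \<xi>' (x \<bullet> x)))" by (rule set_integral_add(1)[OF i1 i4])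
      have "set_integrable lebesgue ?B (\<lambda>x. l * (f (w x) * ?z x))"
        using fwz_int by (intro set_integrable_mult_right) auto
      then show "set_integrable lebesgue ?B (\<lambda>x. l * f (w x) * ?z x)" by (simp only: mult.assoc)
      fix x assume x: "x \<in> ?B"
      let ?y = "?Y (x \<bullet> x)"
      have "l * ?z x * (f ?y + f1 ?y * (w x - ?y)) \<le> l * ?z x * f (w x)"
        using l Z_nonneg[OF unit[OF x]] by (intro mult_left_mono f_tangent) auto
      then show "l * f ?y * ?z x + l * (w x * \<xi>' (x \<bullet> x) - ?y * \<xi>' (x \<bullet> x)) \<le> l * f (w x) * ?z x"
        by (simp add: \<xi>'_def algebra_simps)
    qed
    finally show ?thesis .
  qed
  also have "\<dots> = l * (LINT x:?B|lebesgue. f (w x) * ?z x)"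
    by (simp only: mult.assoc set_integral_mult_right)
  also have "\<dots> = - (LINT x:?B|lebesgue. w x * laplacian ?z x)"
    using C2_upto_boundary_radial[OF Z Z1] Z_1 by (intro test[symmetric]) (auto simp: dot_square_norm)
  also have "\<dots> = (LINT x:?B|lebesgue. w x * \<xi> (x \<bullet> x))"
    unfolding uminus[symmetric]
  proof (rule cong)
    fix x assume x: "x \<in> ?B"
    then have "laplacian ?z x = - \<xi> (x \<bullet> x)"
      using laplacian_radial[OF Z Z1, of x] Z_eq[OF unit[OF x]] DIM by simp
    then show "- (w x * laplacian ?z x) = w x * \<xi> (x \<bullet> x)" by simp
  qed
  finally show ?case .
qed

text \<open>Iterates decrease in the squared norm, so \<open>picard l k r\<close> times the volume
  of the ball of radius \<open>sqrt r\<close> is at most the integral of the iterate. The weight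
  \<open>1\<close> bounds the latter by the integral of \<open>w\<close>.\<close>

lemma weak_imp_picard_bounded:
  fixes w :: "'a::euclidean_space \<Rightarrow> real"
  assumes l: "l \<ge> 0" and DIM: "N = DIM('a)" and w: "weak_solution (ball 0 1) f l w" and r: "0 < r" "r \<le> 1"
  shows "\<exists>C. \<forall>k. picard l k r \<le> C"
proof (intro exI allI)
  fix k
  let ?B = "ball (0::'a) 1" and ?b = "ball (0::'a) (sqrt r)" and ?Y = "picard l k"
  let ?I = "LINT x:?B|lebesgue. w x" and ?v = "measure lebesgue ?b"
  have v: "?v > 0" using r content_ball_pos[of "sqrt r" "0::'a"] by simp
  have "?Y r * ?v = (LINT x:?b|lebesgue. ?Y r)"
    by (simp add: set_lebesgue_integral_def mult.commute)
  also have "\<dots> \<le> (LINT x:?B|lebesgue. ?Y (x \<bullet> x) * 1)"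
    unfolding set_lebesgue_integral_def
  proof (rule integral_mono)
    show "integrable lebesgue (\<lambda>x. indicator ?b x *\<^sub>R ?Y r)"
      using lmeasurable_ball[of "0::'a" "sqrt r"] by (intro integrable_scaleR_left) (simp add: lmeasurable_iff_integrable)
    show "integrable lebesgue (\<lambda>x. indicator ?B x *\<^sub>R (?Y (x \<bullet> x) * 1))"
      using radial_integral(1)[OF C1_unit_cont[OF picard_C1], where 'a='a] by (simp add: set_integrable_def)
    fix x :: 'a
    show "indicator ?b x *\<^sub>R ?Y r \<le> indicator ?B x *\<^sub>R (?Y (x \<bullet> x) * 1)"
    proof (cases "x \<in> ?b")
      case True
      then have "norm x < sqrt r" by simp
      then have "norm x < 1" and "(norm x)^2 \<le> (sqrt r)^2"
        using r by (auto simp: less_imp_le intro!: power_mono simp del: real_sqrt_pow2) (smt (verit) real_sqrt_le_1_iff)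
      then have "x \<bullet> x \<le> r" using r by (simp add: dot_square_norm)
      then have "?Y r \<le> ?Y (x \<bullet> x)" using l r by (intro picard_antimono) auto
      then show ?thesis using True \<open>norm x < 1\<close> by simp
    next
      case False
      then show ?thesis
        using picard_nonneg[OF l, of "x \<bullet> x" k] inner_self_le_1[of x] by (auto simp: indicator_def)
    qed
  qed
  also have "\<dots> \<le> (LINT x:?B|lebesgue. w x * 1)"
    by (rule picard_le_weak_tested[OF l DIM w, of "\<lambda>_. 1" "\<lambda>_. 0"]) (simp_all add: C1_unit_const)
  finally show "?Y r \<le> ?I / ?v" using v by (simp add: field_simps)
qed

text \<open>A classical solution is bounded and dominates the iterates directly. A weak solution
  bounds them only away from the origin, and \<open>picard_shift\<close> converts this into a bound
  on the whole interval for the smaller parameter \<open>1\<close>.\<close>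

lemma solution_imp_picard_bounded:
  assumes l: "l > 1" and DIM: "N = DIM('a::euclidean_space)"
    and sol: "(\<exists>u :: 'a \<Rightarrow> real. classical_solution (ball 0 1) f l u) \<or> (\<exists>u :: 'a \<Rightarrow> real. weak_solution (ball 0 1) f l u)"
  shows "\<exists>C. \<forall>k. \<forall>t\<in>{0..1}. picard 1 k t \<le> C"
  using sol
proof (elim disjE exE)
  fix u :: "'a \<Rightarrow> real"
  assume u: "classical_solution (ball 0 1) f l u"
  then have "continuous_on (cball 0 1) u" by (simp add: classical_solution_def)
  then have "bounded (u ` cball 0 1)" by (intro compact_imp_bounded compact_continuous_image) auto
  then obtain C where C: "\<And>x. norm x \<le> 1 \<Longrightarrow> \<bar>u x\<bar> \<le> C" unfolding bounded_iff by fastforce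
  have "picard 1 k t \<le> C" if t: "t \<in> {0..1}" for k t
  proof -
    obtain b :: 'a where "b \<in> Basis" using nonempty_Basis by blast
    define x where "x = sqrt t *\<^sub>R b"
    have x: "x \<bullet> x = t" "norm x \<le> 1" using t \<open>b \<in> Basis\<close> by (auto simp: x_def)
    have "picard 1 k t \<le> picard l k t" using l t by (intro picard_mono_param) auto
    also have "\<dots> \<le> u x" using picard_le_classical[OF _ DIM u x(2)] l x(1) by simp
    also have "\<dots> \<le> C" using C[OF x(2)] by linarith
    finally show ?thesis .
  qed
  then show ?thesis by blast
next
  fix u :: "'a \<Rightarrow> real"
  assume u: "weak_solution (ball 0 1) f l u"
  \<comment> \<open>With this choice the shift lowers the parameter from \<open>l\<close> to
    \<open>1\<close> and maps the unit interval into the points not below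
    \<open>1 - \<kappa>\<close>.\<close>
  define \<kappa> where "\<kappa> = 1 / l"
  have \<kappa>: "0 < \<kappa>" "\<kappa> < 1" "\<kappa> * l = 1" using l by (auto simp: \<kappa>_def)
  obtain C where C: "\<And>k. picard l k (1 - \<kappa>) \<le> C"
    using weak_imp_picard_bounded[OF _ DIM u, of "1 - \<kappa>"] \<kappa> l by auto
  have "picard 1 k t \<le> C" if t: "t \<in> {0..1}" for k t
  proof -
    have "\<kappa> * t \<ge> 0" "\<kappa> * t \<le> \<kappa>" using t \<kappa> by (auto simp: mult_left_le)
    have "picard (\<kappa> * l) k t \<le> picard l k (\<kappa> * t + (1 - \<kappa>))" using \<kappa> l t by (intro picard_shift) auto
    also have "\<dots> \<le> picard l k (1 - \<kappa>)"
      using \<open>\<kappa> * t \<ge> 0\<close> \<open>\<kappa> * t \<le> \<kappa>\<close> \<kappa> l by (intro picard_antimono) auto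
    also have "\<dots> \<le> C" by (rule C)
    finally show ?thesis by (simp add: \<kappa>)
  qed
  then show ?thesis by blast
qed

end

section \<open>Convergence of the iterates to the minimal solution\<close>

lemma C1_unit_cong:
  assumes "C1_unit w w'" "\<And>t. t \<in> {0..1} \<Longrightarrow> v t = w t"
  shows "C1_unit v w'"
  unfolding C1_unit_def
proof (intro conjI ballI)
  fix t :: real assume t: "t \<in> {0..1}"
  show "(v has_real_derivative w' t) (at t within {0..1})"
    by (rule has_field_derivative_transform_within[OF C1_unitD[OF assms(1) t] zero_less_one t])
       (simp add: assms(2))
qed (rule C1_unit_cont'[OF assms(1)])

lemma moment_bounds:
  assumes "continuous_on {0..1} v" "\<And>t. t \<in> {0..1} \<Longrightarrow> a \<le> v t \<and> v t \<le> b" "s \<in> {0..1}" "N \<ge> 1"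
  shows "a / N \<le> moment (N - 1) v s" "moment (N - 1) v s \<le> b / N"
  using moment_mono[OF continuous_on_const[of _ a] assms(1) _ assms(3), of "N - 1"]
    moment_mono[OF assms(1) continuous_on_const[of _ b] _ assms(3), of "N - 1"] assms(2,4)
  by (simp_all add: moment_const of_nat_diff)

lemma moment_tendsto:
  assumes v: "\<And>k. continuous_on {0..1} (v k)" and le: "\<And>k t. t \<in> {0..1} \<Longrightarrow> \<bar>v k t\<bar> \<le> C"
    and lim: "\<And>t. t \<in> {0..1} \<Longrightarrow> (\<lambda>k. v k t) \<longlonglongrightarrow> u t" and s: "s \<in> {0..1}"
  shows "(\<lambda>k. moment n (v k) s) \<longlonglongrightarrow> moment n u s"
  unfolding moment_def
proof (rule dominated_convergence(2)[where h = "\<lambda>_. C"])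
  fix k and e :: real assume e: "e \<in> {0..1}"
  have "\<bar>e ^ n\<bar> * \<bar>v k (s * e\<^sup>2)\<bar> \<le> 1 * C"
    using e by (intro mult_mono le sq_scale_unit[OF s e]) (auto simp: power_le_one)
  then show "norm (e ^ n * v k (s * e\<^sup>2)) \<le> C" by (simp add: abs_mult)
  show "(\<lambda>k. e ^ n * v k (s * e\<^sup>2)) \<longlonglongrightarrow> e ^ n * u (s * e\<^sup>2)"
    by (intro tendsto_intros lim sq_scale_unit[OF s e])
qed (auto intro!: moment_integrand_integrable v s)

context nonlinearity
begin

text \<open>Bounded monotone iterates converge pointwise. A uniform slope bound makes the limit
  continuous, dominated convergence makes it a fixed point of the integral operator, and the
  operator then supplies two derivatives.\<close>

lemma picard_limit:
  assumes l: "l > 0" and bd: "\<And>k t. t \<in> {0..1} \<Longrightarrow> picard l k t \<le> C"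
  obtains u u1 u2 where "C1_unit u u1" "C1_unit u1 u2" "u 1 = 0"
    "\<And>t. t \<in> {0..1} \<Longrightarrow> (\<lambda>k. picard l k t) \<longlonglongrightarrow> u t"
    "\<And>t. t \<in> {0..1} \<Longrightarrow> 4 * t * u2 t + 2 * real N * u1 t = - (l * f (u t))"
    "\<And>t. 0 \<le> t \<Longrightarrow> t < 1 \<Longrightarrow> u t > 0"
proof -
  define u where "u t = lim (\<lambda>k. picard l k t)" for t
  have lim: "(\<lambda>k. picard l k t) \<longlonglongrightarrow> u t" if t: "t \<in> {0..1}" for t
  proof -
    have "\<forall>k. picard l k t \<le> C" using bd[OF t] by blast
    then obtain L where "(\<lambda>k. picard l k t) \<longlonglongrightarrow> L"
      using incseq_convergent[OF picard_incseq[of l t]] l t by (metis less_imp_le)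
    then show ?thesis unfolding u_def by (rule convergent_LIMSEQ_iff[THEN iffD1, OF convergentI])
  qed
  note fcont = C1_unit_cont[OF C1_unit_f[OF picard_C1]]
  \<comment> \<open>A function bounded by \<open>f C\<close> has moment at most
    \<open>f C / N\<close>, and the slope of an iterate carries the further factor
    \<open>l / 2\<close>.\<close>
  define K where "K = l * f C / (2 * N)"
  have K: "K \<ge> 0" using l f_pos[of C] by (simp add: K_def)
  have slope: "- K \<le> picard1 l k t" if t: "t \<in> {0..1}" for k t
  proof (cases k)
    case (Suc j)
    have "moment (N - 1) (\<lambda>s. f (picard l j s)) t \<le> f C / N"
      by (rule moment_bounds(2)[OF fcont _ t N]) (use bd f_mono f_pos less_imp_le in blast)
    then have "l / 2 * moment (N - 1) (\<lambda>s. f (picard l j s)) t \<le> l / 2 * (f C / N)"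
      using l by (intro mult_left_mono) auto
    then show ?thesis by (simp add: Suc K_def)
  qed (use K in simp)
  have lip: "picard l k s - picard l k t \<le> K * (t - s)" if "0 \<le> s" "s \<le> t" "t \<le> 1" for k s t
  proof -
    have "C1_unit (\<lambda>t. picard l k t + K * t) (\<lambda>t. picard1 l k t + K)"
      using picard_C1[of l k] by (auto simp: C1_unit_def intro!: derivative_eq_intros continuous_intros)
    moreover have "picard1 l k t + K \<ge> 0" if "t \<in> {0..1}" for t using slope[OF that, of k] by linarith
    ultimately have "picard l k s + K * s \<le> picard l k t + K * t"
      using that by (intro C1_unit_mono[where v = "\<lambda>t. picard l k t + K * t" and v' = "\<lambda>t. picard1 l k t + K"]) auto
    then show ?thesis by (simp add: algebra_simps)
  qed
  have u_lip: "\<bar>u s - u t\<bar> \<le> K * (t - s)" if st: "0 \<le> s" "s \<le> t" "t \<le> 1" for s t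
  proof -
    have d: "(\<lambda>k. picard l k s - picard l k t) \<longlonglongrightarrow> u s - u t"
      using st by (intro tendsto_diff lim) auto
    have "u s - u t \<le> K * (t - s)" by (rule LIMSEQ_le_const2[OF d]) (use lip[OF st] in blast)
    moreover have "0 \<le> u s - u t"
      by (rule LIMSEQ_le_const[OF d]) (use picard_antimono[of l s t] st l in auto)
    ultimately show ?thesis by simp
  qed
  have u_cont: "continuous_on {0..1} u"
  proof (rule lipschitz_on_continuous_on[of K])
    show "K-lipschitz_on {0..1} u"
    proof (rule lipschitz_onI[OF _ K])
      fix s t :: real assume "s \<in> {0..1}" "t \<in> {0..1}"
      then show "dist (u s) (u t) \<le> K * dist s t"
        using u_lip[of s t] u_lip[of t s] by (cases "s \<le> t") (auto simp: dist_real_def abs_minus_commute)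
    qed
  qed
  have fu_cont: "continuous_on {0..1} (\<lambda>s. f (u s))"
    by (rule continuous_on_compose2[OF f_cont u_cont]) auto
  have f_bd: "\<bar>f (picard l k t)\<bar> \<le> f C" if "t \<in> {0..1}" for k t
    using f_mono[OF bd[OF that]] f_pos by (simp add: abs_of_pos)
  have f_lim: "(\<lambda>k. f (picard l k t)) \<longlonglongrightarrow> f (u t)" if "t \<in> {0..1}" for t
    using isCont_tendsto_compose[OF DERIV_isCont[OF f] lim[OF that]] .
  have m_lim: "(\<lambda>k. moment (N - 1) (\<lambda>s. f (picard l k s)) t) \<longlonglongrightarrow> moment (N - 1) (\<lambda>s. f (u s)) t"
    if "t \<in> {0..1}" for t
    by (rule moment_tendsto[OF fcont f_bd f_lim that])
  have u_fix: "u t = l * dirichlet N (\<lambda>s. f (u s)) t" if t: "t \<in> {0..1}" for t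
  proof -
    have sub: "{t..1} \<subseteq> {0..1}" using t by auto
    have "(\<lambda>k. integral {t..1} (moment (N - 1) (\<lambda>s. f (picard l k s)))) \<longlonglongrightarrow> integral {t..1} (moment (N - 1) (\<lambda>s. f (u s)))"
    proof (rule dominated_convergence(2)[where h = "\<lambda>_. f C / N"])
      show "moment (N - 1) (\<lambda>s. f (picard l k s)) integrable_on {t..1}" for k
        by (intro integrable_continuous_interval continuous_on_subset[OF moment_cont[OF fcont] sub])
      fix k s assume "s \<in> {t..1}"
      then have s: "s \<in> {0..1}" using sub by blast
      show "norm (moment (N - 1) (\<lambda>s. f (picard l k s)) s) \<le> f C / N"
        using moment_bounds[OF fcont[of l k] _ s N, of 0 "f C"] f_mono[OF bd] f_pos
        by (simp add: less_imp_le)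
    qed (use m_lim sub in auto)
    then have "(\<lambda>k. picard l (Suc k) t) \<longlonglongrightarrow> l * dirichlet N (\<lambda>s. f (u s)) t"
      unfolding picard.simps dirichlet_def by (intro tendsto_intros) auto
    then show ?thesis using LIMSEQ_unique LIMSEQ_Suc[OF lim[OF t]] by blast
  qed
  define u1 where "u1 t = l * (- moment (N - 1) (\<lambda>s. f (u s)) t / 2)" for t
  define u2 where "u2 t = l * (- moment (N + 1) (\<lambda>s. f1 (u s) * u1 s) t / 2)" for t
  have u: "C1_unit u u1"
    unfolding u1_def[abs_def] by (rule C1_unit_cong[OF C1_unit_cmult[OF dirichlet_C1_unit[OF fu_cont]] u_fix])
  have u1: "C1_unit u1 u2"
    unfolding u1_def[abs_def] u2_def[abs_def] by (intro C1_unit_cmult dirichlet_C2_unit[OF _ N] C1_unit_f[OF u, unfolded u1_def[abs_def]])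
  have u_1: "u 1 = 0" using u_fix[of 1] by simp
  have u_eq: "4 * t * u2 t + 2 * real N * u1 t = - (l * f (u t))" if t: "t \<in> {0..1}" for t
  proof -
    have "4 * t * u2 t + 2 * real N * u1 t = l * (4 * t * (- moment (N + 1) (\<lambda>s. f1 (u s) * u1 s) t / 2)
        + 2 * real N * (- moment (N - 1) (\<lambda>s. f (u s)) t / 2))"
      unfolding u1_def[of t] u2_def[of t] by (simp only: ring_distribs mult_ac)
    also have "\<dots> = - (l * f (u t))" by (subst dirichlet_eq[OF C1_unit_f[OF u] N t]) simp
    finally show ?thesis .
  qed
  have u_nonneg: "u t \<ge> 0" if "t \<in> {0..1}" for t
    by (rule LIMSEQ_le_const[OF lim[OF that]]) (use picard_nonneg[of l t] l that in auto)
  have u_pos: "u t > 0" if t: "0 \<le> t" "t < 1" for t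
  proof -
    \<comment> \<open>As \<open>f (u s) \<ge> f 0\<close>, the slope of \<open>u\<close> is at most
      \<open>- c\<close>; together with \<open>u 1 = 0\<close> this gives strict positivity.\<close>
    define c where "c = l * f 0 / (2 * N)"
    have c: "c > 0" using l f_pos[of 0] N by (simp add: c_def)
    have "u1 t + c \<le> 0" if t: "t \<in> {0..1}" for t
    proof -
      have "moment (N - 1) (\<lambda>_. f 0) t \<le> moment (N - 1) (\<lambda>s. f (u s)) t"
        by (intro moment_mono fu_cont t f_mono u_nonneg) auto
      moreover have "moment (N - 1) (\<lambda>_. f 0) t = f 0 / N" using N by (simp add: moment_const of_nat_diff)
      ultimately have "l / 2 * (f 0 / N) \<le> l / 2 * moment (N - 1) (\<lambda>s. f (u s)) t"
        using l by (intro mult_left_mono) auto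
      then show ?thesis by (simp add: u1_def c_def)
    qed
    moreover have "C1_unit (\<lambda>t. u t + c * t) (\<lambda>t. u1 t + c)"
      using u by (auto simp: C1_unit_def intro!: derivative_eq_intros continuous_intros)
    ultimately have "u 1 + c * 1 \<le> u t + c * t"
      using t by (intro C1_unit_antimono[where v = "\<lambda>t. u t + c * t" and v' = "\<lambda>t. u1 t + c"]) auto
    moreover have "c * (1 - t) > 0" using c t by simp
    ultimately show ?thesis using u_1 by (simp add: algebra_simps)
  qed
  show ?thesis by (rule that[OF u u1 u_1 lim u_eq u_pos])
qed

text \<open>Minimality holds because every classical solution, radial or not, dominates all iterates
  and hence their limit.\<close>

lemma minimal_solution_radial:
  assumes l: "l > 0" and DIM: "N = DIM('a::euclidean_space)"
    and u: "C1_unit u u1" "C1_unit u1 u2" and u_1: "u 1 = 0"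
    and lim: "\<And>t. t \<in> {0..1} \<Longrightarrow> (\<lambda>k. picard l k t) \<longlonglongrightarrow> u t"
    and eq: "\<And>t. t \<in> {0..1} \<Longrightarrow> 4 * t * u2 t + 2 * real N * u1 t = - (l * f (u t))"
    and pos: "\<And>t. 0 \<le> t \<Longrightarrow> t < 1 \<Longrightarrow> u t > 0"
  shows "minimal_solution (ball 0 1) f l (\<lambda>x::'a. u (x \<bullet> x))"
  unfolding minimal_solution_def
proof (intro conjI allI impI ballI)
  have "- laplacian (\<lambda>x::'a. u (x \<bullet> x)) x = l * f (u (x \<bullet> x))" if "norm x < 1" for x
    using laplacian_radial[OF u that] eq[of "x \<bullet> x"] inner_self_less_1[OF that] by (simp add: DIM)
  then show "classical_solution (ball 0 1) f l (\<lambda>x::'a. u (x \<bullet> x))"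
    using C2_upto_boundary_radial[OF u, where 'a='a] u_1 pos inner_self_less_1
    by (auto simp: classical_solution_def C2_upto_boundary_def dot_square_norm abs_square_less_1)
next
  fix v :: "'a \<Rightarrow> real" and x :: 'a
  assume v: "classical_solution (ball 0 1) f l v" and "x \<in> closure (ball 0 1)"
  then have x: "norm x \<le> 1" by simp
  have "(\<lambda>k. picard l k (x \<bullet> x)) \<longlonglongrightarrow> u (x \<bullet> x)" using lim inner_self_le_1[OF x] by simp
  then show "u (x \<bullet> x) \<le> v x"
    by (rule LIMSEQ_le_const2) (use picard_le_classical[OF less_imp_le[OF l] DIM v x] in blast)
qed

end

subsection \<open>The extremal solution in the presence of a stable singular solution\<close>

text \<open>\<open>W\<close> is an unbounded solution for the parameter \<open>1\<close>, and
  \<open>\<psi>\<close> a strict supersolution of the linearisation at \<open>W\<close>. The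
  constant \<open>c\<close> measures strictness against \<open>f (W t)\<close>, the size of the
  error caused by changing the parameter; \<open>W_\<psi>\<close> keeps maxima of quotients by
  \<open>\<psi>\<close> away from the origin.\<close>

locale singular_solution = nonlinearity +
  fixes W W1 W2 \<psi> \<psi>1 \<psi>2 :: "real \<Rightarrow> real" and c :: real
  assumes W: "\<And>t. t > 0 \<Longrightarrow> (W has_real_derivative W1 t) (at t)"
    and W1: "\<And>t. t > 0 \<Longrightarrow> (W1 has_real_derivative W2 t) (at t)"
    and W2: "continuous_on {0<..} W2"
    and W1_nonpos: "\<And>t. t > 0 \<Longrightarrow> W1 t \<le> 0" and W2_nonneg: "\<And>t. t > 0 \<Longrightarrow> W2 t \<ge> 0"
    and W_1: "W 1 = 0" and W_eq: "\<And>t. t > 0 \<Longrightarrow> 4 * t * W2 t + 2 * real N * W1 t = - f (W t)"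
    and W_unbounded: "\<And>C. \<exists>t. 0 < t \<and> t \<le> 1 \<and> W t > C"
    and \<psi>: "\<And>t. t > 0 \<Longrightarrow> (\<psi> has_real_derivative \<psi>1 t) (at t)"
    and \<psi>1: "\<And>t. t > 0 \<Longrightarrow> (\<psi>1 has_real_derivative \<psi>2 t) (at t)"
    and \<psi>_pos: "\<And>t. t > 0 \<Longrightarrow> \<psi> t > 0"
    and \<psi>_super: "\<And>t. 0 < t \<Longrightarrow> t \<le> 1 \<Longrightarrow>
       4 * t * \<psi>2 t + 2 * real N * \<psi>1 t + f1 (W t) * \<psi> t \<le> - (c * f (W t))"
    and W_\<psi>: "((\<lambda>t. W t / \<psi> t) \<longlongrightarrow> 0) (at_right 0)"
    and c: "c > 0"
begin

lemma W_antimono: "0 < s \<Longrightarrow> s \<le> t \<Longrightarrow> W t \<le> W s"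
  by (rule DERIV_nonpos_imp_nonincreasing[of s t W])
     (auto intro!: exI[of _ "W1 _"] W W1_nonpos)

text \<open>The affine map moves the singularity out of the unit interval, and convexity of
  \<open>W\<close> makes the rescaled function a supersolution for \<open>l\<close>. It enters
  \<open>picard_le_super\<close> as a constant sequence.\<close>

lemma picard_le_singular:
  assumes l: "0 < l" "l < 1" and t: "t \<in> {0..1}"
  shows "picard l k t \<le> W (l * t + (1 - l))"
proof -
  have pos: "l * t + (1 - l) > 0" if "t \<in> {0..1}" for t
    using l that by (intro add_nonneg_pos mult_nonneg_nonneg) auto
  have C1: "C1_unit (\<lambda>t. v (l * t + (1 - l))) (\<lambda>t. l * v' (l * t + (1 - l)))"
    if v: "\<And>t. t > 0 \<Longrightarrow> (v has_real_derivative v' t) (at t)" and v': "continuous_on {0<..} v'" for v v'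
    unfolding C1_unit_def
  proof (intro conjI ballI)
    fix t :: real assume t: "t \<in> {0..1}"
    have "((\<lambda>t. v (l * t + (1 - l))) has_real_derivative v' (l * t + (1 - l)) * l) (at t within {0..1})"
      by (rule DERIV_chain2[where f = v and g = "\<lambda>t. l * t + (1 - l)", OF v[OF pos[OF t]]])
         (auto intro!: derivative_eq_intros)
    then show "((\<lambda>t. v (l * t + (1 - l))) has_real_derivative l * v' (l * t + (1 - l))) (at t within {0..1})"
      by (simp add: mult.commute)
  next
    have "continuous_on {0..1} (\<lambda>t. v' (l * t + (1 - l)))"
      by (rule continuous_on_compose2[OF v']) (use pos in \<open>auto intro!: continuous_intros\<close>)
    then show "continuous_on {0..1} (\<lambda>t. l * v' (l * t + (1 - l)))" by (intro continuous_intros)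
  qed
  have W1_cont: "continuous_on {0<..} W1"
    using W1 DERIV_isCont by (intro continuous_at_imp_continuous_on) auto
  show ?thesis
  proof (rule picard_le_super[where v = "\<lambda>_ t. W (l * t + (1 - l))"
        and ?v1.0 = "\<lambda>_ t. l * W1 (l * t + (1 - l))" and ?v2.0 = "\<lambda>_ t. l * (l * W2 (l * t + (1 - l)))"])
    show "C1_unit (\<lambda>t. W (l * t + (1 - l))) (\<lambda>t. l * W1 (l * t + (1 - l)))"
      by (rule C1[OF W W1_cont])
    show "C1_unit (\<lambda>t. l * W1 (l * t + (1 - l))) (\<lambda>t. l * (l * W2 (l * t + (1 - l))))"
      by (intro C1_unit_cmult C1[OF W1 W2])
    show "0 \<le> W (l * t + (1 - l))" if t: "t \<in> {0..1}" for t
      using W_antimono[OF pos[OF t], of 1] mult_left_le[of t l] l t by (simp add: W_1)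
    fix s :: real assume s: "s \<in> {0..1}"
    let ?s = "l * s + (1 - l)"
    have "4 * s * (l * (l * W2 ?s)) + 2 * real N * (l * W1 ?s)
        = l * (4 * ?s * W2 ?s + 2 * real N * W1 ?s) - 4 * (l * (1 - l)) * W2 ?s"
      by (simp only: ring_distribs) (simp only: algebra_simps)
    also have "\<dots> \<le> l * (4 * ?s * W2 ?s + 2 * real N * W1 ?s)"
      using W2_nonneg[OF pos[OF s]] l by simp
    finally show "4 * s * (l * (l * W2 ?s)) + 2 * real N * (l * W1 ?s) \<le> - (l * f (W ?s))"
      unfolding W_eq[OF pos[OF s]] by simp
  qed (use l t in \<open>auto simp: W_1\<close>)
qed

section \<open>Gap estimate and identification of the extremal solution\<close>

text \<open>A maximum principle for the quotient \<open>(W - u) / \<psi>\<close>: at its maximum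
  point the inequality for \<open>\<psi>\<close> and the tangent inequality for \<open>f\<close>
  bound it by \<open>(1 - l) / c\<close>.\<close>

lemma minimal_gap:
  assumes l: "0 < l" "l < 1" and u: "C1_unit u u1" "C1_unit u1 u2" and u_1: "u 1 = 0"
    and eq: "\<And>t. t \<in> {0..1} \<Longrightarrow> 4 * t * u2 t + 2 * real N * u1 t = - (l * f (u t))"
    and nonneg: "\<And>t. t \<in> {0..1} \<Longrightarrow> u t \<ge> 0"
    and le: "\<And>t. 0 < t \<Longrightarrow> t \<le> 1 \<Longrightarrow> u t \<le> W t" and t: "0 < t" "t \<le> 1"
  shows "W t - u t \<le> (1 - l) / c * \<psi> t"
proof (rule ccontr)
  assume neg: "\<not> ?thesis"
  define h where "h s = (W s - u s) / \<psi> s" for s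
  have ht: "h t > (1 - l) / c"
    using neg \<psi>_pos[OF t(1)] by (simp add: h_def field_simps)
  then have ht0: "h t > 0" using l c by (smt (verit) divide_pos_pos)
  have "\<forall>\<^sub>F s in at_right 0. W s / \<psi> s < h t"
    using order_tendstoD(2)[OF W_\<psi> ht0] .
  then obtain b where b: "b > 0" "\<And>s. 0 < s \<Longrightarrow> s < b \<Longrightarrow> W s / \<psi> s < h t"
    by (auto simp: eventually_at_right_field)
  \<comment> \<open>At \<open>d\<close> the quotient is already below \<open>h t\<close>, and at
    \<open>1\<close> it is zero, so its maximum over the interval is attained in the
    interior.\<close>
  define d where "d = min b t / 2"
  have d: "0 < d" "d < b" "d < t" using b t by (auto simp: d_def)
  have "h d \<le> W d / \<psi> d"
    using \<psi>_pos[OF d(1)] nonneg[of d] d t by (simp add: h_def divide_right_mono)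
  then have hd: "h d < h t" using b(2)[OF d(1,2)] by simp
  have "continuous_on {d..1} W" "continuous_on {d..1} \<psi>"
    using d by (auto intro!: continuous_at_imp_continuous_on DERIV_isCont[OF W] DERIV_isCont[OF \<psi>])
  moreover have "continuous_on {d..1} u"
    by (rule continuous_on_subset[OF C1_unit_cont[OF u(1)]]) (use d in auto)
  ultimately have "continuous_on {d..1} h"
    unfolding h_def[abs_def] using less_imp_neq[OF \<psi>_pos] d
    by (intro continuous_intros) (auto simp: less_le_trans)
  then obtain s where s: "s \<in> {d..1}" "\<And>x. x \<in> {d..1} \<Longrightarrow> h x \<le> h s"
    using continuous_attains_sup[of "{d..1}" h] d t by auto
  have hs: "h s \<ge> h t" using s(2)[of t] d t by simp
  have "h 1 = 0" by (simp add: h_def W_1 u_1)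
  then have "s \<noteq> 1" "s \<noteq> d" using hs hd ht0 by auto
  then have s': "d < s" "s < 1" "0 < s" using s d by auto
  define e where "e = min (s - d) (1 - s)"
  have e: "e > 0" using s' by (simp add: e_def)
  \<comment> \<open>Maximality of \<open>h s\<close> means that \<open>D\<close> has a local minimum
    at \<open>s\<close>, which fixes the first derivative there and the sign of the second.\<close>
  define D D1 where "D x = h s * \<psi> x - (W x - u x)" and "D1 x = h s * \<psi>1 x - (W1 x - u1 x)" for x
  have near: "d < s + x \<and> s + x < 1 \<and> 0 < s + x" if "\<bar>x\<bar> < e" for x
    using that d by (auto simp: e_def)
  have D: "(D has_real_derivative D1 x) (at x)" if "0 < x" "x < 1" for x
    unfolding D_def[abs_def] D1_def
    by (intro DERIV_diff DERIV_cmult \<psi> W C1_unit_at[OF u(1)] that)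
  have D1: "(D1 has_real_derivative h s * \<psi>2 s - (W2 s - u2 s)) (at s)"
    unfolding D1_def[abs_def]
    by (intro DERIV_diff DERIV_cmult \<psi>1 W1 C1_unit_at[OF u(2)] s')
  have D_min: "D s \<le> D (s + x)" if "\<bar>x\<bar> < e" for x
  proof -
    have p: "\<psi> (s + x) > 0" "\<psi> s > 0" using near[OF that] s' \<psi>_pos by auto
    have "h (s + x) \<le> h s" using near[OF that] by (intro s(2)) auto
    then have "W (s + x) - u (s + x) \<le> h s * \<psi> (s + x)" using p by (simp add: h_def[of "s + x"] field_simps)
    moreover have "W s - u s = h s * \<psi> s" using p by (simp add: h_def)
    ultimately show ?thesis by (simp add: D_def)
  qed
  have "D1 s = 0"
  proof (rule DERIV_local_min[OF D[OF s'(3,2)] e])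
    show "\<forall>y. \<bar>s - y\<bar> < e \<longrightarrow> D s \<le> D y"
    proof (intro allI impI)
      fix y assume "\<bar>s - y\<bar> < e"
      then show "D s \<le> D y" using D_min[of "y - s"] by (simp add: abs_minus_commute)
    qed
  qed
  have "h s * \<psi>2 s - (W2 s - u2 s) \<ge> 0"
  proof (rule second_deriv_local_min[OF e, where g = "\<lambda>x. D (s + x)" and g' = "\<lambda>x. D1 (s + x)"])
    show "((\<lambda>x. D (s + x)) has_real_derivative D1 (s + x)) (at x)" if "\<bar>x\<bar> < e" for x
      using DERIV_shift[of D "D1 (s + x)" x s] D[of "s + x"] near[OF that] by (simp add: add.commute)
    show "((\<lambda>x. D1 (s + x)) has_real_derivative h s * \<psi>2 s - (W2 s - u2 s)) (at 0)"
      using DERIV_shift[of D1 "h s * \<psi>2 s - (W2 s - u2 s)" 0 s] D1 by (simp add: add.commute)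
    show "D (s + 0) \<le> D (s + x)" if "\<bar>x\<bar> < e" for x using D_min[OF that] by simp
  qed
  then have "0 \<le> 4 * s * (h s * \<psi>2 s - (W2 s - u2 s)) + 2 * real N * D1 s"
    using s' \<open>D1 s = 0\<close> by simp
  also have "\<dots> = h s * (4 * s * \<psi>2 s + 2 * real N * \<psi>1 s) - (4 * s * W2 s + 2 * real N * W1 s)
      + (4 * s * u2 s + 2 * real N * u1 s)"
    by (simp add: D1_def algebra_simps)
  also have "\<dots> = h s * (4 * s * \<psi>2 s + 2 * real N * \<psi>1 s) + f (W s) - l * f (u s)"
    using W_eq[OF s'(3)] eq[of s] s' by simp
  also have "\<dots> \<le> h s * (- f1 (W s) * \<psi> s - c * f (W s)) + f (W s) - l * f (u s)"
    using \<psi>_super[OF s'(3)] s' hs ht0 by (intro diff_right_mono add_right_mono mult_left_mono) auto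
  \<comment> \<open>The bracket is the tangent at \<open>W s\<close>, evaluated at
    \<open>u s\<close>, minus \<open>f (u s)\<close>; convexity makes it nonpositive.\<close>
  also have "\<dots> = (f (W s) + f1 (W s) * (u s - W s) - f (u s)) + (1 - l) * f (u s) - h s * c * f (W s)"
  proof -
    have "W s - u s = h s * \<psi> s" using \<psi>_pos[OF s'(3)] by (simp add: h_def)
    then have "u s = W s - h s * \<psi> s" by simp
    then have "f1 (W s) * (u s - W s) = - (f1 (W s) * (h s * \<psi> s))" by simp
    then show ?thesis by (simp add: algebra_simps)
  qed
  also have "\<dots> \<le> (1 - l) * f (u s) - h s * c * f (W s)"
    using f_tangent[of "W s" "u s"] by simp
  also have "\<dots> \<le> (1 - l) * f (W s) - h s * c * f (W s)"
    using l le[of s] s' f_mono by (intro diff_right_mono mult_left_mono) auto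
  finally have "h s * c * f (W s) \<le> (1 - l) * f (W s)" by simp
  then have "h s * c \<le> 1 - l" using f_pos[of "W s"] by simp
  then have "h s \<le> (1 - l) / c" using c by (simp add: field_simps)
  then show False using hs ht by simp
qed

lemma minimal_exists:
  assumes l: "0 < l" "l < 1" and DIM: "N = DIM('a::euclidean_space)"
  shows "\<exists>u. minimal_solution (ball 0 1) f l (\<lambda>x::'a. u (x \<bullet> x)) \<and>
     (\<forall>t\<in>{0..1}. (\<lambda>k. picard l k t) \<longlonglongrightarrow> u t) \<and>
     (\<forall>t\<in>{0..1}. u t \<le> u 0) \<and>
     (\<forall>t. 0 < t \<and> t \<le> 1 \<longrightarrow> u t \<le> W t \<and> W t - (1 - l) / c * \<psi> t \<le> u t)"
proof -
  have W_le: "picard l k t \<le> W (1 - l)" if t: "t \<in> {0..1}" for k t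
    by (rule order_trans[OF picard_le_singular[OF l t] W_antimono]) (use l t in auto)
  obtain u u1 u2 where u: "C1_unit u u1" "C1_unit u1 u2" "u 1 = 0"
    "\<And>t. t \<in> {0..1} \<Longrightarrow> (\<lambda>k. picard l k t) \<longlonglongrightarrow> u t"
    "\<And>t. t \<in> {0..1} \<Longrightarrow> 4 * t * u2 t + 2 * real N * u1 t = - (l * f (u t))"
    "\<And>t. 0 \<le> t \<Longrightarrow> t < 1 \<Longrightarrow> u t > 0"
    using picard_limit[OF l(1) W_le] by metis
  have le: "u t \<le> W t" if t: "0 < t" "t \<le> 1" for t
  proof (rule LIMSEQ_le_const2[OF u(4)])
    have "picard l k t \<le> W t" for k
    proof (rule order_trans[OF picard_le_singular[OF l] W_antimono])
      show "t \<le> l * t + (1 - l)" using mult_left_mono[of t 1 "1 - l"] l t by (simp add: algebra_simps)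
    qed (use t in auto)
    then show "\<exists>n. \<forall>k\<ge>n. picard l k t \<le> W t" by blast
  qed (use t in auto)
  have nonneg: "u t \<ge> 0" if "t \<in> {0..1}" for t
    using u(3) u(6)[of t] that by (cases "t = 1") (auto intro: less_imp_le)
  have max: "u t \<le> u 0" if t: "t \<in> {0..1}" for t
    by (rule LIMSEQ_le[OF u(4)[OF t] u(4)]) (use picard_antimono[of l 0 t] l t in auto)
  have "W t - u t \<le> (1 - l) / c * \<psi> t" if "0 < t" "t \<le> 1" for t
    by (rule minimal_gap[OF l u(1-3) u(5) nonneg le that])
  then show ?thesis
    using minimal_solution_radial[OF l(1) DIM u] u(3,4) le max
    by (intro exI[of _ u]) (auto simp: algebra_simps)
qed

text \<open>A solution would bound the iterates for the parameter \<open>1\<close>, and with them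
  all minimal solutions for \<open>m < 1\<close>, by one constant. The gap estimate makes the latter
  approach \<open>W\<close>, which is unbounded.\<close>

lemma no_solution:
  assumes l: "l > 1" and DIM: "N = DIM('a::euclidean_space)"
  shows "\<not> ((\<exists>u :: 'a \<Rightarrow> real. classical_solution (ball 0 1) f l u) \<or> (\<exists>u :: 'a \<Rightarrow> real. weak_solution (ball 0 1) f l u))"
proof
  assume "(\<exists>u :: 'a \<Rightarrow> real. classical_solution (ball 0 1) f l u) \<or> (\<exists>u :: 'a \<Rightarrow> real. weak_solution (ball 0 1) f l u)"
  then obtain C where C: "\<And>k t. t \<in> {0..1} \<Longrightarrow> picard 1 k t \<le> C"
    using solution_imp_picard_bounded[OF l DIM] by blast
  obtain t where t: "0 < t" "t \<le> 1" "W t > C" using W_unbounded by blast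
  have "W t - (1 - m) / c * \<psi> t \<le> C" if m: "0 < m" "m < 1" for m
  proof -
    obtain u where "\<forall>t\<in>{0..1}. (\<lambda>k. picard m k t) \<longlonglongrightarrow> u t"
      and "\<forall>t. 0 < t \<and> t \<le> 1 \<longrightarrow> u t \<le> W t \<and> W t - (1 - m) / c * \<psi> t \<le> u t"
      using minimal_exists[OF m DIM] by blast
    then have u: "(\<lambda>k. picard m k t) \<longlonglongrightarrow> u t" "W t - (1 - m) / c * \<psi> t \<le> u t"
      using t by simp_all
    have "picard m k t \<le> C" for k
      using picard_mono_param[of m 1 t k] C[of t k] m t by auto
    then have "u t \<le> C" by (intro LIMSEQ_le_const2[OF u(1)]) blast
    then show ?thesis using u(2) by simp
  qed
  then have "\<forall>\<^sub>F m in at_left 1. W t - (1 - m) / c * \<psi> t \<le> C"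
    by (intro eventually_at_leftI[of 0]) auto
  moreover have "((\<lambda>m. W t - (1 - m) / c * \<psi> t) \<longlongrightarrow> W t - (1 - 1) / c * \<psi> t) (at_left 1)"
    using c by (intro tendsto_intros) auto
  ultimately have "W t - (1 - 1) / c * \<psi> t \<le> C"
    by (intro tendsto_upperbound) auto
  then show False using t by simp
qed

text \<open>The extremal parameter is \<open>1\<close>. Away from the origin the limit follows by
  squeezing with the gap estimate; at the origin \<open>u l 0 \<ge> u l t\<close>, and the limits
  \<open>W t\<close> are arbitrarily large.\<close>

theorem extremal_solution_singular:
  assumes DIM: "N = DIM('a::euclidean_space)"
  shows "extremal_solution (ball 0 1) f (\<lambda>x::'a. if x = 0 then \<infinity> else ereal (W (x \<bullet> x)))"
proof -
  let ?P = "\<lambda>l u. minimal_solution (ball 0 1) f l (\<lambda>x::'a. u (x \<bullet> x)) \<and> (\<forall>t\<in>{0..1}. u t \<le> u 0) \<and>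
     (\<forall>t. 0 < t \<and> t \<le> 1 \<longrightarrow> u t \<le> W t \<and> W t - (1 - l) / c * \<psi> t \<le> u t)"
  have "\<exists>u. ?P l u" if "l \<in> {0<..<1}" for l
    using minimal_exists[OF _ _ DIM, of l] that unfolding greaterThanLessThan_iff by blast
  then have "\<forall>l\<in>{0<..<1}. \<exists>u. ?P l u" by blast
  from bchoice[OF this] obtain u where P: "\<And>l. l \<in> {0<..<1} \<Longrightarrow> ?P l (u l)" by blast
  have u: "minimal_solution (ball 0 1) f l (\<lambda>x::'a. u l (x \<bullet> x))" if "l \<in> {0<..<1}" for l
    using P[OF that] by blast
  have max: "u l t \<le> u l 0" if "l \<in> {0<..<1}" "t \<in> {0..1}" for l t
    using P[OF that(1)] that(2) by blast
  have bd: "u l t \<le> W t \<and> W t - (1 - l) / c * \<psi> t \<le> u l t" if "l \<in> {0<..<1}" "0 < t" "t \<le> 1" for l t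
    using P[OF that(1)] that(2,3) by blast
  have ev: "\<forall>\<^sub>F l in at_left 1. l \<in> {0<..<(1::real)}"
    by (intro eventually_at_leftI[of 0]) auto
  have low: "((\<lambda>l. W t - (1 - l) / c * \<psi> t) \<longlongrightarrow> W t) (at_left 1)" for t
  proof -
    have "((\<lambda>l. W t - (1 - l) / c * \<psi> t) \<longlongrightarrow> W t - (1 - 1) / c * \<psi> t) (at_left 1)"
      using c by (intro tendsto_intros) auto
    then show ?thesis by simp
  qed
  have lim: "((\<lambda>l. u l t) \<longlongrightarrow> W t) (at_left 1)" if t: "0 < t" "t \<le> 1" for t
    by (rule tendsto_sandwich[OF _ _ low[of t] tendsto_const[of "W t"]])
       (use eventually_mono[OF ev] bd[OF _ t] in auto)
  have lim0: "((\<lambda>l. ereal (u l 0)) \<longlongrightarrow> \<infinity>) (at_left 1)"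
    unfolding tendsto_PInfty
  proof
    fix r
    obtain t where t: "0 < t" "t \<le> 1" "W t > r" using W_unbounded by blast
    have "\<forall>\<^sub>F l in at_left 1. u l t > r" using order_tendstoD(1)[OF lim[OF t(1,2)] t(3)] .
    with ev show "\<forall>\<^sub>F l in at_left 1. ereal r < ereal (u l 0)"
    proof eventually_elim
      case (elim l)
      then show ?case using max[of l t] t by auto
    qed
  qed
  have "((\<lambda>l. ereal (u l (x \<bullet> x))) \<longlongrightarrow> (if x = 0 then \<infinity> else ereal (W (x \<bullet> x)))) (at_left 1)"
    if "x \<in> closure (ball 0 1)" for x :: 'a
    using lim0 lim[of "x \<bullet> x"] inner_self_le_1[of x] that by auto
  moreover have "extremal_parameter (ball (0::'a) 1) f 1"
    unfolding extremal_parameter_def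
  proof (intro conjI allI impI)
    show "\<exists>u :: 'a \<Rightarrow> real. minimal_solution (ball 0 1) f l u" if "0 < l \<and> l < 1" for l
      using u[of l] that by (intro exI[of _ "\<lambda>x::'a. u l (x \<bullet> x)"]) auto
    show "\<not> (\<exists>u :: 'a \<Rightarrow> real. classical_solution (ball 0 1) f l u)"
      and "\<not> (\<exists>u :: 'a \<Rightarrow> real. weak_solution (ball 0 1) f l u)" if "l > 1" for l
      using no_solution[OF that DIM] by blast+
  qed simp
  ultimately show ?thesis
    unfolding extremal_solution_def using u
    by (intro exI[of _ 1] exI[of _ "\<lambda>l x. u l (x \<bullet> x)"] conjI) auto
qed

end

subsection \<open>A singular solution with sparse scales\<close>

lemma antiderivative_exists:
  fixes g g' :: "real \<Rightarrow> real"
  assumes "\<And>t. t > 0 \<Longrightarrow> (g has_real_derivative g' t) (at t)"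
  shows "\<exists>G. \<forall>t>0. (G has_real_derivative g t) (at t)"
proof -
  have "\<exists>G. \<forall>t. 0 < ereal t \<longrightarrow> ereal t < \<infinity> \<longrightarrow> (G has_vector_derivative g t) (at t)"
    by (rule einterval_antiderivative) (auto intro!: DERIV_isCont[OF assms])
  then show ?thesis by (auto simp: has_real_derivative_iff_has_vector_derivative)
qed

lemma mono_of_deriv:
  fixes g g' :: "real \<Rightarrow> real"
  assumes "s \<le> t" "\<And>x. s \<le> x \<Longrightarrow> x \<le> t \<Longrightarrow> (g has_real_derivative g' x) (at x)" "\<And>x. s \<le> x \<Longrightarrow> x \<le> t \<Longrightarrow> g' x \<ge> 0"
  shows "g s \<le> g t"
  by (rule DERIV_nonneg_imp_nondecreasing[OF assms(1)]) (use assms(2,3) in blast)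

lemma DERIV_ln_shift: "x + a > 0 \<Longrightarrow> ((\<lambda>x. ln (x + a)) has_real_derivative 1 / (x + a)) (at x)" for a :: real
  by (auto intro!: derivative_eq_intros)

lemma DERIV_inverse_real:
  fixes t :: real
  assumes "t > 0"
  shows "(inverse has_real_derivative - (inverse t ^ 2)) (at t)"
  by (rule DERIV_cong[OF DERIV_inverse]) (use assms in \<open>auto simp: power2_eq_square\<close>)

text \<open>The condition \<open>AB_ln\<close> forces the profile to grow by at least one between
  \<open>B n\<close> and \<open>A n\<close>, hence to be unbounded.\<close>

locale staircase =
  fixes A B :: "nat \<Rightarrow> real" and N :: nat
  assumes N: "N \<ge> 10"
    and A_pos: "\<And>n. A n > 0" and A_less: "\<And>n. A n < B n" and B_Suc: "\<And>n. B (Suc n) \<le> A n"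
    and B_0: "B 0 \<le> 1" and AB_ln: "\<And>n. B n * ln (B n / A n) \<ge> 4"
begin

declare One_nat_def [simp del]

lemma B_pos: "B n > 0"
  using A_pos A_less less_trans by blast

lemma B_le_1: "B n \<le> 1"
proof (induction n)
  case (Suc n)
  then show ?case using B_Suc[of n] A_less[of n] by linarith
qed (rule B_0)

section \<open>The sums of stairs and their bounds\<close>

text \<open>The power \<open>j\<close> is a parameter because differentiation multiplies by
  \<open>- j\<close> and raises \<open>j\<close> by one. Thus \<open>S 1\<close> is the function
  \<open>q\<close>, and its derivatives are multiples of the functions \<open>S j\<close>.\<close>

definition stair :: "nat \<Rightarrow> nat \<Rightarrow> real \<Rightarrow> real" where
  "stair j n t = inverse (t + A n) ^ j - inverse (t + B n) ^ j"

definition S :: "nat \<Rightarrow> real \<Rightarrow> real" where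
  "S j t = (\<Sum>n. stair j n t)"

lemma inverse_mono:
  assumes "t > 0"
  shows "inverse (t + B n) \<le> inverse (t + A n)" "inverse (t + A n) \<le> inverse (t + B (Suc n))"
    "0 < inverse (t + B n)" "inverse (t + B n) \<le> inverse t" "t * inverse (t + A n) \<le> 1"
proof -
  have "t + B (Suc n) \<le> t + A n" "t + A n \<le> t + B n" "t \<le> t + B n" "t + B (Suc n) > 0" "t + A n > 0" "t + B n > 0"
    using assms A_pos[of n] A_less[of n] B_Suc[of n] B_pos[of n] B_pos[of "Suc n"] by linarith+
  then show "inverse (t + B n) \<le> inverse (t + A n)" "inverse (t + A n) \<le> inverse (t + B (Suc n))"
    "0 < inverse (t + B n)" "inverse (t + B n) \<le> inverse t"
    using assms by (simp_all add: le_imp_inverse_le)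
  show "t * inverse (t + A n) \<le> 1" using assms A_pos[of n] by (simp add: field_simps)
qed

lemma stair_nonneg: "t > 0 \<Longrightarrow> stair j n t \<ge> 0"
  using power_mono[of "inverse (t + B n)" "inverse (t + A n)" j] inverse_mono(1,3)[of t n]
  by (simp add: stair_def)

text \<open>The sum telescopes, because \<open>B (Suc i) \<le> A i\<close> makes each upper term at
  most the next lower term.\<close>

lemma stair_sum_le:
  assumes "t > 0" "m \<le> n"
  shows "(\<Sum>i=m..<n. stair j i t) \<le> inverse (t + B n) ^ j - inverse (t + B m) ^ j"
  using \<open>m \<le> n\<close>
proof (induction n rule: dec_induct)
  case (step n)
  have "inverse (t + A n) \<ge> 0" using inverse_mono(1,3)[OF assms(1), of n] by linarith
  then have "inverse (t + A n) ^ j \<le> inverse (t + B (Suc n)) ^ j"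
    using inverse_mono(2)[OF assms(1), of n] by (intro power_mono)
  then show ?case using step by (simp add: stair_def)
qed simp

lemma stair_sum_le':
  assumes "t > 0"
  shows "(\<Sum>i<n. stair j i t) \<le> inverse t ^ j - inverse (t + B 0) ^ j"
proof -
  have "inverse (t + B n) ^ j \<le> inverse t ^ j"
    using inverse_mono(3,4)[OF assms, of n] by (intro power_mono) auto
  then show ?thesis using stair_sum_le[OF assms, of 0 n j] by (simp add: atLeast0LessThan)
qed

lemma summable_stair: "t > 0 \<Longrightarrow> summable (\<lambda>n. stair j n t)"
  by (rule summableI_nonneg_bounded[OF stair_nonneg stair_sum_le'])

lemma S_nonneg: "t > 0 \<Longrightarrow> S j t \<ge> 0"
  unfolding S_def by (intro suminf_nonneg summable_stair stair_nonneg)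

lemma stair_le_S: "t > 0 \<Longrightarrow> stair j n t \<le> S j t"
  unfolding S_def using sum_le_suminf[OF summable_stair, of t "{n}" j] stair_nonneg by simp

lemma stair_deriv:
  assumes "t > 0"
  shows "((stair j n) has_real_derivative - real j * stair (Suc j) n t) (at t)"
proof -
  have d: "((\<lambda>t. inverse (t + a) ^ j) has_real_derivative - real j * inverse (t + a) ^ Suc j) (at t)"
    if "a > 0" for a
  proof -
    have "((\<lambda>t. inverse (t + a)) has_real_derivative - (inverse (t + a) * 1 * inverse (t + a))) (at t)"
      using that assms by (intro DERIV_inverse'[where f = "\<lambda>t. t + a"]) (auto intro!: derivative_eq_intros)
    from DERIV_power[OF this, of j]
    have "((\<lambda>t. inverse (t + a) ^ j) has_real_derivative
        real j * (- (inverse (t + a) * 1 * inverse (t + a)) * inverse (t + a) ^ (j - Suc 0))) (at t)" .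
    also have "real j * (- (inverse (t + a) * 1 * inverse (t + a)) * inverse (t + a) ^ (j - Suc 0))
      = - real j * inverse (t + a) ^ Suc j"
      by (cases j) (auto simp: algebra_simps)
    finally show ?thesis .
  qed
  have "((\<lambda>t. inverse (t + A n) ^ j - inverse (t + B n) ^ j) has_real_derivative
      - real j * inverse (t + A n) ^ Suc j - - real j * inverse (t + B n) ^ Suc j) (at t)"
    by (intro DERIV_diff d A_pos B_pos)
  then show ?thesis by (simp add: stair_def[abs_def] algebra_simps)
qed

lemma stair_antimono:
  assumes "0 < s" "s \<le> t"
  shows "stair j n t \<le> stair j n s"
proof (rule DERIV_nonpos_imp_nonincreasing[OF assms(2)])
  fix x assume "s \<le> x"
  then show "\<exists>y. (stair j n has_real_derivative y) (at x) \<and> y \<le> 0"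
    using stair_deriv[of x j n] stair_nonneg[of x "Suc j" n] assms
    by (intro exI[of _ "- real j * stair (Suc j) n x"]) auto
qed

text \<open>Termwise differentiation is justified to the right of \<open>t / 2\<close>, where every
  stair is dominated by its value at \<open>t / 2\<close>.\<close>

lemma S_deriv:
  assumes t: "t > 0"
  shows "(S j has_real_derivative - real j * S (Suc j) t) (at t)"
proof -
  let ?a = "t / 2"
  have a: "?a > 0" using t by simp
  have pos: "x > 0" if "x \<in> {?a..}" for x using that a by simp
  have le: "norm (- real j * stair (Suc j) n x) \<le> real j * stair (Suc j) n ?a" if x: "x \<in> {?a..}" for n x
  proof -
    have "\<bar>- real j\<bar> * \<bar>stair (Suc j) n x\<bar> \<le> real j * stair (Suc j) n ?a"
      using stair_antimono[OF a, of x "Suc j" n] stair_nonneg[OF pos[OF x], of "Suc j" n] x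
      by (intro mult_mono) simp_all
    then show ?thesis by (simp only: real_norm_def abs_mult)
  qed
  have "((\<lambda>t. \<Sum>n. stair j n t) has_real_derivative (\<Sum>n. - real j * stair (Suc j) n t)) (at t)"
  proof (rule has_field_derivative_series'(2)[where S = "{?a..}" and ?x0.0 = t
        and f = "\<lambda>n. stair j n" and f' = "\<lambda>n x. - real j * stair (Suc j) n x"])
    show "(stair j n has_real_derivative - real j * stair (Suc j) n x) (at x within {?a..})"
      if "x \<in> {?a..}" for n x
      by (rule has_field_derivative_at_within[OF stair_deriv[OF pos[OF that]]])
    show "uniformly_convergent_on {?a..} (\<lambda>n x. \<Sum>i<n. - real j * stair (Suc j) i x)"
      by (rule Weierstrass_m_test'[OF le summable_mult[OF summable_stair[OF a]]])
    show "t \<in> interior {?a..}" using t by simp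
    show "t \<in> {?a..}" using t by simp
    show "summable (\<lambda>n. stair j n t)" by (rule summable_stair[OF t])
    show "convex {?a..}" by simp
  qed
  then show ?thesis
    unfolding S_def[abs_def] suminf_mult[OF summable_stair[OF t]] .
qed

lemma S_1_le:
  assumes "t > 0"
  shows "t * S 1 t \<le> 1 - t / (t + B 0)"
proof -
  have "S 1 t \<le> inverse t - inverse (t + B 0)"
    unfolding S_def using stair_sum_le'[OF assms, of 1] by (intro suminf_le_const summable_stair assms) simp
  then have "t * S 1 t \<le> t * (inverse t - inverse (t + B 0))" using assms by (intro mult_left_mono) auto
  then show ?thesis using assms by (simp add: right_diff_distrib divide_inverse)
qed

lemma S_1_le_1: "t > 0 \<Longrightarrow> t * S 1 t \<le> 1"
  using S_1_le[of t] B_pos[of 0] by (smt (verit) divide_nonneg_nonneg)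

text \<open>The stairs up to \<open>n\<close> telescope to at most \<open>inverse (A n)\<close>, the
  later ones to at most \<open>inverse t - inverse (t + B (Suc n))\<close>. A tiny
  \<open>B (Suc n)\<close> therefore makes the second contribution negligible at a prescribed
  \<open>t\<close>.\<close>

lemma S_1_split:
  assumes t: "t > 0"
  shows "S 1 t \<le> inverse (A n) + B (Suc n) / t^2"
  unfolding S_def
proof (rule suminf_le_const[OF summable_stair[OF t]])
  fix k
  let ?m = "Suc n + k"
  have "(\<Sum>i<k. stair 1 i t) \<le> (\<Sum>i<?m. stair 1 i t)"
    by (intro sum_mono2 stair_nonneg t) auto
  also have "\<dots> = (\<Sum>i=0..<n. stair 1 i t) + stair 1 n t + (\<Sum>i=Suc n..<?m. stair 1 i t)"
    using sum.atLeastLessThan_concat[of 0 "Suc n" ?m "\<lambda>i. stair 1 i t"] by (simp add: atLeast0LessThan)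
  also have "\<dots> \<le> (inverse (t + B n) - inverse (t + B 0)) + (inverse (t + A n) - inverse (t + B n))
       + (inverse (t + B ?m) - inverse (t + B (Suc n)))"
    using stair_sum_le[OF t, of 0 n 1] stair_sum_le[OF t, of "Suc n" ?m 1] by (intro add_mono) (auto simp: stair_def)
  also have "\<dots> \<le> inverse (t + A n) + (inverse t - inverse (t + B (Suc n)))"
    using inverse_mono(3)[OF t, of 0] inverse_mono(4)[OF t, of ?m] by linarith
  also have "inverse (t + A n) \<le> inverse (A n)" using t A_pos[of n] by (simp add: field_simps)
  also have "inverse t - inverse (t + B (Suc n)) = B (Suc n) / (t * (t + B (Suc n)))"
    using t B_pos[of "Suc n"] by (simp add: field_simps)
  also have "\<dots> \<le> B (Suc n) / t^2"
    using t B_pos[of "Suc n"] by (intro divide_left_mono) (auto simp: power2_eq_square)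
  finally show "(\<Sum>i<k. stair 1 i t) \<le> inverse (A n) + B (Suc n) / t^2" by simp
qed

text \<open>For each stair, factor the difference of squares and use that \<open>t\<close> times
  either inverse is at most one.\<close>

lemma S_2_le:
  assumes t: "t > 0"
  shows "t * S 2 t \<le> 2 * S 1 t"
proof -
  have "t * stair 2 n t \<le> 2 * stair 1 n t" for n
  proof -
    define x y where "x = inverse (t + A n)" and "y = inverse (t + B n)"
    have xy: "y \<le> x" "0 < y" "t * x \<le> 1" using inverse_mono[OF t, of n] by (auto simp: x_def y_def)
    then have "t * y \<le> 1" using t by (smt (verit) mult_left_mono)
    then have "(t * x + t * y) * (x - y) \<le> 2 * (x - y)" using xy by (intro mult_right_mono) auto
    then show ?thesis by (simp add: stair_def x_def[symmetric] y_def[symmetric] power2_eq_square algebra_simps)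
  qed
  then have "(\<Sum>n. t * stair 2 n t) \<le> (\<Sum>n. 2 * stair 1 n t)"
    by (intro suminf_le summable_mult summable_stair t)
  then show ?thesis unfolding S_def by (simp only: suminf_mult[OF summable_stair[OF t]])
qed

text \<open>For each stair, \<open>x^2 + x * y + y^2\<close> is at most
  \<open>3 / 2 * x * (x + y)\<close>, and \<open>t * x \<le> 1\<close> leaves the factor
  \<open>6 \<le> N\<close>.\<close>

lemma S_3_le:
  assumes t: "t > 0"
  shows "4 * t * S 3 t \<le> real N * S 2 t"
proof -
  have "4 * t * stair 3 n t \<le> real N * stair 2 n t" for n
  proof -
    define x y where "x = inverse (t + A n)" and "y = inverse (t + B n)"
    have xy: "y \<le> x" "0 < y" "t * x \<le> 1" using inverse_mono[OF t, of n] by (auto simp: x_def y_def)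
    have "y * y \<le> x * y" "y * y \<le> x * x" using xy by (auto intro: mult_mono)
    then have sq: "x * x + x * y + y * y \<le> 3 / 2 * (x * (x + y))" by (simp add: algebra_simps)
    have "4 * t * (x * x + x * y + y * y) \<le> 4 * t * (3 / 2 * (x * (x + y)))"
      using t by (intro mult_left_mono sq) auto
    also have "\<dots> = 6 * ((t * x) * (x + y))" by simp
    also have "\<dots> \<le> 6 * (1 * (x + y))" using xy by (intro mult_left_mono mult_right_mono) auto
    also have "\<dots> \<le> real N * (x + y)" using N xy by (simp only: mult_1_left) (intro mult_right_mono, auto)
    finally have "(x - y) * (4 * t * (x * x + x * y + y * y)) \<le> (x - y) * (real N * (x + y))"
      using xy by (intro mult_left_mono) auto
    then show ?thesis
      by (simp add: stair_def x_def[symmetric] y_def[symmetric] power2_eq_square power3_eq_cube algebra_simps)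
  qed
  then have "(\<Sum>n. 4 * t * stair 3 n t) \<le> (\<Sum>n. real N * stair 2 n t)"
    by (intro suminf_le summable_mult summable_stair t)
  then show ?thesis unfolding S_def by (simp only: suminf_mult[OF summable_stair[OF t]])
qed

section \<open>The singular profile\<close>

text \<open>The additive constants of the antiderivatives \<open>Q\<close> and \<open>V\<close>
  cancel in \<open>P\<close> and \<open>W\<close>, which are normalised by \<open>P 1 = 1\<close>
  and \<open>W 1 = 0\<close>.\<close>

definition Q where "Q = (SOME Q. \<forall>t>0. (Q has_real_derivative S 1 t) (at t))"

definition P where "P t = exp (Q 1 - Q t)"

definition V where "V = (SOME V. \<forall>t>0. (V has_real_derivative P t) (at t))"

definition W where "W t = V 1 - V t"

lemma Q_deriv: "t > 0 \<Longrightarrow> (Q has_real_derivative S 1 t) (at t)"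
proof -
  have "\<forall>t>0. (Q has_real_derivative S 1 t) (at t)"
    unfolding Q_def by (rule someI_ex[where P = "\<lambda>Q. \<forall>t>0. (Q has_real_derivative S 1 t) (at t)", OF antiderivative_exists[OF S_deriv]])
  then show "t > 0 \<Longrightarrow> (Q has_real_derivative S 1 t) (at t)" by simp
qed

lemma P_deriv:
  assumes "t > 0"
  shows "(P has_real_derivative - S 1 t * P t) (at t)"
proof -
  have "((\<lambda>t. exp (Q 1 - Q t)) has_real_derivative exp (Q 1 - Q t) * (0 - S 1 t)) (at t)"
    by (intro DERIV_fun_exp DERIV_diff DERIV_const Q_deriv assms)
  then show ?thesis by (simp add: P_def[abs_def] mult.commute)
qed

lemma V_deriv: "t > 0 \<Longrightarrow> (V has_real_derivative P t) (at t)"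
proof -
  have "\<forall>t>0. (V has_real_derivative P t) (at t)"
    unfolding V_def by (rule someI_ex[where P = "\<lambda>V. \<forall>t>0. (V has_real_derivative P t) (at t)", OF antiderivative_exists[OF P_deriv]])
  then show "t > 0 \<Longrightarrow> (V has_real_derivative P t) (at t)" by simp
qed

lemma W_deriv:
  assumes "t > 0"
  shows "(W has_real_derivative - P t) (at t)"
  using DERIV_diff[OF DERIV_const[of "V 1"] V_deriv[OF assms]] by (simp add: W_def[abs_def])

lemma P_pos: "P t > 0"
  by (simp add: P_def)

lemma Q_mono: "0 < s \<Longrightarrow> s \<le> t \<Longrightarrow> Q s \<le> Q t"
  by (rule mono_of_deriv[of s t Q "S 1"]) (simp_all add: Q_deriv S_nonneg)

lemma P_ge_1: "0 < t \<Longrightarrow> t \<le> 1 \<Longrightarrow> P t \<ge> 1"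
  using Q_mono[of t 1] by (simp add: P_def)

text \<open>Integrate \<open>x * S 1 x \<le> 1\<close>. The consequences are power bounds on
  \<open>P\<close> and the logarithmic bound on \<open>W\<close>.\<close>

lemma Q_ln: 
  assumes "0 < s" "s \<le> t"
  shows "Q t - Q s \<le> ln t - ln s"
proof -
  have "ln s - Q s \<le> ln t - Q t"
  proof (rule mono_of_deriv[OF assms(2), where g = "\<lambda>x. ln x - Q x" and g' = "\<lambda>x. 1 / x - S 1 x"])
    fix x assume "s \<le> x"
    then have x: "x > 0" using assms by simp
    then show "((\<lambda>x. ln x - Q x) has_real_derivative 1 / x - S 1 x) (at x)"
      by (intro DERIV_diff DERIV_ln_divide Q_deriv)
    show "1 / x - S 1 x \<ge> 0" using S_1_le_1[OF x] x by (simp add: pos_le_divide_eq mult.commute)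
  qed
  then show ?thesis by simp
qed

lemma P_le_inverse:
  assumes "0 < t" "t \<le> 1"
  shows "P t \<le> 1 / t"
proof -
  have "P t \<le> exp (- ln t)" unfolding P_def using Q_ln[OF assms] by simp
  then show ?thesis using assms by (simp add: exp_minus divide_inverse)
qed

lemma P_ge_inverse:
  assumes "1 \<le> t"
  shows "1 / t \<le> P t"
proof -
  have "exp (- ln t) \<le> P t" unfolding P_def using Q_ln[of 1 t] assms by simp
  then show ?thesis using assms by (simp add: exp_minus divide_inverse)
qed

lemma W_1: "W 1 = 0"
  by (simp add: W_def)

lemma W_le_ln:
  assumes t: "t > 0"
  shows "W t \<le> - ln t"
proof (cases "t \<le> 1")
  case True
  have "W t + ln t \<le> W 1 + ln 1"
  proof (rule mono_of_deriv[OF True, where g = "\<lambda>x. W x + ln x" and g' = "\<lambda>x. - P x + 1 / x"])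
    fix x assume "t \<le> x" "x \<le> 1"
    then have x: "x > 0" using t by simp
    then show "((\<lambda>x. W x + ln x) has_real_derivative - P x + 1 / x) (at x)"
      by (intro DERIV_add DERIV_ln_divide W_deriv)
    show "- P x + 1 / x \<ge> 0" using P_le_inverse[OF x \<open>x \<le> 1\<close>] by simp
  qed
  then show ?thesis by (simp add: W_1)
next
  case False
  have "- W 1 - ln 1 \<le> - W t - ln t"
  proof (rule mono_of_deriv[where g = "\<lambda>x. - W x - ln x" and g' = "\<lambda>x. P x - 1 / x"])
    fix x :: real assume "1 \<le> x"
    then have "((\<lambda>x. - W x - ln x) has_real_derivative - (- P x) - 1 / x) (at x)"
      by (intro DERIV_diff DERIV_minus DERIV_ln_divide W_deriv) auto
    then show "((\<lambda>x. - W x - ln x) has_real_derivative P x - 1 / x) (at x)" by simp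
    show "P x - 1 / x \<ge> 0" using P_ge_inverse[OF \<open>1 \<le> x\<close>] by simp
  qed (use False in simp)
  then show ?thesis by (simp add: W_1)
qed

lemma W_strict: 
  assumes "0 < s" "s < t"
  shows "W t < W s"
proof (rule DERIV_neg_imp_decreasing[OF assms(2)])
  fix x assume "s \<le> x"
  then have "x > 0" using assms by simp
  then show "\<exists>y. (W has_real_derivative y) (at x) \<and> y < 0"
    using W_deriv P_pos[of x] by (intro exI[of _ "- P x"]) auto
qed

lemma W_antimono: "0 < s \<Longrightarrow> s \<le> t \<Longrightarrow> W t \<le> W s"
  using W_strict[of s t] by (cases "s = t") auto

text \<open>Between \<open>B n\<close> and \<open>A n\<close> the slope satisfies
  \<open>P x \<ge> B n / (4 * x)\<close>, so \<open>W\<close> gains at least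
  \<open>B n / 4 * ln (B n / A n)\<close>, which is at least one.\<close>

lemma W_A_ge: "W (A n) \<ge> real n + 1"
proof -
  have step: "W (A n) \<ge> W (B n) + 1" for n
  proof -
    \<comment> \<open>Only stair \<open>n\<close> is kept and integrated from \<open>x\<close> to
      \<open>B n\<close>. The constant four combines \<open>x + A n \<le> 2 * x\<close> with
      \<open>B n + B n = 2 * B n\<close>.\<close>
    have ge: "P x \<ge> B n / 4 / x" if x: "A n \<le> x" "x \<le> B n" for x
    proof -
      have x0: "x > 0" using x A_pos[of n] by linarith
      have "Q x - ln (x + A n) + ln (x + B n) \<le> Q (B n) - ln (B n + A n) + ln (B n + B n)"
      proof (rule mono_of_deriv[OF x(2), where g = "\<lambda>x. Q x - ln (x + A n) + ln (x + B n)"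
            and g' = "\<lambda>x. S 1 x - 1 / (x + A n) + 1 / (x + B n)"])
        fix y assume "x \<le> y"
        then have y: "y > 0" using x0 by simp
        then show "((\<lambda>x. Q x - ln (x + A n) + ln (x + B n)) has_real_derivative
            S 1 y - 1 / (y + A n) + 1 / (y + B n)) (at y)"
          using A_pos[of n] B_pos[of n]
          by (intro DERIV_add DERIV_diff Q_deriv DERIV_ln_shift) auto
        show "S 1 y - 1 / (y + A n) + 1 / (y + B n) \<ge> 0"
          using stair_le_S[OF y, of 1 n] by (simp add: stair_def divide_inverse)
      qed
      moreover have "ln (B n) - ln 4 - ln x \<le> ln (B n + A n) - ln (B n + B n) + ln (x + B n) - ln (x + A n)"
      proof -
        have "ln (B n) \<le> ln (B n + A n)" "ln (B n) \<le> ln (x + B n)" "ln (x + A n) \<le> ln (2 * x)"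
          using x x0 A_pos[of n] B_pos[of n] by simp_all
        moreover have "ln (2 * x) = ln 2 + ln x" "ln (B n + B n) = ln 2 + ln (B n)"
          unfolding mult_2[symmetric] using x0 B_pos[of n] by (simp_all add: ln_mult)
        moreover have "ln 4 = ln 2 + ln (2::real)" using ln_mult[of 2 2] by simp
        ultimately show ?thesis by linarith
      qed
      ultimately have "ln (B n) - ln 4 - ln x \<le> Q (B n) - Q x" by linarith
      also have "\<dots> \<le> Q 1 - Q x" using Q_mono[OF B_pos B_le_1, of n] by simp
      finally have "exp (ln (B n) - ln 4 - ln x) \<le> P x" unfolding P_def by simp
      then show ?thesis using x0 B_pos[of n] by (simp add: exp_diff)
    qed
    have "- W (A n) - B n / 4 * ln (A n) \<le> - W (B n) - B n / 4 * ln (B n)"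
    proof (rule mono_of_deriv[where g = "\<lambda>x. - W x - B n / 4 * ln x" and g' = "\<lambda>x. P x - B n / 4 / x"])
      fix x assume x: "A n \<le> x" "x \<le> B n"
      then have x0: "x > 0" using A_pos[of n] by linarith
      have "((\<lambda>x. - W x - B n / 4 * ln x) has_real_derivative - (- P x) - B n / 4 * (1 / x)) (at x)"
        by (intro DERIV_diff DERIV_minus DERIV_cmult DERIV_ln_divide W_deriv x0)
      then show "((\<lambda>x. - W x - B n / 4 * ln x) has_real_derivative P x - B n / 4 / x) (at x)" by simp
      show "P x - B n / 4 / x \<ge> 0" using ge[OF x] by simp
    qed (use A_less[of n] in simp)
    moreover have "B n / 4 * (ln (B n) - ln (A n)) \<ge> 1"
      using AB_ln[of n] A_pos[of n] B_pos[of n] by (simp add: ln_div)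
    ultimately show ?thesis by (simp add: algebra_simps)
  qed
  show ?thesis
  proof (induction n)
    case 0
    have "W (B 0) \<ge> 0" using W_antimono[OF B_pos B_0] by (simp add: W_1)
    then show ?case using step[of 0] by simp
  next
    case (Suc n)
    have "W (A n) \<le> W (B (Suc n))" by (intro W_antimono B_pos B_Suc)
    then show ?case using step[of "Suc n"] Suc by simp
  qed
qed

end

section \<open>The inverse profile and the nonlinearity\<close>

context staircase
begin

text \<open>The values \<open>W (A n)\<close> are arbitrarily large, and the bound by
  \<open>- ln t\<close> sends \<open>W\<close> to minus infinity. With strict monotonicity
  \<open>W\<close> is a bijection onto the whole line, where its inverse \<open>R\<close> defines
  \<open>f\<close>.\<close>

lemma W_surj: "\<exists>t>0. W t = y"
proof -
  obtain n where n: "y \<le> real n" using real_arch_simple by blast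
  define b where "b = max (exp (- y)) (A n)"
  have b: "b > 0" "A n \<le> b" using A_pos[of n] by (auto simp: b_def)
  have "ln (exp (- y)) \<le> ln b" using b(1) by (subst ln_le_cancel_iff) (auto simp: b_def)
  then have "W b \<le> y" using W_le_ln[OF b(1)] by simp
  moreover have "y \<le> W (A n)" using W_A_ge[of n] n by linarith
  moreover have "isCont W x" if "A n \<le> x" for x
    using DERIV_isCont[OF W_deriv] A_pos[of n] that by simp
  ultimately obtain t where t: "A n \<le> t" "W t = y" using IVT2[of W b y "A n"] b(2) by blast
  then have "t > 0" using A_pos[of n] by linarith
  then show ?thesis using t(2) by blast
qed

definition R where "R y = (SOME t. t > 0 \<and> W t = y)"

lemma R_pos: "R y > 0" and W_R: "W (R y) = y"
proof -
  have "R y > 0 \<and> W (R y) = y" unfolding R_def by (rule someI_ex[OF W_surj])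
  then show "R y > 0" "W (R y) = y" by simp_all
qed

lemma R_W:
  assumes "t > 0"
  shows "R (W t) = t"
  using W_strict[OF assms, of "R (W t)"] W_strict[OF R_pos[of "W t"], of t] W_R[of "W t"]
  by linarith

lemma R_deriv: "(R has_real_derivative - 1 / P (R y)) (at y)"
proof -
  have "isCont R (W (R y))"
  proof (rule isCont_inverse_function2[of "R y / 2" "R y" "2 * R y"])
    fix z assume "R y / 2 \<le> z"
    then have "z > 0" using R_pos[of y] by linarith
    then show "R (W z) = z" "isCont W z" by (rule R_W, rule DERIV_isCont[OF W_deriv])
  qed (use R_pos[of y] in simp_all)
  then have "isCont R y" unfolding W_R .
  then have "(R has_real_derivative inverse (- P (R y))) (at y)"
    using P_pos[of "R y"]
    by (intro DERIV_inverse_function[where f = W and a = "y - 1" and b = "y + 1"] W_deriv R_pos W_R) simp_all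
  then show ?thesis by (simp add: divide_inverse)
qed

text \<open>Since the derivative of \<open>R\<close> is \<open>- 1 / P (R y)\<close>,
  differentiating in \<open>y\<close> acts on functions of \<open>t\<close> as
  \<open>- 1 / P\<close> times the \<open>t\<close>-derivative.\<close>

lemma compose_R_deriv:
  assumes "\<And>t. t > 0 \<Longrightarrow> (g has_real_derivative - P t * g' t) (at t)"
  shows "((\<lambda>y. g (R y)) has_real_derivative g' (R y)) (at y)"
proof -
  have "((\<lambda>y. g (R y)) has_real_derivative (- P (R y) * g' (R y)) * (- 1 / P (R y))) (at y)"
    by (rule DERIV_chain2[OF assms[OF R_pos] R_deriv])
  then show ?thesis using P_pos[of "R y"] by simp
qed

text \<open>\<open>F\<close> is minus the Laplacian of \<open>W\<close>, computed from the
  derivatives \<open>- P\<close> and \<open>S 1 * P\<close>. Below, \<open>- P * G\<close> is the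
  derivative of \<open>F\<close>, and \<open>G'\<close> is the derivative of
  \<open>G\<close>.\<close>

definition F where "F t = P t * (2 * real N - 4 * t * S 1 t)"

definition G where "G t = (2 * real N + 4) * S 1 t - 4 * t * (S 1 t)^2 - 4 * t * S 2 t"

definition G' where
  "G' t = - (2 * real N + 8) * S 2 t - 4 * (S 1 t)^2 + 8 * t * S 1 t * S 2 t + 8 * t * S 3 t"

definition f where "f y = F (R y)"
definition f1 where "f1 y = G (R y)"
definition f2 where "f2 y = - G' (R y) / P (R y)"

lemma S_1_deriv:
  assumes "t > 0"
  shows "(S 1 has_real_derivative - S 2 t) (at t)"
  by (rule DERIV_cong[OF S_deriv[OF assms]]) simp

lemma S_2_deriv:
  assumes "t > 0"
  shows "(S 2 has_real_derivative - 2 * S 3 t) (at t)"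
proof -
  have "Suc 2 = (3::nat)" by simp
  from S_deriv[OF assms, of 2, unfolded this] show ?thesis by simp
qed

lemma F_deriv:
  assumes "t > 0"
  shows "(F has_real_derivative - P t * G t) (at t)"
proof -
  have "(F has_real_derivative - S 1 t * P t * (2 * real N - 4 * t * S 1 t) + (0 - (4 * 1 * S 1 t + - S 2 t * (4 * t))) * P t) (at t)"
    unfolding F_def[abs_def]
    by (intro DERIV_mult DERIV_diff DERIV_const DERIV_cmult DERIV_ident P_deriv S_1_deriv assms)
  then show ?thesis by (rule DERIV_cong) (simp add: G_def algebra_simps power2_eq_square)
qed

lemma G_deriv:
  assumes "t > 0"
  shows "(G has_real_derivative G' t) (at t)"
  unfolding G_def[abs_def]
  by (rule DERIV_cong, (rule DERIV_diff DERIV_cmult DERIV_mult DERIV_ident DERIV_power S_1_deriv S_2_deriv assms)+)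
     (simp add: G'_def algebra_simps power2_eq_square)

text \<open>This sign is the convexity of \<open>f\<close>. The positive terms are at most
  \<open>8 * S 2 t\<close> and \<open>2 * N * S 2 t\<close>, by \<open>S_1_le_1\<close> and
  \<open>S_3_le\<close>, and are cancelled exactly by the leading negative term.\<close>

lemma G'_nonpos:
  assumes t: "t > 0"
  shows "G' t \<le> 0"
proof -
  have "t * S 1 t * S 2 t \<le> 1 * S 2 t" using S_1_le_1[OF t] S_nonneg[OF t] by (intro mult_right_mono) auto
  moreover have "(S 1 t)^2 \<ge> 0" by simp
  moreover have "8 * t * S 3 t \<le> 2 * (real N * S 2 t)" using S_3_le[OF t] by simp
  moreover have "G' t = 8 * (t * S 1 t * S 2 t) + 8 * t * S 3 t - 2 * (real N * S 2 t) - 8 * S 2 t - 4 * (S 1 t)^2"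
    by (simp add: G'_def algebra_simps)
  ultimately show ?thesis by linarith
qed

text \<open>The leading term is at least \<open>24 * S 1 t\<close>, and the two subtracted terms
  take away at most \<open>4 * S 1 t\<close> and \<open>8 * S 1 t\<close>. Monotonicity and
  superlinear growth of \<open>f\<close> both rest on this bound.\<close>

lemma G_ge:
  assumes t: "t > 0"
  shows "12 * S 1 t \<le> G t"
proof -
  have "t * S 1 t * S 1 t \<le> 1 * S 1 t" using S_1_le_1[OF t] S_nonneg[OF t] by (intro mult_right_mono) auto
  moreover have "4 * t * S 2 t \<le> 8 * S 1 t" using S_2_le[OF t] by simp
  moreover have "2 * real N * S 1 t \<ge> 20 * S 1 t" using N S_nonneg[OF t, of 1] by (intro mult_right_mono) auto
  ultimately show ?thesis by (simp add: G_def algebra_simps power2_eq_square)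
qed

lemma G_le:
  assumes t: "t > 0"
  shows "G t \<le> (2 * real N + 4) * S 1 t"
proof -
  have "4 * t * (S 1 t)^2 \<ge> 0" "4 * t * S 2 t \<ge> 0" using t S_nonneg[OF t, of 2] by auto
  then show ?thesis unfolding G_def by linarith
qed

lemma F_pos:
  assumes t: "t > 0"
  shows "F t > 0"
proof -
  have "2 * real N - 4 * t * S 1 t > 0" using S_1_le_1[OF t] N by simp
  then show ?thesis using P_pos[of t] by (simp add: F_def)
qed

lemma f_deriv: "(f has_real_derivative f1 y) (at y)"
  unfolding f_def[abs_def] f1_def by (rule compose_R_deriv[OF F_deriv])

lemma f1_deriv: "(f1 has_real_derivative f2 y) (at y)"
proof -
  have "((\<lambda>y. G (R y)) has_real_derivative (\<lambda>t. - G' t / P t) (R y)) (at y)"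
  proof (rule compose_R_deriv)
    fix t :: real assume "t > 0"
    then show "(G has_real_derivative - P t * (- G' t / P t)) (at t)"
      using G_deriv P_pos[of t] by simp
  qed
  then show ?thesis by (simp add: f1_def[abs_def] f2_def)
qed

lemma f2_nonneg: "f2 y \<ge> 0"
  using G'_nonpos[OF R_pos, of y] P_pos[of "R y"] by (simp add: f2_def divide_nonpos_pos)

lemma f1_nonneg: "f1 y \<ge> 0"
  using G_ge[OF R_pos, of y] S_nonneg[OF R_pos, of 1 y] by (simp add: f1_def)

lemma convex_f: "convex_on UNIV f"
  by (rule f''_ge0_imp_convex[where f' = f1 and f'' = f2]) (auto intro: f_deriv f1_deriv f2_nonneg)

lemma f_tangent: "f s + f1 s * (t - s) \<le> f t"
  using convex_on_imp_above_tangent[OF convex_f, of s t "f1 s"] f_deriv[of s] by simp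

section \<open>Smoothness of the nonlinearity\<close>

text \<open>A class that contains \<open>F\<close> and is closed under differentiation and under
  division by \<open>P\<close>, so that the operator in \<open>compose_R_deriv\<close> can be
  iterated.\<close>

inductive stair_algebra :: "(real \<Rightarrow> real) \<Rightarrow> bool" where
  const: "stair_algebra (\<lambda>_. c)"
| ident: "stair_algebra (\<lambda>t. t)"
| S: "stair_algebra (S j)"
| P: "stair_algebra P"
| inverse_P: "stair_algebra (\<lambda>t. inverse (P t))"
| add: "stair_algebra g \<Longrightarrow> stair_algebra h \<Longrightarrow> stair_algebra (\<lambda>t. g t + h t)"
| mult: "stair_algebra g \<Longrightarrow> stair_algebra h \<Longrightarrow> stair_algebra (\<lambda>t. g t * h t)"

lemma stair_algebra_deriv:
  "stair_algebra g \<Longrightarrow> \<exists>g'. stair_algebra g' \<and> (\<forall>t>0. (g has_real_derivative g' t) (at t))"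
proof (induction rule: stair_algebra.induct)
  case (const c)
  show ?case by (rule exI[of _ "\<lambda>_. 0"]) (auto intro: stair_algebra.const)
next
  case ident
  show ?case by (rule exI[of _ "\<lambda>_. 1"]) (auto intro: stair_algebra.const)
next
  case (S j)
  have "stair_algebra (\<lambda>t. (- real j) * S (Suc j) t)"
    by (intro stair_algebra.mult stair_algebra.const stair_algebra.S)
  then show ?case using S_deriv by blast
next
  case P
  have "stair_algebra (\<lambda>t. (- 1 * S 1 t) * P t)"
    by (intro stair_algebra.mult stair_algebra.const stair_algebra.S stair_algebra.P)
  then show ?case
    by (intro exI[of _ "\<lambda>t. (- 1 * S 1 t) * P t"] conjI allI impI DERIV_cong[OF P_deriv]) simp_all
next
  case inverse_P
  have "((\<lambda>t. inverse (P t)) has_real_derivative S 1 t * inverse (P t)) (at t)" if "t > 0" for t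
    using P_pos[of t] by (intro DERIV_cong[OF DERIV_inverse'[OF P_deriv[OF that]]]) (simp_all add: field_simps)
  moreover have "stair_algebra (\<lambda>t. S 1 t * inverse (P t))"
    by (intro stair_algebra.mult stair_algebra.S stair_algebra.inverse_P)
  ultimately show ?case by blast
next
  case (add g h)
  then obtain g' h' where *: "stair_algebra g'" "stair_algebra h'"
    "\<forall>t>0. (g has_real_derivative g' t) (at t)" "\<forall>t>0. (h has_real_derivative h' t) (at t)" by blast
  then show ?case
    by (intro exI[of _ "\<lambda>t. g' t + h' t"] conjI stair_algebra.add allI impI DERIV_add) auto
next
  case (mult g h)
  then obtain g' h' where *: "stair_algebra g'" "stair_algebra h'"
    "\<forall>t>0. (g has_real_derivative g' t) (at t)" "\<forall>t>0. (h has_real_derivative h' t) (at t)" by blast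
  then show ?case
    by (intro exI[of _ "\<lambda>t. g' t * h t + h' t * g t"] conjI stair_algebra.add stair_algebra.mult mult.hyps
        allI impI DERIV_mult) auto
qed

lemma smooth_f: "smooth_on_halfline f"
proof -
  have F: "stair_algebra F"
  proof -
    have "stair_algebra (\<lambda>t. P t * (2 * real N + (- 4 * t) * S 1 t))"
      by (intro stair_algebra.mult stair_algebra.add stair_algebra.const stair_algebra.ident
          stair_algebra.S stair_algebra.P)
    moreover have "(\<lambda>t. P t * (2 * real N + (- 4 * t) * S 1 t)) = F" by (simp add: F_def fun_eq_iff)
    ultimately show ?thesis by simp
  qed
  have step: "\<exists>y. (stair_algebra y \<and> (Suc n = 0 \<longrightarrow> y = F)) \<and> (\<forall>t>0. (x has_real_derivative - P t * y t) (at t))"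
    if x: "stair_algebra x \<and> (n = 0 \<longrightarrow> x = F)" for x n
  proof -
    obtain x' where x': "stair_algebra x'" "\<And>t. t > 0 \<Longrightarrow> (x has_real_derivative x' t) (at t)"
      using stair_algebra_deriv[OF conjunct1[OF x]] by blast
    have "stair_algebra (\<lambda>t. (- 1 * x' t) * inverse (P t))"
      by (intro stair_algebra.mult stair_algebra.const stair_algebra.inverse_P x')
    moreover have "- P t * ((- 1 * x' t) * inverse (P t)) = x' t" for t
      using P_pos[of t] by (simp add: field_simps)
    then have "\<forall>t>0. (x has_real_derivative - P t * ((- 1 * x' t) * inverse (P t))) (at t)"
      using x'(2) by (simp only:) blast
    ultimately show ?thesis by blast
  qed
  \<comment> \<open>Successive derivatives of \<open>f\<close>, expressed as functions of
    \<open>t\<close>, come from dependent choice; the clause for \<open>n = 0\<close> pins the start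
    to \<open>F\<close>.\<close>
  obtain g where g: "\<And>n. stair_algebra (g n) \<and> (n = 0 \<longrightarrow> g n = F)"
    "\<And>n. \<forall>t>0. (g n has_real_derivative - P t * g (Suc n) t) (at t)"
    using dependent_nat_choice[where P = "\<lambda>n x. stair_algebra x \<and> (n = 0 \<longrightarrow> x = F)"
        and Q = "\<lambda>n x y. \<forall>t>0. (x has_real_derivative - P t * y t) (at t)", OF _ step] F by blast
  have "((\<lambda>y. g n (R y)) has_real_derivative g (Suc n) (R y)) (at y)" for n y
    by (rule compose_R_deriv) (use g(2) in blast)
  then show ?thesis
    unfolding smooth_on_halfline_def using g(1)[of 0]
    by (intro exI[of _ "\<lambda>n y. g n (R y)"]) (auto simp: f_def intro: has_field_derivative_at_within)
qed

section \<open>Superlinear growth\<close>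

text \<open>Chain \<open>n + 1 \<le> W (A n) \<le> - ln (A n) \<le> 1 / A n - 1\<close>.\<close>

lemma A_le: "A n \<le> 1 / (real n + 2)"
proof -
  have "real n + 1 \<le> - ln (A n)" using W_A_ge[of n] W_le_ln[OF A_pos, of n] by linarith
  also have "\<dots> = ln (1 / A n)" using A_pos[of n] by (simp add: ln_div)
  also have "\<dots> \<le> 1 / A n - 1" using A_pos[of n] by (intro ln_le_minus_one) simp
  finally have "real n + 2 \<le> 1 / A n" by simp
  then show ?thesis using A_pos[of n] by (simp add: field_simps)
qed

text \<open>At \<open>t = A n\<close> stair \<open>n\<close> alone is at least
  \<open>3 / (10 * A n)\<close>, because \<open>4 * A n \<le> B n\<close>. Then \<open>G_ge\<close>
  and \<open>A_le\<close> give the bound.\<close>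

lemma f1_large: "f1 (W (A n)) \<ge> real n"
proof -
  have "4 * A n \<le> B n"
  proof -
    have "4 \<le> B n * ln (B n / A n)" by (rule AB_ln)
    also have "\<dots> \<le> 1 * (B n / A n - 1)"
      using A_pos[of n] B_pos[of n] A_less[of n] B_le_1[of n] by (intro mult_mono ln_le_minus_one) auto
    finally have "5 \<le> B n / A n" by simp
    then show ?thesis using A_pos[of n] by (simp add: field_simps)
  qed
  then have "inverse (A n + B n) \<le> inverse (5 * A n)" using A_pos[of n] by (intro le_imp_inverse_le) auto
  then have "inverse (A n) / 2 - inverse (A n) / 5 \<le> stair 1 n (A n)"
    by (simp add: stair_def)
  also have "\<dots> \<le> S 1 (A n)" by (rule stair_le_S[OF A_pos])
  finally have "3 * inverse (A n) \<le> 10 * S 1 (A n)" by simp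
  moreover have "S 1 (A n) \<ge> 0" by (rule S_nonneg[OF A_pos])
  moreover have "inverse (A n) \<ge> 0" using A_pos[of n] by simp
  ultimately have "inverse (A n) \<le> 12 * S 1 (A n)" by linarith
  also have "\<dots> \<le> f1 (W (A n))" using G_ge[OF A_pos] by (simp add: f1_def R_W A_pos)
  finally have "inverse (A n) \<le> f1 (W (A n))" .
  moreover have "real n + 2 \<le> inverse (A n)" using A_le[of n] A_pos[of n] by (simp add: field_simps)
  ultimately show ?thesis by linarith
qed

text \<open>The tangent at \<open>s = W (A n)\<close> has slope at least \<open>n\<close>, so
  \<open>f t \<ge> n * t / 2\<close> once \<open>t \<ge> 2 * s\<close>.\<close>

lemma f_superlinear: "filterlim (\<lambda>t. f t / t) at_top at_top"
  unfolding filterlim_at_top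
proof
  fix Z :: real
  obtain n where n: "2 * Z \<le> real n" using real_arch_simple by blast
  define s where "s = W (A n)"
  have s: "s > 0" using W_A_ge[of n] by (simp add: s_def)
  show "\<forall>\<^sub>F t in at_top. Z \<le> f t / t"
    using eventually_ge_at_top[of "2 * s"]
  proof eventually_elim
    case (elim t)
    then have t: "t > 0" using s by simp
    have "Z * t \<le> real n * (t / 2)" using n t mult_right_mono[of "2 * Z" "real n" "t / 2"] by simp
    also have "\<dots> \<le> f1 s * (t - s)"
      using f1_large[of n, folded s_def] elim s t f1_nonneg[of s] by (intro mult_mono) auto
    also have "\<dots> \<le> f t" using f_tangent[of s t] F_pos[OF R_pos, of s] by (simp add: f_def)
    finally show ?case using t by (simp add: field_simps)
  qed
qed

section \<open>The strict supersolution of the linearised equation\<close>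

definition \<psi> where "\<psi> t = P t * inverse t"
definition \<psi>1 where "\<psi>1 t = - P t * (S 1 t * inverse t + inverse t ^ 2)"
definition \<psi>2 where
  "\<psi>2 t = P t * (((S 1 t)^2 + S 2 t) * inverse t + 2 * S 1 t * inverse t ^ 2 + 2 * inverse t ^ 3)"

lemma \<psi>_deriv:
  assumes "t > 0"
  shows "(\<psi> has_real_derivative \<psi>1 t) (at t)"
proof -
  have "(\<psi> has_real_derivative - S 1 t * P t * inverse t + - (inverse t ^ 2) * P t) (at t)"
    unfolding \<psi>_def[abs_def] by (intro DERIV_mult P_deriv DERIV_inverse_real assms)
  then show ?thesis by (rule DERIV_cong) (simp add: \<psi>1_def algebra_simps)
qed

lemma \<psi>1_deriv:
  assumes "t > 0"
  shows "(\<psi>1 has_real_derivative \<psi>2 t) (at t)"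
proof -
  have "((\<lambda>t. S 1 t * inverse t + inverse t ^ 2) has_real_derivative
      (- S 2 t * inverse t + - (inverse t ^ 2) * S 1 t)
        + real 2 * (- (inverse t ^ 2) * inverse t ^ (2 - Suc 0))) (at t)"
    by (intro DERIV_mult DERIV_add DERIV_power S_1_deriv DERIV_inverse_real assms)
  from DERIV_mult[OF DERIV_minus[OF P_deriv[OF assms]] this]
  show ?thesis
    unfolding \<psi>1_def[abs_def] by (rule DERIV_cong) (simp add: \<psi>2_def algebra_simps power2_eq_square power3_eq_cube)
qed

text \<open>All terms quadratic in \<open>S 1\<close> and all terms in \<open>S 2\<close> cancel,
  leaving \<open>- P t * (2 * N - 8 - 12 * t * S 1 t) / t^2\<close>. For \<open>N \<ge> 10\<close>
  the bracket is nonnegative already by \<open>t * S 1 t \<le> 1\<close>, and the sharper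
  \<open>S_1_le\<close> makes it at least \<open>6 * t^2\<close>. As
  \<open>f (W t) \<le> 2 * N * P t\<close>, the constant is \<open>3 / N\<close>.\<close>

lemma \<psi>_super:
  assumes t: "0 < t" "t \<le> 1"
  shows "4 * t * \<psi>2 t + 2 * real N * \<psi>1 t + f1 (W t) * \<psi> t \<le> - (3 / real N * f (W t))"
proof -
  let ?a = "2 * real N - 8 - 12 * (t * S 1 t)"
  have i: "t * (inverse t * x) = x" for x using t by simp
  have "4 * t * \<psi>2 t + 2 * real N * \<psi>1 t + f1 (W t) * \<psi> t = - P t * (?a * inverse t ^ 2)"
    unfolding f1_def R_W[OF t(1)] G_def \<psi>_def \<psi>1_def \<psi>2_def
    using t by (simp add: field_simps power2_eq_square power3_eq_cube)
  also have "\<dots> \<le> - P t * 6"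
  proof -
    have "12 * (t / (t + B 0)) \<le> ?a" using S_1_le[OF t(1)] N by simp
    moreover have "6 * t^2 \<le> 12 * (t / (t + B 0))"
    proof -
      have "t * (t + B 0) \<le> 1 * 2" using t B_0 B_pos[of 0] by (intro mult_mono) auto
      then have "t * (6 * (t * (t + B 0))) \<le> t * 12" using t by (intro mult_left_mono) auto
      then show ?thesis using t B_pos[of 0] by (simp add: field_simps power2_eq_square)
    qed
    ultimately have "6 * t^2 \<le> ?a" by linarith
    then have "6 * t^2 * inverse t ^ 2 \<le> ?a * inverse t ^ 2" by (intro mult_right_mono) auto
    moreover have "6 * t^2 * inverse t ^ 2 = 6" using t by (simp add: power_mult_distrib[symmetric])
    ultimately have "P t * 6 \<le> P t * (?a * inverse t ^ 2)"
      using P_pos[of t] by (intro mult_left_mono) auto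
    then show ?thesis by simp
  qed
  also have "\<dots> \<le> - (3 / real N * f (W t))"
  proof -
    have "3 / real N * (2 * real N - 4 * t * S 1 t) \<le> 3 / real N * (2 * real N)"
      using t S_nonneg[OF t(1), of 1] by (intro mult_left_mono) auto
    also have "\<dots> = 6" using N by simp
    finally have "P t * (3 / real N * (2 * real N - 4 * t * S 1 t)) \<le> P t * 6"
      using P_pos[of t] by (intro mult_left_mono) auto
    then show ?thesis by (simp add: f_def R_W t F_def mult_ac)
  qed
  finally show ?thesis .
qed

text \<open>From \<open>W t \<le> - ln t \<le> 2 / sqrt t\<close> and \<open>P t \<ge> 1\<close> the
  quotient is at most \<open>2 * sqrt t\<close>.\<close>

lemma W_over_\<psi>: "((\<lambda>t. W t / \<psi> t) \<longlongrightarrow> 0) (at_right 0)"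
proof (rule tendsto_sandwich)
  have ev: "\<forall>\<^sub>F t in at_right 0. 0 < t \<and> t < (1::real)"
    by (intro eventually_at_rightI[of 0 1]) auto
  show "\<forall>\<^sub>F t in at_right 0. 0 \<le> W t / \<psi> t"
    using ev
  proof eventually_elim
    case (elim t)
    then show ?case using W_antimono[of t 1] P_pos[of t] by (simp add: W_1 \<psi>_def)
  qed
  show "\<forall>\<^sub>F t in at_right 0. W t / \<psi> t \<le> 2 * sqrt t"
    using ev
  proof eventually_elim
    case (elim t)
    have W0: "W t \<ge> 0" using W_antimono[of t 1] elim by (simp add: W_1)
    have "- ln t = 2 * ln (1 / sqrt t)" using elim by (simp add: ln_div ln_sqrt)
    also have "\<dots> \<le> 2 * (1 / sqrt t - 1)" using elim by (intro mult_left_mono ln_le_minus_one) auto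
    finally have "W t \<le> 2 * (1 / sqrt t)" using W_le_ln[of t] elim by simp
    then have "t * W t \<le> t * (2 * (1 / sqrt t))" using elim by (intro mult_left_mono) auto
    also have "\<dots> = 2 * (t / sqrt t)" by simp
    also have "\<dots> = 2 * sqrt t" using elim by (simp only: real_div_sqrt[OF less_imp_le])
    finally have *: "t * W t \<le> 2 * sqrt t" .
    have "W t / \<psi> t = t * W t / P t" using elim by (simp add: \<psi>_def field_simps)
    also have "\<dots> \<le> t * W t / 1" using elim W0 P_ge_1[of t] by (intro divide_left_mono) auto
    finally show ?case using * by simp
  qed
  have "((\<lambda>t. 2 * sqrt t) \<longlongrightarrow> 2 * sqrt 0) (at_right 0)" by (intro tendsto_intros)
  then show "((\<lambda>t. 2 * sqrt t) \<longlongrightarrow> 0) (at_right (0::real))" by simp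
qed simp

lemma P_cont: "continuous_on {0<..} P"
  using DERIV_isCont[OF P_deriv] by (intro continuous_at_imp_continuous_on) auto

lemma S_cont: "continuous_on {0<..} (S j)"
  using DERIV_isCont[OF S_deriv] by (intro continuous_at_imp_continuous_on) auto

lemma R_cont: "continuous_on UNIV R"
  using DERIV_isCont[OF R_deriv] by (intro continuous_at_imp_continuous_on) auto

lemma f2_cont: "continuous_on UNIV f2"
proof -
  have "P t \<noteq> 0" for t using P_pos[of t] by simp
  then have "continuous_on {0<..} (\<lambda>t. - G' t / P t)"
    unfolding G'_def by (intro continuous_intros P_cont S_cont) auto
  then show ?thesis
    unfolding f2_def[abs_def]
    by (rule continuous_on_compose2[OF _ R_cont]) (auto simp: R_pos)
qed

lemma singular_solution_W:
  "singular_solution f f1 f2 N W (\<lambda>t. - P t) (\<lambda>t. S 1 t * P t) \<psi> \<psi>1 \<psi>2 (3 / real N)"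
proof unfold_locales
  show "N \<ge> 1" "0 < 3 / real N" using N by auto
  show "f y > 0" for y by (simp add: f_def F_pos R_pos)
  show "continuous_on {0<..} (\<lambda>t. S 1 t * P t)" by (intro continuous_intros P_cont S_cont)
  show "- P t \<le> 0" for t using P_pos[of t] by simp
  show "\<exists>t>0. t \<le> 1 \<and> C < W t" for C
  proof -
    obtain n where "C \<le> real n" using real_arch_simple by blast
    then have "C < W (A n)" using W_A_ge[of n] by simp
    moreover have "A n \<le> 1" using A_less[of n] B_le_1[of n] by simp
    ultimately show ?thesis using A_pos[of n] by blast
  qed
  show "((\<lambda>t. - P t) has_real_derivative S 1 t * P t) (at t)" if "t > 0" for t
    using DERIV_minus[OF P_deriv[OF that]] by simp
  show "0 \<le> S 1 t * P t" if "t > 0" for t using S_nonneg[OF that, of 1] P_pos[of t] by simp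
  show "0 < \<psi> t" if "t > 0" for t using that P_pos[of t] by (simp add: \<psi>_def)
  show "4 * t * (S 1 t * P t) + 2 * real N * - P t = - f (W t)" if "t > 0" for t
    using that by (simp add: f_def R_W F_def algebra_simps)
qed (use f_deriv f1_deriv f2_cont f1_nonneg f_tangent W_deriv W_1 \<psi>_deriv \<psi>1_deriv \<psi>_super W_over_\<psi> in auto)

end

section \<open>Choice of the scales and the limit inferior\<close>

theorem theorem1p2:
  fixes \<phi> :: "real \<Rightarrow> real"
  assumes "CARD('n::finite) \<ge> 10"
    and "\<And>r. 0 < r \<Longrightarrow> r < 1 \<Longrightarrow> \<phi> r > 0"
    and "filterlim \<phi> at_top (at_right 0)"
  shows "\<exists>f :: real \<Rightarrow> real.
      smooth_on_halfline f \<and> mono_on {0..} f \<and> convex_on {0..} f \<and> f 0 > 0 \<and>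
      filterlim (\<lambda>t. f t / t) at_top at_top \<and>
      (\<exists>(ustar :: real ^ 'n \<Rightarrow> ereal) (U :: real \<Rightarrow> real).
         extremal_solution (ball 0 1) f ustar \<and>
         (\<forall>x. 0 < norm x \<and> norm x < 1 \<longrightarrow> ustar x = ereal (U (norm x))) \<and>
         \<not> bounded (U ` {0<..<1}) \<and>
         Liminf (at_right 0) (\<lambda>r. ereal (deriv f (U r) / \<phi> r)) = 0)"
proof -
  let ?N = "CARD('n)"
  \<comment> \<open>This choice of the lower end of a stair gives
    \<open>b * ln (b / a b) = 4\<close>, which is \<open>AB_ln\<close> with equality.\<close>
  define a :: "real \<Rightarrow> real" where "a b = b * exp (- 4 / b)" for b
  have a_pos: "a b > 0" if "b > 0" for b using that by (simp add: a_def)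
  \<comment> \<open>The next scale is chosen together with a small radius \<open>r\<close> where
    \<open>\<phi>\<close> exceeds \<open>n + 1\<close> times \<open>inverse (a b) + 1\<close>.
    Requiring \<open>b' \<le> r ^ 4\<close> makes the contribution of all later stairs at
    \<open>t = r^2\<close> at most one.\<close>
  have "\<exists>b'. (0 < b' \<and> b' \<le> (1::real)) \<and>
      (\<exists>r. 0 < r \<and> r \<le> 1 / (real n + 2) \<and> (real n + 1) * (inverse (a b) + 1) \<le> \<phi> r \<and> b' \<le> a b \<and> b' \<le> r ^ 4)"
    if b: "0 < b \<and> b \<le> 1" for b n
  proof -
    have "\<forall>\<^sub>F r in at_right 0. (real n + 1) * (inverse (a b) + 1) \<le> \<phi> r"
      using assms(3) unfolding filterlim_at_top by blast
    then obtain d where d: "d > 0" "\<And>r. 0 < r \<Longrightarrow> r < d \<Longrightarrow> (real n + 1) * (inverse (a b) + 1) \<le> \<phi> r"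
      by (auto simp: eventually_at_right_field)
    define r where "r = min (d / 2) (1 / (real n + 2))"
    have r: "0 < r" "r < d" "r \<le> 1 / (real n + 2)" using d(1) by (auto simp: r_def)
    define b' where "b' = min 1 (min (a b) (r ^ 4))"
    have "0 < b'" "b' \<le> 1" "b' \<le> a b" "b' \<le> r ^ 4" using a_pos b r by (auto simp: b'_def)
    then show ?thesis using r d(2)[OF r(1,2)] by blast
  qed
  from dependent_nat_choice[where P = "\<lambda>_ b. 0 < b \<and> b \<le> (1::real)" and Q = "\<lambda>n b b'.
      \<exists>r. 0 < r \<and> r \<le> 1 / (real n + 2) \<and> (real n + 1) * (inverse (a b) + 1) \<le> \<phi> r \<and> b' \<le> a b \<and> b' \<le> r ^ 4", OF _ this]
  obtain B where B: "\<And>n. 0 < B n \<and> B n \<le> (1::real)"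
    and B': "\<And>n. \<exists>r. 0 < r \<and> r \<le> 1 / (real n + 2) \<and> (real n + 1) * (inverse (a (B n)) + 1) \<le> \<phi> r
        \<and> B (Suc n) \<le> a (B n) \<and> B (Suc n) \<le> r ^ 4"
    using zero_less_one by blast
  define A where "A n = a (B n)" for n
  interpret s: staircase A B ?N
  proof
    fix n
    have b: "B n > 0" using B by blast
    show "A n > 0" using a_pos[OF b] by (simp add: A_def)
    show "A n < B n" using b by (simp add: A_def a_def)
    show "B (Suc n) \<le> A n" using B' unfolding A_def by blast
    have "B n / A n = exp (4 / B n)" using b by (simp add: A_def a_def exp_minus field_simps)
    then show "4 \<le> B n * ln (B n / A n)" using b by simp
  qed (use assms(1) B in auto)
  interpret u: singular_solution s.f s.f1 s.f2 ?N s.W "\<lambda>t. - s.P t" "\<lambda>t. s.S 1 t * s.P t"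
    s.\<psi> s.\<psi>1 s.\<psi>2 "3 / real ?N"
    by (rule s.singular_solution_W)
  let ?ustar = "\<lambda>x::real^'n. if x = 0 then \<infinity> else ereal (s.W (x \<bullet> x))" and ?U = "\<lambda>r. s.W (r^2)"
  have ext: "extremal_solution (ball 0 1) s.f ?ustar"
    by (rule u.extremal_solution_singular) simp
  have unbounded: "\<not> bounded (?U ` {0<..<1})"
  proof
    assume "bounded (?U ` {0<..<1})"
    then obtain C where "\<forall>r\<in>{0<..<1}. \<bar>?U r\<bar> \<le> C" unfolding bounded_iff by auto
    then have C: "\<bar>?U r\<bar> \<le> C" if "0 < r" "r < 1" for r using that by simp
    obtain n where n: "C \<le> real n" using real_arch_simple by blast
    have "A n > 0" "A n < 1" using s.A_pos[of n] s.A_less[of n] s.B_le_1[of n] by linarith+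
    then show False using C[of "sqrt (A n)"] s.W_A_ge[of n] n by simp
  qed
  have deriv_f: "deriv s.f (?U r) = s.G (r^2)" if "r > 0" for r
    using DERIV_imp_deriv[OF s.f_deriv[of "?U r"]] that by (simp add: s.f1_def s.R_W)
  have "Liminf (at_right 0) (\<lambda>r. ereal (deriv s.f (?U r) / \<phi> r)) = 0"
  proof (rule antisym)
    have "\<forall>\<^sub>F r in at_right 0. 0 \<le> ereal (deriv s.f (?U r) / \<phi> r)"
    proof (rule eventually_at_rightI[of 0 1])
      fix r :: real assume r: "r \<in> {0<..<1}"
      then have "s.G (r^2) \<ge> 0" using s.G_ge[of "r^2"] s.S_nonneg[of "r^2" 1] by simp
      then show "0 \<le> ereal (deriv s.f (?U r) / \<phi> r)" using r assms(2)[of r] by (simp add: deriv_f)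
    qed simp
    then show "0 \<le> Liminf (at_right 0) (\<lambda>r. ereal (deriv s.f (?U r) / \<phi> r))" by (rule Liminf_bounded)
  next
    show "Liminf (at_right 0) (\<lambda>r. ereal (deriv s.f (?U r) / \<phi> r)) \<le> 0"
    proof (rule ccontr)
      assume "\<not> ?thesis"
      then obtain c where c: "0 < ereal c" "ereal c < Liminf (at_right 0) (\<lambda>r. ereal (deriv s.f (?U r) / \<phi> r))"
        using ereal_dense2[of 0] by (auto simp: not_le)
      from less_LiminfD[OF c(2)] have "\<forall>\<^sub>F r in at_right 0. c < deriv s.f (?U r) / \<phi> r" by simp
      then obtain d where d: "d > 0" "\<And>r. 0 < r \<Longrightarrow> r < d \<Longrightarrow> c < deriv s.f (?U r) / \<phi> r"
        by (auto simp: eventually_at_right_field)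
      \<comment> \<open>\<open>n > 1 / d\<close> puts the associated radius below \<open>d\<close>,
        and \<open>n > (2 * N + 4) / c\<close> lets the factor \<open>n + 1\<close> in the lower
        bound for \<open>\<phi> r\<close> absorb the constant in \<open>G_le\<close>.\<close>
      obtain n where n: "max (1 / d) ((2 * real ?N + 4) / c) < real n" using reals_Archimedean2 by blast
      obtain r where r: "0 < r" "r \<le> 1 / (real n + 2)" "(real n + 1) * (inverse (A n) + 1) \<le> \<phi> r"
        "B (Suc n) \<le> r ^ 4"
        using B'[of n] unfolding A_def by blast
      have "1 / (real n + 2) < d" using n d(1) by (simp add: field_simps)
      then have cr: "c < s.G (r^2) / \<phi> r" using d(2)[of r] r by (simp add: deriv_f)
      have Ai: "inverse (A n) > 0" using s.A_pos[of n] by simp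
      have "s.S 1 (r^2) \<le> inverse (A n) + B (Suc n) / (r^2)^2" using r by (intro s.S_1_split) simp
      also have "B (Suc n) / (r^2)^2 \<le> 1" using r by (simp add: field_simps)
      finally have S: "s.S 1 (r^2) \<le> inverse (A n) + 1" by simp
      have "s.G (r^2) \<le> (2 * real ?N + 4) * s.S 1 (r^2)" using r by (intro s.G_le) simp
      also have "\<dots> \<le> (2 * real ?N + 4) * (inverse (A n) + 1)" using S by (intro mult_left_mono) auto
      also have "\<dots> \<le> c * (real n + 1) * (inverse (A n) + 1)"
        using n c(1) Ai by (intro mult_right_mono) (auto simp: field_simps)
      also have "\<dots> \<le> c * \<phi> r" using r(3) c(1) by (simp add: mult.assoc)
      finally have "s.G (r^2) \<le> c * \<phi> r" .
      moreover have "\<phi> r > 0" using r(3) Ai by (smt (verit) mult_pos_pos of_nat_0_le_iff)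
      ultimately show False using cr by (simp add: field_simps)
    qed
  qed
  moreover have "mono_on {0..} s.f" by (intro mono_onI u.f_mono)
  moreover have "convex_on {0..} s.f" using s.convex_f by (rule convex_on_subset) simp_all
  ultimately show ?thesis
    using s.smooth_f u.f_pos s.f_superlinear ext unbounded
    by (intro exI[of _ s.f] conjI exI[of _ ?ustar] exI[of _ ?U]) (auto simp: dot_square_norm)
qed

end
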